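(* Let $\alpha$ be a smooth function of involutive and non-generic type, and let $F_2\colon I_2\times J_2\to\mathbb R^3$ be the map associated with the integral manifold $S_2$ determined by smooth functions $\xi(t),\mu(t)$ as described in the context. If a point $(s_0,t_0)\in S(F_2)$ satisfies $$\left(\widetilde{\overline{\alpha_q+\alpha\alpha_p}}\right)_t(s_0,t_0)-\xi'''(t_0)\neq0,$$ then $F_2$ is a cuspidal edge at $(s_0,t_0)$.
   Context: All objects are $C^\infty$ and all considerations are local. $(x,y,z,p,q)$ are canonical coordinates on $J^1(2,1)=PT^*J^0(2,1)$, $\dim J^0(2,1)=3$, in which the contact form is $dz-p\,dx-q\,dy$; $J^0(2,1)$ is locally identified with $\mathbb R^3$ via $(x,y,z)$. The function $\alpha=\alpha(x,y,z,p,q)$ is of involutive type if $\alpha_x+p\alpha_z-\alpha(\alpha_y+q\alpha_z)=0$ on its domain, and of non-generic type if $1+x(\alpha_y+q\alpha_z)=0$ on its domain. Define the local diffeomorphism $\Phi_2(x,y,z,p,q)=(x_0,\dots,x_4)=(x,\ \alpha,\ z-px-qy,\ p,\ q)$, with a local inverse $\Phi_2^{-1}$ on an open set $V_2\subset\mathbb R\times U_2$ (product of an open interval and an open $U_2\subset\mathbb R^4$); let $\varphi_2,\psi_2$ be its second ($y$) and third ($z$) components. Put $\beta=y+\alpha x$; the function $\overline\beta=\beta\circ\Phi_2^{-1}$ does not depend on $x_0$ and is regarded as a function of $(x_1,x_2,x_3,x_4)$. Let $\xi(t)$ be a smooth function and $\mu(t)$ a solution of $\mu'(t)=-\overline\beta(\xi'(t),\mu(t),\xi(t),t)$.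 For open intervals $I_2,J_2$ with $(s,\xi'(t),\mu(t),\xi(t),t)\in V_2$ for $(s,t)\in I_2\times J_2$, put $\Theta_2(s,t)=\Phi_2^{-1}(s,\xi'(t),\mu(t),\xi(t),t)$; its image $S_2$ is a two-dimensional integral manifold of the ideal generated by $dz-p\,dx-q\,dy$, $dp-\alpha\,dq$ and their exterior derivatives. For a function $g$ of $(x,y,z,p,q)$ write $\widetilde{\overline g}=g\circ\Theta_2\colon I_2\times J_2\to\mathbb R$. The map associated with $S_2$ is $$F_2(s,t)=(s,\ \varphi_2(s,\xi'(t),\mu(t),\xi(t),t),\ \psi_2(s,\xi'(t),\mu(t),\xi(t),t)),$$ and $S(F_2)$ is the set of its singular points (where $\mathrm{rank}\,dF_2<2$). Two map germs $f\colon(\mathbb R^2,a)\to(\mathbb R^3,f(a))$, $g\colon(\mathbb R^2,b)\to(\mathbb R^3,g(b))$ are right-left equivalent if $\psi\circ f=g\circ\varphi$ for some diffeomorphism germs $\varphi\colon(\mathbb R^2,a)\to(\mathbb R^2,b)$ and $\psi\colon(\mathbb R^3,f(a))\to(\mathbb R^3,g(b))$. A map is a cuspidal edge at a point if its germ there is right-left equivalent to the germ at the origin of $(u,v)\mapsto(u,v^2,v^3)$. *)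

theory Defs
  imports "HOL-Analysis.Analysis"
begin

text \<open>For \<open>S\<close> open (the only case used below), \<open>Ck_on n S f\<close> says that \<open>f\<close> is of class \<open>C^n\<close>
  on \<open>S\<close>: in finite dimension it suffices to control the derivative along each fixed vector \<open>v\<close>.\<close>

primrec Ck_on :: "nat \<Rightarrow> 'a::euclidean_space set \<Rightarrow> ('a \<Rightarrow> 'b::euclidean_space) \<Rightarrow> bool" where
  "Ck_on 0 S f \<longleftrightarrow> continuous_on S f"
| "Ck_on (Suc n) S f \<longleftrightarrow>
     (\<forall>x\<in>S. f differentiable (at x)) \<and> (\<forall>v. Ck_on n S (\<lambda>x. frechet_derivative f (at x) v))"

definition smooth_on :: "'a::euclidean_space set \<Rightarrow> ('a \<Rightarrow> 'b::euclidean_space) \<Rightarrow> bool" where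
  "smooth_on S f \<longleftrightarrow> (\<forall>n. Ck_on n S f)"

definition diffeomorphism_with_inverse ::
  "'a::euclidean_space set \<Rightarrow> 'b::euclidean_space set \<Rightarrow> ('a \<Rightarrow> 'b) \<Rightarrow> ('b \<Rightarrow> 'a) \<Rightarrow> bool" where
  "diffeomorphism_with_inverse A B f g \<longleftrightarrow>
     open A \<and> open B \<and> f ` A = B \<and> g ` B = A \<and>
     (\<forall>x\<in>A. g (f x) = x) \<and> (\<forall>y\<in>B. f (g y) = y) \<and> smooth_on A f \<and> smooth_on B g"

text \<open>Germs are represented by total functions, of which only the values near the base point
  matter.\<close>

definition smooth_germ :: "('a::euclidean_space \<Rightarrow> 'b::euclidean_space) \<Rightarrow> 'a \<Rightarrow> bool" where
  "smooth_germ f a \<longleftrightarrow> (\<exists>N. open N \<and> a \<in> N \<and> smooth_on N f)"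

definition diffeomorphism_germ ::
  "('a::euclidean_space \<Rightarrow> 'b::euclidean_space) \<Rightarrow> 'a \<Rightarrow> 'b \<Rightarrow> bool" where
  "diffeomorphism_germ f a b \<longleftrightarrow>
     (\<exists>N M g. a \<in> N \<and> f a = b \<and> diffeomorphism_with_inverse N M f g)"

definition right_left_equivalent ::
  "('a::euclidean_space \<Rightarrow> 'b::euclidean_space) \<Rightarrow> 'a \<Rightarrow> ('a \<Rightarrow> 'b) \<Rightarrow> 'a \<Rightarrow> bool" where
  "right_left_equivalent f a g b \<longleftrightarrow>
     smooth_germ f a \<and> smooth_germ g b \<and>
     (\<exists>\<phi> \<psi>. diffeomorphism_germ \<phi> a b \<and> diffeomorphism_germ \<psi> (f a) (g b) \<and>
        (\<forall>\<^sub>F w in nhds a. \<psi> (f w) = g (\<phi> w)))"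

definition cuspidal_edge_at :: "(real \<times> real \<Rightarrow> real \<times> real \<times> real) \<Rightarrow> real \<times> real \<Rightarrow> bool" where
  "cuspidal_edge_at f a \<longleftrightarrow> right_left_equivalent f a (\<lambda>(u, v). (u, v ^ 2, v ^ 3)) (0, 0)"

text \<open>The rank of the differential is the dimension of its image.\<close>

definition singular_set ::
  "(real \<times> real) set \<Rightarrow> (real \<times> real \<Rightarrow> real \<times> real \<times> real) \<Rightarrow> (real \<times> real) set" where
  "singular_set A F = {a \<in> A. dim (range (frechet_derivative F (at a))) < 2}"

definition open_interval :: "real set \<Rightarrow> bool" where
  "open_interval I \<longleftrightarrow> open I \<and> is_interval I"

text \<open>A point of \<open>J^1(2,1)\<close> is given by its canonical coordinates \<open>(x, y, z, p, q)\<close>; the same type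
  carries the coordinates \<open>(x0, x1, x2, x3, x4)\<close>.\<close>

type_synonym R4 = "real \<times> real \<times> real \<times> real"
type_synonym R5 = "real \<times> R4"

definition D_x :: "(R5 \<Rightarrow> real) \<Rightarrow> R5 \<Rightarrow> real" where
  "D_x f = (\<lambda>(x, y, z, p, q). deriv (\<lambda>r. f (r, y, z, p, q)) x)"

definition D_y :: "(R5 \<Rightarrow> real) \<Rightarrow> R5 \<Rightarrow> real" where
  "D_y f = (\<lambda>(x, y, z, p, q). deriv (\<lambda>r. f (x, r, z, p, q)) y)"

definition D_z :: "(R5 \<Rightarrow> real) \<Rightarrow> R5 \<Rightarrow> real" where
  "D_z f = (\<lambda>(x, y, z, p, q). deriv (\<lambda>r. f (x, y, r, p, q)) z)"

definition D_p :: "(R5 \<Rightarrow> real) \<Rightarrow> R5 \<Rightarrow> real" where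
  "D_p f = (\<lambda>(x, y, z, p, q). deriv (\<lambda>r. f (x, y, z, r, q)) p)"

definition D_q :: "(R5 \<Rightarrow> real) \<Rightarrow> R5 \<Rightarrow> real" where
  "D_q f = (\<lambda>(x, y, z, p, q). deriv (\<lambda>r. f (x, y, z, p, r)) q)"

definition involutive_type :: "R5 set \<Rightarrow> (R5 \<Rightarrow> real) \<Rightarrow> bool" where
  "involutive_type D \<alpha> \<longleftrightarrow>
     (\<forall>(x, y, z, p, q)\<in>D. let w = (x, y, z, p, q) in
        D_x \<alpha> w + p * D_z \<alpha> w - \<alpha> w * (D_y \<alpha> w + q * D_z \<alpha> w) = 0)"

definition nongeneric_type :: "R5 set \<Rightarrow> (R5 \<Rightarrow> real) \<Rightarrow> bool" where
  "nongeneric_type D \<alpha> \<longleftrightarrow>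
     (\<forall>(x, y, z, p, q)\<in>D. let w = (x, y, z, p, q) in
        1 + x * (D_y \<alpha> w + q * D_z \<alpha> w) = 0)"

definition Phi2 :: "(R5 \<Rightarrow> real) \<Rightarrow> R5 \<Rightarrow> R5" where
  "Phi2 \<alpha> = (\<lambda>(x, y, z, p, q). (x, \<alpha> (x, y, z, p, q), z - p * x - q * y, p, q))"

definition beta :: "(R5 \<Rightarrow> real) \<Rightarrow> R5 \<Rightarrow> real" where
  "beta \<alpha> = (\<lambda>(x, y, z, p, q). y + \<alpha> (x, y, z, p, q) * x)"

text \<open>Throughout, \<open>\<Psi>\<close> stands for the local inverse of \<open>Phi2 \<alpha>\<close>, defined on \<open>V2 = K \<times> U2\<close> with \<open>K\<close>
  an open interval.\<close>

text \<open>\<open>beta_bar\<close> is \<open>beta \<alpha> \<circ> \<Psi>\<close> as a function of \<open>(x1, x2, x3, x4)\<close>: the common value over all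
  \<open>x0 \<in> K\<close>. For \<open>\<alpha>\<close> of involutive and non-generic type the composite does not depend on \<open>x0\<close>, so
  that the description is proper for arguments in \<open>U2\<close>.\<close>

definition beta_bar :: "(R5 \<Rightarrow> real) \<Rightarrow> real set \<Rightarrow> (R5 \<Rightarrow> R5) \<Rightarrow> R4 \<Rightarrow> real" where
  "beta_bar \<alpha> K \<Psi> w = (THE b. \<forall>x0\<in>K. beta \<alpha> (\<Psi> (x0, w)) = b)"

definition phi2 :: "(R5 \<Rightarrow> R5) \<Rightarrow> R5 \<Rightarrow> real" where
  "phi2 \<Psi> v = (case \<Psi> v of (x, y, z, p, q) \<Rightarrow> y)"

definition psi2 :: "(R5 \<Rightarrow> R5) \<Rightarrow> R5 \<Rightarrow> real" where
  "psi2 \<Psi> v = (case \<Psi> v of (x, y, z, p, q) \<Rightarrow> z)"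

definition Theta2 :: "(R5 \<Rightarrow> R5) \<Rightarrow> (real \<Rightarrow> real) \<Rightarrow> (real \<Rightarrow> real) \<Rightarrow> real \<times> real \<Rightarrow> R5" where
  "Theta2 \<Psi> \<xi> \<mu> = (\<lambda>(s, t). \<Psi> (s, deriv \<xi> t, \<mu> t, \<xi> t, t))"

definition F2 :: "(R5 \<Rightarrow> R5) \<Rightarrow> (real \<Rightarrow> real) \<Rightarrow> (real \<Rightarrow> real) \<Rightarrow> real \<times> real \<Rightarrow> real \<times> real \<times> real" where
  "F2 \<Psi> \<xi> \<mu> = (\<lambda>(s, t). (s, phi2 \<Psi> (s, deriv \<xi> t, \<mu> t, \<xi> t, t), psi2 \<Psi> (s, deriv \<xi> t, \<mu> t, \<xi> t, t)))"

end

theory Submission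
  imports Defs
begin

text \<open>For involutive non-generic \<open>\<alpha>\<close> the function \<open>y + \<alpha> x\<close> is constant along the \<open>x0\<close>-lines, so the
  equation for \<open>\<mu>\<close> makes the map explicit: \<open>F\<^sub>2(s, t) = (s, y, z)\<close> with \<open>y = - \<mu>' - s \<xi>'\<close> and
  \<open>z = \<mu> + s \<xi> + t y\<close>, whence \<open>z\<^sub>t = t y\<^sub>t\<close>. Differentiating \<open>\<alpha> = \<xi>'(t)\<close> along the surface and using
  \<open>x (\<alpha>\<^sub>y + q \<alpha>\<^sub>z) = - 1\<close> gives \<open>\<alpha>\<^sub>q + \<alpha> \<alpha>\<^sub>p = \<xi>'' + y\<^sub>t / s\<close>; so the hypothesis says \<open>y\<^sub>t\<^sub>t \<noteq> 0\<close>, and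
  singular points are those with \<open>y\<^sub>t = 0\<close>. For fixed \<open>s\<close> the curve \<open>t \<mapsto> (y, z)\<close> then has an ordinary
  cusp at a point \<open>\<tau>(s)\<close> depending smoothly on \<open>s\<close>. In suitable coordinates it reads
  \<open>(v\<^sup>2, v\<^sup>3 (E\<^sub>0(s, v\<^sup>2) + v E\<^sub>1(s, v\<^sup>2)))\<close>, where Whitney's theorem on even functions, with a parameter,
  provides \<open>E\<^sub>0\<close> and \<open>E\<^sub>1\<close>, and the diffeomorphism \<open>(s, Y, Z) \<mapsto> (s, Y, (Z - Y\<^sup>2 E\<^sub>1(s, Y)) / E\<^sub>0(s, Y))\<close>
  of the target brings it to \<open>(v\<^sup>2, v\<^sup>3)\<close>.\<close>

section \<open>Calculus of smooth functions\<close>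

text \<open>The surface covers only the side \<open>Y >= 0\<close> of its target, whereas the change
  of coordinates must be a diffeomorphism of a full neighbourhood. So \<open>E0\<close> and
  \<open>E1\<close> must be smooth for negative arguments too, and jointly in \<open>s\<close>; this
  makes Whitney's theorem the main cost. An extension chosen separately for each \<open>s\<close>
  would say nothing about smoothness in \<open>s\<close>. Seeley's extension is one linear formula
  with universal coefficients, built from the values of the function at
  \<open>sqrt (2 ^ k * - w)\<close>, so differentiation in \<open>s\<close> passes through it. Its
  coefficients come from Euler's product with zeros at the powers of 2. One principle yields joint
  smoothness of both integral averages and extensions: continuous functions forming a family closed
  under both partial derivatives are smooth. The integer index in \<open>avg\<close> and in
  \<open>seeley\<close> exists to make these families closed. The relation between \<open>y\<close>
  and \<open>z\<close> says that \<open>t\<close> is the slope of the plane curve. Shearing by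
  \<open>\<tau>(s) y\<close> makes the cusp tangent horizontal, and only then does the last
  coordinate vanish to third order.\<close>

lemma Ck_on_cong:
  fixes f g :: "'a::euclidean_space \<Rightarrow> 'b::euclidean_space"
  assumes "open S" "Ck_on n S f" "\<And>x. x \<in> S \<Longrightarrow> f x = g x"
  shows "Ck_on n S g"
  using assms(2,3)
proof (induction n arbitrary: f g)
  case 0
  then show ?case by (simp cong: continuous_on_cong)
next
  case (Suc n)
  have der: "(g has_derivative frechet_derivative f (at x)) (at x)" if "x \<in> S" for x
    using Suc.prems that frechet_derivative_works[of f "at x"]
    by (auto intro: has_derivative_transform_within_open[OF _ \<open>open S\<close> that])
  have "frechet_derivative f (at x) = frechet_derivative g (at x)" if "x \<in> S" for x
    using der[OF that] frechet_derivative_at by blast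
  then have "Ck_on n S (\<lambda>x. frechet_derivative g (at x) v)" for v
    using Suc.IH[of "\<lambda>x. frechet_derivative f (at x) v"] Suc.prems by auto
  then show ?case using der by (auto simp: differentiable_def)
qed

text \<open>Uniqueness of the derivative lets an explicit formula \<open>f'\<close> replace the
  opaque term \<open>frechet_derivative\<close> of the definition. The differentiation rules below
  pass through this form.\<close>

lemma Ck_on_SucI:
  fixes f :: "'a::euclidean_space \<Rightarrow> 'b::euclidean_space"
  assumes "open S" "\<And>x. x \<in> S \<Longrightarrow> (f has_derivative f' x) (at x)"
    and "\<And>v. Ck_on n S (\<lambda>x. f' x v)"
  shows "Ck_on (Suc n) S f"
proof -
  have "f' x = frechet_derivative f (at x)" if "x \<in> S" for x
    using assms(2)[OF that] frechet_derivative_at by blast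
  then have "Ck_on n S (\<lambda>x. frechet_derivative f (at x) v)" for v
    using Ck_on_cong[OF assms(1) assms(3), where g = "\<lambda>x. frechet_derivative f (at x) v"] by simp
  then show ?thesis using assms(2) by (auto simp: differentiable_def)
qed

lemma Ck_on_Suc_has_derivative:
  "Ck_on (Suc n) S f \<Longrightarrow> x \<in> S \<Longrightarrow> (f has_derivative frechet_derivative f (at x)) (at x)"
  using frechet_derivative_works by auto

lemma Ck_on_Suc_frechet_derivative:
  "Ck_on (Suc n) S f \<Longrightarrow> Ck_on n S (\<lambda>x. frechet_derivative f (at x) v)"
  by simp

lemma Ck_on_imp_continuous_on: "Ck_on n S f \<Longrightarrow> continuous_on S f"
proof (cases n)
  case (Suc m)
  moreover assume "Ck_on n S f"
  ultimately show ?thesis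
    using Ck_on_Suc_has_derivative[of m S f] has_derivative_continuous continuous_at_imp_continuous_on
    by blast
qed simp

lemma Ck_on_SucD: "Ck_on (Suc n) S f \<Longrightarrow> Ck_on n S f"
proof (induction n arbitrary: f)
  case 0
  from Ck_on_imp_continuous_on[OF this] show ?case by simp
next
  case (Suc n)
  have "Ck_on n S (\<lambda>x. frechet_derivative f (at x) v)" for v
    by (rule Suc.IH[OF Ck_on_Suc_frechet_derivative[OF Suc.prems]])
  with Suc.prems show ?case by simp
qed

lemma Ck_on_subset: "Ck_on n S f \<Longrightarrow> T \<subseteq> S \<Longrightarrow> Ck_on n T f"
  by (induction n arbitrary: f) (auto intro: continuous_on_subset)

lemma Ck_on_Union:
  assumes "\<And>U. U \<in> \<U> \<Longrightarrow> open U" "\<And>U. U \<in> \<U> \<Longrightarrow> Ck_on n U f"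
  shows "Ck_on n (\<Union>\<U>) f"
  using assms(2)
proof (induction n arbitrary: f)
  case 0
  then show ?case using continuous_on_open_Union[of \<U>] assms(1) by auto
qed auto

lemma Ck_on_bounded_linear_comp:
  fixes f :: "'a::euclidean_space \<Rightarrow> 'b::euclidean_space" and L :: "'b \<Rightarrow> 'c::euclidean_space"
  assumes "bounded_linear L" "open S" "Ck_on n S f"
  shows "Ck_on n S (\<lambda>x. L (f x))"
  using assms(3)
proof (induction n arbitrary: f)
  case 0
  then show ?case using bounded_linear.continuous_on[OF assms(1), of S f] by simp
next
  case (Suc n)
  show ?case
  proof (rule Ck_on_SucI[OF assms(2)])
    show "((\<lambda>x. L (f x)) has_derivative (\<lambda>v. L (frechet_derivative f (at x) v))) (at x)"
      if "x \<in> S" for x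
      by (rule bounded_linear.has_derivative[OF assms(1) Ck_on_Suc_has_derivative[OF Suc.prems that]])
    show "Ck_on n S (\<lambda>x. L (frechet_derivative f (at x) v))" for v
      by (rule Suc.IH[OF Ck_on_Suc_frechet_derivative[OF Suc.prems]])
  qed
qed

lemma Ck_on_const: "open S \<Longrightarrow> Ck_on n S (\<lambda>x. c)"
proof (induction n arbitrary: c)
  case (Suc n)
  show ?case
    by (rule Ck_on_SucI[OF Suc.prems has_derivative_const Suc.IH[OF Suc.prems]])
qed simp

lemma Ck_on_add:
  fixes f g :: "'a::euclidean_space \<Rightarrow> 'b::euclidean_space"
  assumes "open S" "Ck_on n S f" "Ck_on n S g"
  shows "Ck_on n S (\<lambda>x. f x + g x)"
  using assms(2,3)
proof (induction n arbitrary: f g)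
  case 0
  then show ?case using continuous_on_add[of S f g] by simp
next
  case (Suc n)
  show ?case
  proof (rule Ck_on_SucI[OF assms(1)])
    show "((\<lambda>x. f x + g x) has_derivative
        (\<lambda>v. frechet_derivative f (at x) v + frechet_derivative g (at x) v)) (at x)"
      if "x \<in> S" for x
      by (rule has_derivative_add[OF Ck_on_Suc_has_derivative[OF Suc.prems(1) that]
            Ck_on_Suc_has_derivative[OF Suc.prems(2) that]])
    show "Ck_on n S (\<lambda>x. frechet_derivative f (at x) v + frechet_derivative g (at x) v)" for v
      by (rule Suc.IH[OF Ck_on_Suc_frechet_derivative[OF Suc.prems(1)]
            Ck_on_Suc_frechet_derivative[OF Suc.prems(2)]])
  qed
qed

lemma Ck_on_bilinear:
  fixes f :: "'a::euclidean_space \<Rightarrow> 'b::euclidean_space" and g :: "'a \<Rightarrow> 'c::euclidean_space"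
    and B :: "'b \<Rightarrow> 'c \<Rightarrow> 'd::euclidean_space"
  assumes "bounded_bilinear B" "open S" "Ck_on n S f" "Ck_on n S g"
  shows "Ck_on n S (\<lambda>x. B (f x) (g x))"
  using assms(3,4)
proof (induction n arbitrary: f g)
  case 0
  then have "continuous_on S f" "continuous_on S g"
    by (simp_all only: Ck_on.simps)
  from bounded_bilinear.continuous_on[OF assms(1) this] show ?case
    by (simp only: Ck_on.simps)
next
  case (Suc n)
  show ?case
  proof (rule Ck_on_SucI[OF assms(2)])
    show "((\<lambda>x. B (f x) (g x)) has_derivative
        (\<lambda>v. B (f x) (frechet_derivative g (at x) v) + B (frechet_derivative f (at x) v) (g x)))
        (at x)" if "x \<in> S" for x
      by (rule bounded_bilinear.FDERIV[OF assms(1) Ck_on_Suc_has_derivative[OF Suc.prems(1) that]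
            Ck_on_Suc_has_derivative[OF Suc.prems(2) that]])
    \<comment> \<open>Each summand of the product rule has an undifferentiated factor, still of
      class \<open>Suc n\<close>; \<open>Ck_on_SucD\<close> lowers it to the class of the induction
      hypothesis.\<close>
    show "Ck_on n S (\<lambda>x. B (f x) (frechet_derivative g (at x) v)
        + B (frechet_derivative f (at x) v) (g x))" for v
      by (rule Ck_on_add[OF assms(2) Suc.IH[OF Ck_on_SucD[OF Suc.prems(1)] Ck_on_Suc_frechet_derivative[OF Suc.prems(2)]]
            Suc.IH[OF Ck_on_Suc_frechet_derivative[OF Suc.prems(1)] Ck_on_SucD[OF Suc.prems(2)]]])
  qed
qed

lemma Ck_on_sum:
  fixes f :: "'i \<Rightarrow> 'a::euclidean_space \<Rightarrow> 'b::euclidean_space"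
  assumes "open S" "\<And>i. i \<in> I \<Longrightarrow> Ck_on n S (f i)"
  shows "Ck_on n S (\<lambda>x. \<Sum>i\<in>I. f i x)"
  using assms(2)
proof (induction I rule: infinite_finite_induct)
  case (insert i I)
  then show ?case
    using Ck_on_add[OF assms(1), of n "f i" "\<lambda>x. \<Sum>i\<in>I. f i x"] by simp
qed (simp_all add: Ck_on_const assms(1))

lemma Ck_on_compose:
  fixes f :: "'a::euclidean_space \<Rightarrow> 'b::euclidean_space" and g :: "'b \<Rightarrow> 'c::euclidean_space"
  assumes "open S" "open T" "f ` S \<subseteq> T" "Ck_on n S f" "Ck_on n T g"
  shows "Ck_on n S (\<lambda>x. g (f x))"
  using assms(4,5)
proof (induction n arbitrary: g)
  case 0
  then have "continuous_on S f" "continuous_on T g"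
    by (simp_all only: Ck_on.simps)
  from continuous_on_compose2[OF this(2,1) assms(3)] show ?case
    by (simp only: Ck_on.simps)
next
  case (Suc n)
  let ?f' = "\<lambda>x. frechet_derivative f (at x)" and ?g' = "\<lambda>y. frechet_derivative g (at y)"
  show ?case
  proof (rule Ck_on_SucI[OF assms(1)])
    fix x assume x: "x \<in> S"
    have f: "(f has_derivative ?f' x) (at x)"
      by (rule Ck_on_Suc_has_derivative[OF Suc.prems(1) x])
    have g: "(g has_derivative ?g' (f x)) (at (f x))"
      using assms(3) x by (intro Ck_on_Suc_has_derivative[OF Suc.prems(2)]) auto
    have lin: "linear (?g' (f x))" using g has_derivative_linear by blast
    \<comment> \<open>\<open>Ck_on\<close> controls derivatives along fixed vectors, but the chain
      rule applies \<open>?g' (f x)\<close> to the moving vector \<open>?f' x v\<close>. Expansion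
      in the basis leaves fixed directions \<open>b\<close> with scalar coefficients.\<close>
    have eq: "?g' (f x) w = (\<Sum>b\<in>Basis. (w \<bullet> b) *\<^sub>R ?g' (f x) b)" for w
    proof -
      have "?g' (f x) w = ?g' (f x) (\<Sum>b\<in>Basis. (w \<bullet> b) *\<^sub>R b)"
        by (simp only: euclidean_representation)
      also have "\<dots> = (\<Sum>b\<in>Basis. (w \<bullet> b) *\<^sub>R ?g' (f x) b)"
        by (simp only: linear_sum[OF lin] linear_scale[OF lin])
      finally show ?thesis .
    qed
    show "((\<lambda>x. g (f x)) has_derivative
        (\<lambda>v. \<Sum>b\<in>Basis. (?f' x v \<bullet> b) *\<^sub>R ?g' (f x) b)) (at x)"
      by (rule has_derivative_eq_rhs[OF has_derivative_compose[OF f g]]) (rule ext, rule eq)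
  next
    show "Ck_on n S (\<lambda>x. \<Sum>b\<in>Basis. (?f' x v \<bullet> b) *\<^sub>R ?g' (f x) b)" for v
    proof (rule Ck_on_sum[OF assms(1)])
      fix b :: 'b assume "b \<in> Basis"
      have "Ck_on n S (\<lambda>x. ?g' (f x) b)"
        by (rule Suc.IH[OF Ck_on_SucD[OF Suc.prems(1)] Ck_on_Suc_frechet_derivative[OF Suc.prems(2)]])
      moreover have "Ck_on n S (\<lambda>x. ?f' x v \<bullet> b)"
        by (rule Ck_on_bounded_linear_comp[OF bounded_linear_inner_left assms(1)
              Ck_on_Suc_frechet_derivative[OF Suc.prems(1)]])
      ultimately show "Ck_on n S (\<lambda>x. (?f' x v \<bullet> b) *\<^sub>R ?g' (f x) b)"
        by (rule Ck_on_bilinear[OF bounded_bilinear_scaleR assms(1), rotated])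
    qed
  qed
qed

section \<open>Closure properties of smooth functions\<close>

lemma smooth_on_cong:
  "open S \<Longrightarrow> smooth_on S f \<Longrightarrow> (\<And>x. x \<in> S \<Longrightarrow> f x = g x) \<Longrightarrow> smooth_on S g"
  using Ck_on_cong unfolding smooth_on_def by blast

lemma smooth_on_subset: "smooth_on S f \<Longrightarrow> T \<subseteq> S \<Longrightarrow> smooth_on T f"
  using Ck_on_subset unfolding smooth_on_def by blast

lemma smooth_on_Un:
  "open S \<Longrightarrow> open T \<Longrightarrow> smooth_on S f \<Longrightarrow> smooth_on T f \<Longrightarrow> smooth_on (S \<union> T) f"
  unfolding smooth_on_def using Ck_on_Union[of "{S, T}" _ f] by auto

lemma smooth_on_imp_continuous_on: "smooth_on S f \<Longrightarrow> continuous_on S f"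
  unfolding smooth_on_def using Ck_on.simps(1) by blast

lemma smooth_on_has_derivative:
  "smooth_on S f \<Longrightarrow> x \<in> S \<Longrightarrow> (f has_derivative frechet_derivative f (at x)) (at x)"
  unfolding smooth_on_def using Ck_on_Suc_has_derivative by blast

lemma smooth_on_frechet_derivative:
  "smooth_on S f \<Longrightarrow> smooth_on S (\<lambda>x. frechet_derivative f (at x) v)"
  unfolding smooth_on_def using Ck_on_Suc_frechet_derivative by blast

lemma smooth_on_const: "open S \<Longrightarrow> smooth_on S (\<lambda>x. c)"
  by (simp add: smooth_on_def Ck_on_const)

lemma smooth_on_bounded_linear: "open S \<Longrightarrow> bounded_linear L \<Longrightarrow> smooth_on S L"
  unfolding smooth_on_def
proof
  fix n assume L: "open S" "bounded_linear L"
  show "Ck_on n S L"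
  proof (cases n)
    case (Suc m)
    then show ?thesis
      by (simp only: Suc)
        (rule Ck_on_SucI[OF L(1) bounded_linear_imp_has_derivative[OF L(2)] Ck_on_const[OF L(1)]])
  qed (simp add: L linear_continuous_on)
qed

lemma smooth_on_id: "open S \<Longrightarrow> smooth_on S (\<lambda>x. x)"
  by (rule smooth_on_bounded_linear[OF _ bounded_linear_ident])

lemma smooth_on_compose:
  "open S \<Longrightarrow> open T \<Longrightarrow> f ` S \<subseteq> T \<Longrightarrow> smooth_on S f \<Longrightarrow> smooth_on T g \<Longrightarrow>
    smooth_on S (\<lambda>x. g (f x))"
  using Ck_on_compose unfolding smooth_on_def by blast

lemma smooth_on_add:
  "open S \<Longrightarrow> smooth_on S f \<Longrightarrow> smooth_on S g \<Longrightarrow> smooth_on S (\<lambda>x. f x + g x)"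
  unfolding smooth_on_def by (blast intro: Ck_on_add)

lemma smooth_on_mult:
  fixes f g :: "'a::euclidean_space \<Rightarrow> real"
  shows "open S \<Longrightarrow> smooth_on S f \<Longrightarrow> smooth_on S g \<Longrightarrow> smooth_on S (\<lambda>x. f x * g x)"
  unfolding smooth_on_def by (blast intro: Ck_on_bilinear[OF bounded_bilinear_mult])

lemma smooth_on_uminus: "open S \<Longrightarrow> smooth_on S f \<Longrightarrow> smooth_on S (\<lambda>x. - f x)"
  unfolding smooth_on_def
  by (blast intro: Ck_on_bounded_linear_comp[OF bounded_linear_minus[OF bounded_linear_ident]])

lemma smooth_on_diff:
  "open S \<Longrightarrow> smooth_on S f \<Longrightarrow> smooth_on S g \<Longrightarrow> smooth_on S (\<lambda>x. f x - g x)"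
  using smooth_on_add[OF _ _ smooth_on_uminus, of S f g] by simp

lemma smooth_on_power:
  fixes f :: "'a::euclidean_space \<Rightarrow> real"
  shows "open S \<Longrightarrow> smooth_on S f \<Longrightarrow> smooth_on S (\<lambda>x. f x ^ n)"
  by (induction n) (simp_all add: smooth_on_const smooth_on_mult[of S f])

lemma smooth_on_Pair:
  fixes f :: "'a::euclidean_space \<Rightarrow> 'b::euclidean_space" and g :: "'a \<Rightarrow> 'c::euclidean_space"
  assumes "open S" "smooth_on S f" "smooth_on S g"
  shows "smooth_on S (\<lambda>x. (f x, g x))"
proof -
  have "smooth_on S (\<lambda>x. (f x, 0 :: 'c))"
    using assms Ck_on_bounded_linear_comp[OF bounded_linear_Pair[OF bounded_linear_ident bounded_linear_zero]]
    unfolding smooth_on_def by blast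
  moreover have "smooth_on S (\<lambda>x. (0 :: 'b, g x))"
    using assms Ck_on_bounded_linear_comp[OF bounded_linear_Pair[OF bounded_linear_zero bounded_linear_ident]]
    unfolding smooth_on_def by blast
  ultimately show ?thesis using smooth_on_add[OF assms(1), of "\<lambda>x. (f x, 0)" "\<lambda>x. (0, g x)"] by simp
qed

lemma smooth_on_fst: "open S \<Longrightarrow> smooth_on S f \<Longrightarrow> smooth_on S (\<lambda>x. fst (f x))"
  unfolding smooth_on_def by (blast intro: Ck_on_bounded_linear_comp[OF bounded_linear_fst])

lemma smooth_on_snd: "open S \<Longrightarrow> smooth_on S f \<Longrightarrow> smooth_on S (\<lambda>x. snd (f x))"
  unfolding smooth_on_def by (blast intro: Ck_on_bounded_linear_comp[OF bounded_linear_snd])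

text \<open>The common reason why reciprocals, square roots and inverse functions are smooth: their derivative
  is a smooth function of their value.\<close>

lemma smooth_on_autonomous:
  fixes G :: "'a::euclidean_space \<Rightarrow> 'b::euclidean_space" and H :: "'a \<Rightarrow> 'b \<Rightarrow> 'b"
  assumes "open V" "open U" "G ` V \<subseteq> U" "\<And>v. smooth_on U (H v)"
    and der: "\<And>w. w \<in> V \<Longrightarrow> (G has_derivative (\<lambda>v. H v (G w))) (at w)"
  shows "smooth_on V G"
  unfolding smooth_on_def
proof
  fix n show "Ck_on n V G"
  proof (induction n)
    case 0
    then show ?case
      using der has_derivative_continuous continuous_at_imp_continuous_on by (simp, blast)
  next
    case (Suc n)
    have "Ck_on n V (\<lambda>w. H v (G w))" for v
      using assms(4)[of v] by (intro Ck_on_compose[OF assms(1-3) Suc]) (simp add: smooth_on_def)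
    from Ck_on_SucI[OF assms(1) der this] show ?case .
  qed
qed

lemma smooth_on_inverse:
  fixes f :: "'a::euclidean_space \<Rightarrow> real"
  assumes "open S" "smooth_on S f" "\<And>x. x \<in> S \<Longrightarrow> f x \<noteq> 0"
  shows "smooth_on S (\<lambda>x. inverse (f x))"
proof (rule smooth_on_compose[OF assms(1) _ _ assms(2)])
  show op: "open (- {0 :: real})" by blast
  show "f ` S \<subseteq> - {0}" using assms(3) by auto
  show "smooth_on (- {0 :: real}) inverse"
  proof (rule smooth_on_autonomous[OF op open_UNIV subset_UNIV, where H = "\<lambda>v y. - (v * y\<^sup>2)"])
    show "smooth_on UNIV (\<lambda>y. - (v * y\<^sup>2))" for v :: real
      by (rule smooth_on_uminus[OF open_UNIV smooth_on_mult[OF open_UNIV smooth_on_const[OF open_UNIV]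
              smooth_on_power[OF open_UNIV smooth_on_id[OF open_UNIV]]]])
    show "(inverse has_derivative (\<lambda>v. - (v * (inverse w)\<^sup>2))) (at w)"
      if "w \<in> - {0}" for w :: real
      using that by (auto intro!: derivative_eq_intros simp: power2_eq_square fun_eq_iff)
  qed
qed

lemma smooth_on_divide:
  fixes f g :: "'a::euclidean_space \<Rightarrow> real"
  assumes "open S" "smooth_on S f" "smooth_on S g" "\<And>x. x \<in> S \<Longrightarrow> g x \<noteq> 0"
  shows "smooth_on S (\<lambda>x. f x / g x)"
  unfolding divide_inverse
  by (rule smooth_on_mult[OF assms(1,2) smooth_on_inverse[OF assms(1,3,4)]])

lemma smooth_on_sqrt:
  fixes f :: "'a::euclidean_space \<Rightarrow> real"
  assumes "open S" "smooth_on S f" "\<And>x. x \<in> S \<Longrightarrow> f x > 0"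
  shows "smooth_on S (\<lambda>x. sqrt (f x))"
proof (rule smooth_on_compose[OF assms(1) _ _ assms(2)])
  show op: "open {0 :: real <..}" by simp
  show "f ` S \<subseteq> {0<..}" using assms(3) by auto
  show "smooth_on {0<..} sqrt"
  proof (rule smooth_on_autonomous[OF op op, where H = "\<lambda>v y. v * inverse y / 2"])
    show "sqrt ` {0<..} \<subseteq> {0<..}" by auto
    show "smooth_on {0<..} (\<lambda>y. v * inverse y / 2)" for v :: real
      unfolding divide_inverse
      by (rule smooth_on_mult[OF op smooth_on_mult[OF op smooth_on_const[OF op]
            smooth_on_inverse[OF op smooth_on_id[OF op]]] smooth_on_const[OF op]]) simp
    show "(sqrt has_derivative (\<lambda>v. v * inverse (sqrt w) / 2)) (at w)"
      if "w \<in> {0<..}" for w :: real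
      using that by (auto intro!: derivative_eq_intros simp: fun_eq_iff field_simps)
  qed
qed

section \<open>Functions of two real variables\<close>

definition D1 :: "(real \<times> real \<Rightarrow> real) \<Rightarrow> real \<times> real \<Rightarrow> real" where
  "D1 f x = frechet_derivative f (at x) (1, 0)"

definition D2 :: "(real \<times> real \<Rightarrow> real) \<Rightarrow> real \<times> real \<Rightarrow> real" where
  "D2 f x = frechet_derivative f (at x) (0, 1)"

lemma smooth_on_D1: "smooth_on S f \<Longrightarrow> smooth_on S (D1 f)"
  unfolding D1_def[abs_def] by (rule smooth_on_frechet_derivative)

lemma smooth_on_D2: "smooth_on S f \<Longrightarrow> smooth_on S (D2 f)"
  unfolding D2_def[abs_def] by (rule smooth_on_frechet_derivative)

lemma linear_on_plane:
  fixes L :: "real \<times> real \<Rightarrow> real"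
  assumes "linear L"
  shows "L v = fst v * L (1, 0) + snd v * L (0, 1)"
proof -
  have "v = fst v *\<^sub>R (1, 0) + snd v *\<^sub>R (0, 1)"
    by (cases v) simp
  then have "L v = L (fst v *\<^sub>R (1, 0) + snd v *\<^sub>R (0, 1))" by simp
  also have "\<dots> = fst v * L (1, 0) + snd v * L (0, 1)"
    by (simp only: linear_add[OF assms] linear_scale[OF assms] real_scaleR_def)
  finally show ?thesis .
qed

lemma has_derivative_D1_D2:
  assumes "smooth_on S f" "x \<in> S"
  shows "(f has_derivative (\<lambda>v. fst v * D1 f x + snd v * D2 f x)) (at x)"
proof (rule has_derivative_eq_rhs)
  show der: "(f has_derivative frechet_derivative f (at x)) (at x)"
    by (rule smooth_on_has_derivative[OF assms])
  show "frechet_derivative f (at x) = (\<lambda>v. fst v * D1 f x + snd v * D2 f x)"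
    unfolding D1_def D2_def by (rule ext, rule linear_on_plane[OF has_derivative_linear[OF der]])
qed

lemma D1_DERIV:
  assumes "smooth_on S f" "(s, t) \<in> S"
  shows "((\<lambda>r. f (r, t)) has_real_derivative D1 f (s, t)) (at s)"
proof -
  have "((\<lambda>r. (r, t)) has_derivative (\<lambda>h. (h, 0))) (at s)"
    by (auto intro!: derivative_eq_intros)
  from has_derivative_compose[OF this has_derivative_D1_D2[OF assms]] show ?thesis
    unfolding has_field_derivative_def by (rule has_derivative_eq_rhs) (auto simp: fun_eq_iff)
qed

lemma D2_DERIV:
  assumes "smooth_on S f" "(s, t) \<in> S"
  shows "((\<lambda>r. f (s, r)) has_real_derivative D2 f (s, t)) (at t)"
proof -
  have "((\<lambda>r. (s, r)) has_derivative (\<lambda>h. (0, h))) (at t)"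
    by (auto intro!: derivative_eq_intros)
  from has_derivative_compose[OF this has_derivative_D1_D2[OF assms]] show ?thesis
    unfolding has_field_derivative_def by (rule has_derivative_eq_rhs) (auto simp: fun_eq_iff)
qed

lemma D2_eqI:
  assumes "smooth_on S f" "(s, t) \<in> S" "((\<lambda>r. f (s, r)) has_real_derivative d) (at t)"
  shows "D2 f (s, t) = d"
  using DERIV_unique[OF D2_DERIV[OF assms(1,2)] assms(3)] .

section \<open>Smoothness from partial derivatives, and inverses over the first variable\<close>

lemma open_prod_box:
  fixes S :: "(real \<times> real) set"
  assumes "open S" "(s, t) \<in> S"
  obtains e where "e > 0" "ball s e \<times> ball t e \<subseteq> S"
proof -
  obtain A B where AB: "open A" "open B" "(s, t) \<in> A \<times> B" "A \<times> B \<subseteq> S"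
    using open_prod_elim[OF assms] by metis
  obtain a where "a > 0" "ball s a \<subseteq> A"
    using AB open_contains_ball[of A] by auto
  moreover obtain b where "b > 0" "ball t b \<subseteq> B"
    using AB open_contains_ball[of B] by auto
  ultimately show ?thesis
    using AB(4) by (intro that[of "min a b"]) (auto simp: subset_iff)
qed

text \<open>Continuity of \<open>f2\<close> makes the increments in the second variable uniform near
  the point, so \<open>f1\<close> enters only through its value there.\<close>

lemma has_derivative_of_partials:
  fixes f f1 f2 :: "real \<times> real \<Rightarrow> real"
  assumes S: "open S" "(s, t) \<in> S"
    and f1: "((\<lambda>r. f (r, t)) has_real_derivative f1 (s, t)) (at s)"
    and f2: "\<And>a b. (a, b) \<in> S \<Longrightarrow> ((\<lambda>r. f (a, r)) has_real_derivative f2 (a, b)) (at b)"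
    and cont: "continuous_on S f2"
  shows "(f has_derivative (\<lambda>v. fst v * f1 (s, t) + snd v * f2 (s, t))) (at (s, t))"
proof -
  obtain e where e: "e > 0" "ball s e \<times> ball t e \<subseteq> S"
    using open_prod_box[OF S] .
  let ?X = "ball s e" and ?Y = "ball t e"
  have op: "open (?X \<times> ?Y)" by (simp add: open_Times)
  have "((\<lambda>(x, y). f (x, y)) has_derivative
      (\<lambda>(tx, ty). tx * f1 (s, t) + blinfun_mult_right (f2 (s, t)) ty)) (at (s, t) within ?X \<times> ?Y)"
  proof (rule has_derivative_partialsI)
    show "((\<lambda>x. f (x, t)) has_derivative (\<lambda>tx. tx * f1 (s, t))) (at s within ?X)"
      using f1 unfolding has_field_derivative_def
      by (simp add: has_derivative_at_withinI mult.commute[of _ "f1 (s, t)"])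
    show "((\<lambda>y. f (x, y)) has_derivative blinfun_mult_right (f2 (x, y))) (at y within ?Y)"
      if "x \<in> ?X" "y \<in> ?Y" for x y
    proof -
      have eq: "blinfun_apply (blinfun_mult_right (f2 (x, y))) = (*) (f2 (x, y))"
        by (simp add: fun_eq_iff)
      have "(x, y) \<in> S" using that e(2) by blast
      from has_derivative_at_withinI[OF f2[OF this, unfolded has_field_derivative_def]]
      show ?thesis by (simp only: eq)
    qed
    have "continuous (at (s, t)) f2"
      using continuous_on_eq_continuous_at[OF S(1)] cont S(2) by blast
    then have "continuous (at (s, t) within ?X \<times> ?Y) f2"
      by (rule continuous_at_imp_continuous_at_within)
    from bounded_linear.continuous[OF bounded_linear_blinfun_mult_right this]
    show "continuous (at (s, t) within ?X \<times> ?Y) (\<lambda>(x, y). blinfun_mult_right (f2 (x, y)))"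
      by (simp add: case_prod_beta')
  qed (use e in auto)
  then have "(f has_derivative
      (\<lambda>(tx, ty). tx * f1 (s, t) + blinfun_mult_right (f2 (s, t)) ty)) (at (s, t))"
    using at_within_open[OF _ op, of "(s, t)"] e(1) by simp
  then show ?thesis
    by (rule has_derivative_eq_rhs) (auto simp: fun_eq_iff)
qed

text \<open>Membership in the family replaces formulas for iterated derivatives: continuity gives
  class 0, and class \<open>n\<close> of all members gives class \<open>Suc n\<close> of each. It
  suits operators whose derivatives are again of the same shape.\<close>

lemma smooth_on_of_partials:
  fixes \<F> :: "(real \<times> real \<Rightarrow> real) set"
  assumes S: "open S" and cont: "\<And>f. f \<in> \<F> \<Longrightarrow> continuous_on S f"
    and d1: "\<And>f. f \<in> \<F> \<Longrightarrow>
      \<exists>f1\<in>\<F>. \<forall>s t. (s, t) \<in> S \<longrightarrow> ((\<lambda>r. f (r, t)) has_real_derivative f1 (s, t)) (at s)"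
    and d2: "\<And>f. f \<in> \<F> \<Longrightarrow>
      \<exists>f2\<in>\<F>. \<forall>s t. (s, t) \<in> S \<longrightarrow> ((\<lambda>r. f (s, r)) has_real_derivative f2 (s, t)) (at t)"
    and f: "f \<in> \<F>"
  shows "smooth_on S f"
  unfolding smooth_on_def
proof
  fix n show "Ck_on n S f"
    using f
  proof (induction n arbitrary: f)
    case 0
    then show ?case using cont by simp
  next
    case (Suc n)
    obtain f1 where f1: "f1 \<in> \<F>"
      "\<And>s t. (s, t) \<in> S \<Longrightarrow> ((\<lambda>r. f (r, t)) has_real_derivative f1 (s, t)) (at s)"
      using d1[OF Suc.prems] by blast
    obtain f2 where f2: "f2 \<in> \<F>"
      "\<And>s t. (s, t) \<in> S \<Longrightarrow> ((\<lambda>r. f (s, r)) has_real_derivative f2 (s, t)) (at t)"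
      using d2[OF Suc.prems] by blast
    show ?case
    proof (rule Ck_on_SucI[OF S])
      show "(f has_derivative (\<lambda>v. fst v * f1 x + snd v * f2 x)) (at x)" if "x \<in> S" for x
      proof -
        have "((\<lambda>r. f (r, snd x)) has_real_derivative f1 (fst x, snd x)) (at (fst x))"
          using f1(2)[of "fst x" "snd x"] that by simp
        from has_derivative_of_partials[where f = f and ?f1.0 = f1 and ?f2.0 = f2, OF S _ this f2(2) cont[OF f2(1)]]
        show ?thesis using that by simp
      qed
      have scale: "Ck_on n S (\<lambda>x. c * g x)" if "g \<in> \<F>" for c :: real and g
        by (rule Ck_on_bounded_linear_comp[OF bounded_linear_mult_right S Suc.IH[OF that]])
      show "Ck_on n S (\<lambda>x. fst v * f1 x + snd v * f2 x)" for v :: "real \<times> real"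
        by (rule Ck_on_add[OF S scale[OF f1(1)] scale[OF f2(1)]])
    qed
  qed
qed

text \<open>The inverse function theorem for \<open>(s, t) \<mapsto> (s, g (s, t))\<close>. The
  first coordinate is preserved, so the inverse is again fibred and only its second component
  \<open>\<rho>\<close> is recorded. Applied to a derivative, it also serves as the implicit
  function theorem.\<close>

lemma fibred_inverse:
  fixes g :: "real \<times> real \<Rightarrow> real"
  assumes S: "open S" "smooth_on S g" "(s0, t0) \<in> S" "D2 g (s0, t0) \<noteq> 0"
  obtains U V \<rho> where "open U" "(s0, t0) \<in> U" "U \<subseteq> S" "open V" "smooth_on V \<rho>"
    "\<And>s t. (s, t) \<in> U \<Longrightarrow> (s, g (s, t)) \<in> V \<and> \<rho> (s, g (s, t)) = t"
    "\<And>s v. (s, v) \<in> V \<Longrightarrow> (s, \<rho> (s, v)) \<in> U \<and> g (s, \<rho> (s, v)) = v"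
proof -
  \<comment> \<open>Shrinking to the locus \<open>D2 g \<noteq> 0\<close> makes the Jacobian
    invertible at every point, not just at the base point; the formula for the derivative of the
    inverse needs this.\<close>
  define S' where "S' = S \<inter> (D2 g -` (- {0}))"
  have S': "open S'"
    unfolding S'_def using smooth_on_imp_continuous_on[OF smooth_on_D2[OF S(2)]] S(1)
    by (intro continuous_open_preimage) auto
  have sm: "smooth_on S' g" using smooth_on_subset[OF S(2)] S'_def by blast
  have nz: "D2 g x \<noteq> 0" if "x \<in> S'" for x using that S'_def by auto
  let ?f = "\<lambda>x. (fst x, g x)"
  \<comment> \<open>\<open>L a b\<close> is the Jacobian matrix with rows \<open>(1, 0)\<close> and
    \<open>(a, b)\<close>. Its inverse has the same shape, with \<open>- a / b\<close> and
    \<open>1 / b\<close>.\<close>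
  define L where "L a b v = (fst v, fst v * a + snd v * b)" for a b and v :: "real \<times> real"
  have bl0: "bounded_linear (\<lambda>v :: real \<times> real. (fst v, 0 :: real))"
    and bl1: "bounded_linear (\<lambda>v :: real \<times> real. (0 :: real, fst v))"
    and bl2: "bounded_linear (\<lambda>v :: real \<times> real. (0 :: real, snd v))"
    by (intro bounded_linear_Pair bounded_linear_fst bounded_linear_snd bounded_linear_zero)+
  \<comment> \<open>\<open>B a b\<close> is \<open>L a b\<close> as a bounded linear function;
    written as an affine expression in \<open>a\<close> and \<open>b\<close>, it is visibly
    continuous in the operator norm.\<close>
  define B where "B a b = Blinfun (\<lambda>v :: real \<times> real. (fst v, 0 :: real))
      + a *\<^sub>R Blinfun (\<lambda>v :: real \<times> real. (0 :: real, fst v))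
      + b *\<^sub>R Blinfun (\<lambda>v :: real \<times> real. (0 :: real, snd v))" for a b :: real
  have B: "blinfun_apply (B a b) = L a b" for a b
    unfolding B_def L_def
    by (simp add: fun_eq_iff blinfun.add_left blinfun.scaleR_left
        bounded_linear_Blinfun_apply[OF bl0] bounded_linear_Blinfun_apply[OF bl1]
        bounded_linear_Blinfun_apply[OF bl2])
  have inv: "L (- a / b) (1 / b) (L a b v) = v" "L a b (L (- a / b) (1 / b) v) = v"
    if "b \<noteq> 0" for a b v
    using that by (cases v; simp add: L_def field_simps)+
  define d1 d2 where "d1 = D1 g (s0, t0)" and "d2 = D2 g (s0, t0)"
  have x0: "(s0, t0) \<in> S'" using S S'_def by simp
  obtain U V h h' where U: "open U" "U \<subseteq> S'" "(s0, t0) \<in> U" "open V"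
    and hom: "homeomorphism U V ?f h"
    and h: "\<And>y. y \<in> V \<Longrightarrow> (h has_derivative h' y) (at y)"
      "\<And>y. y \<in> V \<Longrightarrow> h' y = inv (blinfun_apply (B (D1 g (h y)) (D2 g (h y))))"
  proof (rule inverse_function_theorem[OF S', where f = ?f and ?x0.0 = "(s0, t0)"
        and f' = "\<lambda>x. B (D1 g x) (D2 g x)" and invf = "B (- d1 / d2) (1 / d2)"])
    show "(?f has_derivative blinfun_apply (B (D1 g x) (D2 g x))) (at x)" if "x \<in> S'" for x
      unfolding B L_def
      by (intro has_derivative_Pair has_derivative_D1_D2[OF sm that]
          bounded_linear_imp_has_derivative bounded_linear_fst)
    show "continuous_on S' (\<lambda>x. B (D1 g x) (D2 g x))"
      unfolding B_def
      using smooth_on_imp_continuous_on[OF smooth_on_D1[OF sm]]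
        smooth_on_imp_continuous_on[OF smooth_on_D2[OF sm]]
      by (intro continuous_intros)
    show "B (- d1 / d2) (1 / d2) o\<^sub>L B (D1 g (s0, t0)) (D2 g (s0, t0)) = id_blinfun"
      using inv(1)[of d2 d1] S(4)
      by (intro blinfun_eqI) (simp add: B d1_def d2_def)
  qed (use x0 in auto)
  have hU: "h y \<in> U" and fh: "?f (h y) = y" if "y \<in> V" for y
    using hom that by (auto simp: homeomorphism_def)
  have fV: "?f x \<in> V" and hf: "h (?f x) = x" if "x \<in> U" for x
    using hom that by (auto simp: homeomorphism_def)
  have nzh: "D2 g (h y) \<noteq> 0" if "y \<in> V" for y
    using hU[OF that] U(2) nz by blast
  \<comment> \<open>The derivative of \<open>h\<close> at \<open>w\<close> is the inverse Jacobian
    evaluated at \<open>h w\<close>, a smooth function of the value of \<open>h\<close>.\<close>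
  have "smooth_on V h"
  proof (rule smooth_on_autonomous[OF U(4,1), where
        H = "\<lambda>v x. (fst v, fst v * (- D1 g x / D2 g x) + snd v * (1 / D2 g x))"])
    show "h ` V \<subseteq> U" using hU by blast
    have smU: "smooth_on U g" "\<And>x. x \<in> U \<Longrightarrow> D2 g x \<noteq> 0"
      using smooth_on_subset[OF sm U(2)] nz U(2) by auto
    show "smooth_on U (\<lambda>x. (fst v, fst v * (- D1 g x / D2 g x) + snd v * (1 / D2 g x)))"
      for v :: "real \<times> real"
      using smU
      by (intro smooth_on_Pair smooth_on_const smooth_on_add smooth_on_mult smooth_on_divide
          smooth_on_uminus smooth_on_D1 smooth_on_D2 U(1))
    show "(h has_derivative
        (\<lambda>v. (fst v, fst v * (- D1 g (h w) / D2 g (h w)) + snd v * (1 / D2 g (h w))))) (at w)"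
      if "w \<in> V" for w
    proof (rule has_derivative_eq_rhs[OF h(1)[OF that]])
      have "inv (L (D1 g (h w)) (D2 g (h w))) = L (- D1 g (h w) / D2 g (h w)) (1 / D2 g (h w))"
        by (rule inv_equality) (simp_all only: inv[OF nzh[OF that]])
      then show "h' w = (\<lambda>v. (fst v, fst v * (- D1 g (h w) / D2 g (h w)) + snd v * (1 / D2 g (h w))))"
        unfolding h(2)[OF that] B by (simp add: L_def fun_eq_iff)
    qed
  qed
  then have "smooth_on V (\<lambda>y. snd (h y))" by (rule smooth_on_snd[OF U(4)])
  moreover have "(s, snd (h (s, v))) \<in> U \<and> g (s, snd (h (s, v))) = v" if "(s, v) \<in> V" for s v
    using hU[OF that] fh[OF that] by (metis fst_conv prod.collapse snd_conv)
  moreover have "(s, g (s, t)) \<in> V \<and> snd (h (s, g (s, t))) = t" if "(s, t) \<in> U" for s t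
    using fV[OF that] hf[OF that] by simp
  ultimately show thesis
    using that[of U V "\<lambda>y. snd (h y)"] U S'_def by blast
qed

text \<open>Hadamard's division operator: for \<open>n = 0\<close>, \<open>g = D2 f\<close> and
  \<open>f (s, 0) = 0\<close> it extends \<open>f (s, v) / v\<close> smoothly across
  \<open>v = 0\<close>. The weight \<open>u ^ n\<close> allows division by higher powers and
  reappears under differentiation.\<close>

definition avg :: "nat \<Rightarrow> (real \<times> real \<Rightarrow> real) \<Rightarrow> real \<times> real \<Rightarrow> real" where
  "avg n g = (\<lambda>(s, v). integral {0..1} (\<lambda>u. u ^ n * g (s, u * v)))"

lemma mult_mem_convex:
  fixes B :: "real set"
  assumes "convex B" "0 \<in> B" "v \<in> B" "u \<in> {0..1}"
  shows "u * v \<in> B"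
  using convexD[OF assms(1,2,3), of "1 - u" u] assms(4) by simp

lemma continuous_on_avg_integrand:
  assumes B: "convex B" "0 \<in> B" and g: "continuous_on (A \<times> B) g"
  shows "continuous_on ((A \<times> B) \<times> {0..1 :: real}) (\<lambda>(x, u). u ^ n * g (fst x, u * snd x))"
proof -
  have "continuous_on ((A \<times> B) \<times> {0..1 :: real}) (\<lambda>y. g (fst (fst y), snd y * snd (fst y)))"
    by (rule continuous_on_compose2[OF g])
      (use mult_mem_convex[OF B] in \<open>auto intro!: continuous_intros\<close>)
  then show ?thesis
    by (auto simp: case_prod_beta' intro!: continuous_intros)
qed

text \<open>Under the integral sign, \<open>D1\<close> turns \<open>avg n g\<close> into
  \<open>avg n (D1 g)\<close> and \<open>D2\<close> turns it into \<open>avg (Suc n) (D2 g)\<close>,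
  so all these averages together form a family closed under partial derivatives. Convexity of
  \<open>A\<close> serves the Leibniz rule; that of \<open>B\<close>, with \<open>0 \<in> B\<close>,
  keeps \<open>u * v\<close> in the domain.\<close>

lemma smooth_on_avg:
  fixes g :: "real \<times> real \<Rightarrow> real"
  assumes A: "open A" "convex A" and B: "open B" "convex B" "0 \<in> B"
    and g: "smooth_on (A \<times> B) g"
  shows "smooth_on (A \<times> B) (avg n g)"
proof (rule smooth_on_of_partials[where \<F> = "{avg n g | n g. smooth_on (A \<times> B) g}"])
  show op: "open (A \<times> B)" using A B by (simp add: open_Times)
  show "continuous_on (A \<times> B) f" if "f \<in> {avg n g | n g. smooth_on (A \<times> B) g}" for f
  proof -
    obtain n g where f: "f = avg n g" and g: "smooth_on (A \<times> B) g" using \<open>f \<in> _\<close> by blast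
    have "continuous_on (A \<times> B) (\<lambda>x. integral (cbox 0 1) (\<lambda>u. u ^ n * g (fst x, u * snd x)))"
      using continuous_on_avg_integrand[OF B(2,3) smooth_on_imp_continuous_on[OF g]]
      by (intro integral_continuous_on_param) simp
    then show ?thesis by (simp add: f avg_def case_prod_beta')
  qed
  have integrable: "(\<lambda>u. u ^ n * g (s, u * t)) integrable_on cbox 0 1"
    if "smooth_on (A \<times> B) g" "s \<in> A" "t \<in> B" for n g s t
  proof -
    have "continuous_on {0..1} (\<lambda>u. (\<lambda>(x, u). u ^ n * g (fst x, u * snd x)) ((s, t), u))"
      by (rule continuous_on_compose2[OF
            continuous_on_avg_integrand[OF B(2,3) smooth_on_imp_continuous_on[OF that(1)]]])
        (use that in \<open>auto intro!: continuous_intros\<close>)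
    then show ?thesis by (auto intro: integrable_continuous_interval)
  qed
  show "\<exists>f1\<in>{avg n g | n g. smooth_on (A \<times> B) g}. \<forall>s t. (s, t) \<in> A \<times> B \<longrightarrow>
      ((\<lambda>r. f (r, t)) has_real_derivative f1 (s, t)) (at s)"
    if "f \<in> {avg n g | n g. smooth_on (A \<times> B) g}" for f
  proof -
    obtain n g where f: "f = avg n g" and g: "smooth_on (A \<times> B) g" using \<open>f \<in> _\<close> by blast
    have "((\<lambda>r. f (r, t)) has_real_derivative avg n (D1 g) (s, t)) (at s)"
      if st: "(s, t) \<in> A \<times> B" for s t
    proof -
      have "((\<lambda>r. integral (cbox 0 1) (\<lambda>u. u ^ n * g (r, u * t))) has_field_derivative
          integral (cbox 0 1) (\<lambda>u. u ^ n * D1 g (s, u * t))) (at s within A)"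
      proof (rule leibniz_rule_field_derivative[where fx = "\<lambda>r u. u ^ n * D1 g (r, u * t)"])
        show "((\<lambda>r. u ^ n * g (r, u * t)) has_field_derivative u ^ n * D1 g (r, u * t))
            (at r within A)" if "r \<in> A" "u \<in> cbox 0 1" for r u
        proof -
          have "(r, u * t) \<in> A \<times> B" using that st mult_mem_convex[OF B(2,3)] by auto
          from DERIV_cmult[OF D1_DERIV[OF g this]] show ?thesis
            by (rule has_field_derivative_at_within)
        qed
        have "continuous_on (A \<times> {0..1}) (\<lambda>y. (\<lambda>(x, u). u ^ n * D1 g (fst x, u * snd x))
            ((fst y, t), snd y))"
          by (rule continuous_on_compose2[OF continuous_on_avg_integrand[OF B(2,3)
                  smooth_on_imp_continuous_on[OF smooth_on_D1[OF g]]]])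
            (use st in \<open>auto intro!: continuous_intros\<close>)
        then show "continuous_on (A \<times> cbox 0 1) (\<lambda>(r, u). u ^ n * D1 g (r, u * t))"
          by (simp add: case_prod_beta')
      qed (use st A integrable[OF g] in auto)
      then show ?thesis
        using st at_within_open[OF _ A(1)] by (auto simp: f avg_def)
    qed
    then show ?thesis using smooth_on_D1[OF g] by blast
  qed
  show "\<exists>f2\<in>{avg n g | n g. smooth_on (A \<times> B) g}. \<forall>s t. (s, t) \<in> A \<times> B \<longrightarrow>
      ((\<lambda>r. f (s, r)) has_real_derivative f2 (s, t)) (at t)"
    if "f \<in> {avg n g | n g. smooth_on (A \<times> B) g}" for f
  proof -
    obtain n g where f: "f = avg n g" and g: "smooth_on (A \<times> B) g" using \<open>f \<in> _\<close> by blast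
    have "((\<lambda>r. f (s, r)) has_real_derivative avg (Suc n) (D2 g) (s, t)) (at t)"
      if st: "(s, t) \<in> A \<times> B" for s t
    proof -
      have "((\<lambda>r. integral (cbox 0 1) (\<lambda>u. u ^ n * g (s, u * r))) has_field_derivative
          integral (cbox 0 1) (\<lambda>u. u ^ Suc n * D2 g (s, u * t))) (at t within B)"
      proof (rule leibniz_rule_field_derivative[where fx = "\<lambda>r u. u ^ Suc n * D2 g (s, u * r)"])
        show "((\<lambda>r. u ^ n * g (s, u * r)) has_field_derivative u ^ Suc n * D2 g (s, u * r))
            (at r within B)" if "r \<in> B" "u \<in> cbox 0 1" for r u
        proof -
          have mem: "(s, u * r) \<in> A \<times> B" using that st mult_mem_convex[OF B(2,3)] by auto
          have "((\<lambda>r. u * r) has_real_derivative u) (at r)"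
            by (auto intro!: derivative_eq_intros)
          from DERIV_cmult[OF DERIV_chain2[OF D2_DERIV[OF g mem] this], of "u ^ n"]
          have "((\<lambda>r. u ^ n * g (s, u * r)) has_real_derivative u ^ Suc n * D2 g (s, u * r)) (at r)"
            by (simp add: mult_ac)
          then show ?thesis by (rule has_field_derivative_at_within)
        qed
        have "continuous_on (B \<times> {0..1}) (\<lambda>y. (\<lambda>(x, u). u ^ Suc n * D2 g (fst x, u * snd x))
            ((s, fst y), snd y))"
          by (rule continuous_on_compose2[OF continuous_on_avg_integrand[OF B(2,3)
                  smooth_on_imp_continuous_on[OF smooth_on_D2[OF g]]]])
            (use st in \<open>auto intro!: continuous_intros\<close>)
        then show "continuous_on (B \<times> cbox 0 1) (\<lambda>(r, u). u ^ Suc n * D2 g (s, u * r))"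
          by (simp add: case_prod_beta')
      qed (use st B integrable[OF g] in auto)
      then show ?thesis
        using st at_within_open[OF _ B(1)] by (auto simp: f avg_def)
    qed
    then show ?thesis using smooth_on_D2[OF g] by blast
  qed
qed (use g in blast)

text \<open>Integrate the derivative of \<open>u \<mapsto> f (s, u * v)\<close> over the unit
  interval: the chain rule gives one factor \<open>v\<close>, and \<open>D2 f\<close> at
  \<open>u * v\<close> gives \<open>u ^ n * v ^ n\<close>. Thus a known order of vanishing of the
  derivative is raised by one.\<close>

lemma eq_power_mult_avg:
  assumes B: "convex B" "0 \<in> B" and f: "smooth_on (A \<times> B) f"
    and k: "\<And>s v. (s, v) \<in> A \<times> B \<Longrightarrow> D2 f (s, v) = v ^ n * k (s, v)"
    and sv: "(s, v) \<in> A \<times> B" and f0: "f (s, 0) = 0"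
  shows "f (s, v) = v ^ Suc n * avg n k (s, v)"
proof -
  have "((\<lambda>u. f (s, u * v)) has_vector_derivative v ^ Suc n * (u ^ n * k (s, u * v)))
      (at u within {0..1})" if "u \<in> {0..1}" for u
  proof -
    have mem: "(s, u * v) \<in> A \<times> B" using that sv mult_mem_convex[OF B] by auto
    have "((\<lambda>u. u * v) has_real_derivative v) (at u)" by (auto intro!: derivative_eq_intros)
    from DERIV_chain2[OF D2_DERIV[OF f mem] this]
    have "((\<lambda>u. f (s, u * v)) has_real_derivative v ^ Suc n * (u ^ n * k (s, u * v))) (at u)"
      by (simp add: k[OF mem] power_mult_distrib mult_ac)
    then show ?thesis
      using has_field_derivative_at_within has_real_derivative_iff_has_vector_derivative by blast
  qed
  from fundamental_theorem_of_calculus[OF _ this]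
  have "((\<lambda>u. v ^ Suc n * (u ^ n * k (s, u * v))) has_integral f (s, 1 * v) - f (s, 0 * v)) {0..1}"
    by simp
  from integral_unique[OF this] have "f (s, v) = integral {0..1} (\<lambda>u. v ^ Suc n * (u ^ n * k (s, u * v)))"
    using f0 by simp
  then show ?thesis by (simp add: avg_def)
qed

text \<open>At \<open>v = 0\<close> only the integral of \<open>u ^ n\<close> is left. This carries
  the nonvanishing of leading coefficients through repeated division.\<close>

lemma avg_zero: "avg n g (s, 0) = g (s, 0) / Suc n"
proof -
  have "((\<lambda>u :: real. u ^ n) has_integral 1 / Suc n) {0..1}"
  proof -
    have "((\<lambda>u :: real. u ^ n) has_integral 1 ^ Suc n / Suc n - 0 ^ Suc n / Suc n) {0..1}"
    proof (rule fundamental_theorem_of_calculus)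
      have "((\<lambda>u :: real. u ^ Suc n / Suc n) has_real_derivative u ^ n) (at u)" for u
        by (rule derivative_eq_intros refl | simp)+
      then show "((\<lambda>u :: real. u ^ Suc n / Suc n) has_vector_derivative u ^ n)
          (at u within {0..1})" for u
        using has_field_derivative_at_within has_real_derivative_iff_has_vector_derivative by blast
    qed simp
    then show ?thesis by simp
  qed
  from integral_unique[OF has_integral_mult_left[OF this, of "g (s, 0)"]] show ?thesis
    unfolding avg_def prod.case mult_zero_right by (simp only: times_divide_eq_left mult_1)
qed

section \<open>Whitney's theorem on even functions\<close>

text \<open>The Taylor coefficients of Euler's product over \<open>j\<close> of
  \<open>1 - x / 2 ^ j\<close>. The recursion results from comparing coefficients in
  \<open>f (2 x) = (1 - 2 x) f x\<close>.\<close>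

primrec euler_coeff :: "nat \<Rightarrow> real" where
  "euler_coeff 0 = 1"
| "euler_coeff (Suc k) = euler_coeff k * (- 2 / (2 ^ Suc k - 1))"

text \<open>The ratio of consecutive coefficients tends to 0, so the series converges absolutely
  everywhere. The arguments of interest are \<open>x = 2 ^ m\<close>, where
  \<open>x ^ k = (2 ^ k) ^ m\<close> makes the series a moment of order \<open>m\<close>.\<close>

lemma summable_euler_coeff: "summable (\<lambda>k. \<bar>euler_coeff k\<bar> * x ^ k)"
proof -
  \<comment> \<open>Chosen so that \<open>4 * \<bar>x\<bar> \<le> 2 ^ Suc n - 1\<close> from
    \<open>N\<close> on, which bounds the term ratio by 1/2.\<close>
  obtain N where N: "4 * \<bar>x\<bar> + 1 < 2 ^ N"
    using real_arch_pow[of 2 "4 * \<bar>x\<bar> + 1"] by auto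
  show ?thesis
  proof (rule summable_ratio_test[of "1/2" N])
    fix n assume "n \<ge> N"
    then have "(2 :: real) ^ N \<le> 2 ^ Suc n" by (intro power_increasing) auto
    then have le: "4 * \<bar>x\<bar> \<le> 2 ^ Suc n - 1" and pos: "(0 :: real) < 2 ^ Suc n - 1" using N by linarith+
    have "\<bar>euler_coeff (Suc n)\<bar> * \<bar>x\<bar> = \<bar>euler_coeff n\<bar> * (2 * \<bar>x\<bar> / (2 ^ Suc n - 1))"
      using pos by (simp add: abs_mult)
    also have "\<dots> \<le> \<bar>euler_coeff n\<bar> * (1 / 2)"
      using le pos by (intro mult_left_mono) (auto simp: divide_le_eq)
    finally have "\<bar>euler_coeff (Suc n)\<bar> * \<bar>x\<bar> * \<bar>x\<bar> ^ n \<le> \<bar>euler_coeff n\<bar> * (1 / 2) * \<bar>x\<bar> ^ n"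
      by (rule mult_right_mono) simp
    then show "norm (\<bar>euler_coeff (Suc n)\<bar> * x ^ Suc n) \<le> 1 / 2 * norm (\<bar>euler_coeff n\<bar> * x ^ n)"
      by (simp add: abs_mult power_abs mult_ac del: euler_coeff.simps)
  qed simp
qed

lemma summable_euler_coeff_mult:
  assumes "\<And>k. \<bar>c k\<bar> \<le> 1"
  shows "summable (\<lambda>k. c k * euler_coeff k * x ^ k)"
proof (rule summable_comparison_test'[OF summable_euler_coeff[of "\<bar>x\<bar>"], of 0])
  show "norm (c n * euler_coeff n * x ^ n) \<le> \<bar>euler_coeff n\<bar> * \<bar>x\<bar> ^ n" for n
    using mult_right_mono[OF assms[of n], of "\<bar>euler_coeff n\<bar> * \<bar>x\<bar> ^ n"]
    by (simp add: abs_mult power_abs mult_ac)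
qed

text \<open>Euler's identity: the series equals \<open>\<Prod>j. (1 - x / 2 ^ j)\<close>, hence vanishes at all powers of 2.\<close>

lemma euler_series_double:
  "(\<Sum>k. euler_coeff k * (2 * x) ^ k) = (1 - 2 * x) * (\<Sum>k. euler_coeff k * x ^ k)"
proof -
  have sm: "summable (\<lambda>k. euler_coeff k * x ^ k)" for x
    using summable_euler_coeff_mult[of "\<lambda>_. 1"] by simp
  \<comment> \<open>The recursion without its denominator: the functional equation read off
    coefficient by coefficient.\<close>
  have rec: "euler_coeff (Suc k) * 2 ^ Suc k = euler_coeff (Suc k) - 2 * euler_coeff k" for k
  proof -
    have "(2 :: real) ^ Suc k \<noteq> 1" using one_less_power[of "2 :: real" "Suc k"] by simp
    then show ?thesis by (simp add: field_simps)
  qed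
  have "(\<Sum>k. euler_coeff k * (2 * x) ^ k) = 1 + (\<Sum>k. euler_coeff (Suc k) * (2 * x) ^ Suc k)"
    using suminf_split_head[OF sm[of "2 * x"]] by simp
  also have "(\<lambda>k. euler_coeff (Suc k) * (2 * x) ^ Suc k)
      = (\<lambda>k. euler_coeff (Suc k) * x ^ Suc k - 2 * x * (euler_coeff k * x ^ k))"
  proof
    fix k
    have "euler_coeff (Suc k) * (2 * x) ^ Suc k = (euler_coeff (Suc k) * 2 ^ Suc k) * x ^ Suc k"
      by (simp only: power_mult_distrib mult_ac)
    also have "\<dots> = euler_coeff (Suc k) * x ^ Suc k - 2 * x * (euler_coeff k * x ^ k)"
      unfolding rec by (simp add: algebra_simps del: euler_coeff.simps)
    finally show "euler_coeff (Suc k) * (2 * x) ^ Suc k = \<dots>" .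
  qed
  also have "(\<Sum>k. euler_coeff (Suc k) * x ^ Suc k - 2 * x * (euler_coeff k * x ^ k))
      = (\<Sum>k. euler_coeff (Suc k) * x ^ Suc k) - 2 * x * (\<Sum>k. euler_coeff k * x ^ k)"
    using sm[of x] summable_Suc_iff[of "\<lambda>k. euler_coeff k * x ^ k"]
    by (subst suminf_diff[symmetric]) (auto simp: suminf_mult summable_mult simp del: euler_coeff.simps)
  also have "(\<Sum>k. euler_coeff (Suc k) * x ^ Suc k) = (\<Sum>k. euler_coeff k * x ^ k) - 1"
    using suminf_split_head[OF sm[of x]] by simp
  finally show ?thesis by (simp add: algebra_simps)
qed

text \<open>The factor \<open>1 - 2 * x\<close> vanishes at \<open>x = 1 / 2\<close> and creates the
  zero at 1; doubling then propagates it to every power of 2.\<close>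

lemma euler_series_zero: "(\<Sum>k. euler_coeff k * (2 ^ n) ^ k) = 0"
proof (induction n)
  case 0
  show ?case using euler_series_double[of "1 / 2"] by simp
next
  case (Suc n)
  then show ?case using euler_series_double[of "2 ^ n"] by (simp add: mult.commute)
qed

lemma inverse_one_plus_power_le: "\<bar>1 / (1 + 2 ^ k)\<bar> \<le> (1 :: real)"
proof -
  have "(0 :: real) < 2 ^ k" by simp
  then show ?thesis by (simp add: divide_le_eq)
qed

text \<open>This sum becomes a divisor of the Seeley coefficients. A numerical certificate: the
  first four terms add up to about 0.0577, and the tail is at most 1/85, because
  \<open>\<bar>euler_coeff (k + 4)\<bar>\<close> is at most \<open>1 / 10 * (1 / 2) ^ k\<close> and
  the denominators are at least 17.\<close>

lemma seeley_normalisation: "(\<Sum>k. euler_coeff k / (1 + 2 ^ k)) \<noteq> 0"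
proof -
  let ?f = "\<lambda>k. euler_coeff k / (1 + 2 ^ k)"
  have sm: "summable ?f"
    using summable_euler_coeff_mult[of "\<lambda>k. 1 / (1 + 2 ^ k)" 1, OF inverse_one_plus_power_le] by simp
  have bound: "\<bar>euler_coeff (k + 4)\<bar> \<le> 1 / 10 * (1 / 2) ^ k" for k
  proof (induction k)
    case 0
    show ?case by (simp add: eval_nat_numeral)
  next
    case (Suc k)
    have "(2 :: real) ^ Suc (k + 4) = 32 * 2 ^ k" by (simp add: power_add)
    moreover have "(1 :: real) \<le> 2 ^ k" by simp
    ultimately have le: "(4 :: real) \<le> 2 ^ Suc (k + 4) - 1" by linarith
    have "\<bar>euler_coeff (Suc k + 4)\<bar> = \<bar>euler_coeff (k + 4)\<bar> * (2 / (2 ^ Suc (k + 4) - 1))"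
      unfolding add_Suc euler_coeff.simps abs_mult using le by simp
    also have "\<dots> \<le> (1 / 10 * (1 / 2) ^ k) * (1 / 2)"
      using le by (intro mult_mono Suc) (auto simp: divide_le_eq)
    finally show ?case by simp
  qed
  have "norm (?f (k + 4)) \<le> 1 / 170 * (1 / 2) ^ k" for k
  proof -
    have "(2 :: real) ^ (k + 4) = 16 * 2 ^ k" by (simp add: power_add)
    moreover have "(1 :: real) \<le> 2 ^ k" by simp
    ultimately have "(17 :: real) \<le> 1 + 2 ^ (k + 4)" by linarith
    have "\<bar>euler_coeff (k + 4)\<bar> / (1 + 2 ^ (k + 4)) \<le> (1 / 10 * (1 / 2) ^ k) / 17"
      by (rule frac_le[OF _ bound _ \<open>17 \<le> 1 + 2 ^ (k + 4)\<close>]) simp_all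
    then show ?thesis by simp
  qed
  then have "norm (\<Sum>k. ?f (k + 4)) \<le> (\<Sum>k. 1 / 170 * (1 / 2) ^ k)"
    by (intro norm_suminf_le summable_mult summable_geometric) auto
  also have "\<dots> = 1 / 170 * (\<Sum>k. (1 / 2) ^ k)"
    by (rule suminf_mult[OF summable_geometric]) simp
  also have "\<dots> = 1 / 85"
    using suminf_geometric[of "1 / 2 :: real"] by simp
  finally have "\<bar>\<Sum>k. ?f (k + 4)\<bar> \<le> 1 / 85" by simp
  moreover have "(\<Sum>k. ?f k) = (\<Sum>k. ?f (k + 4)) + (\<Sum>k<4. ?f k)"
    by (rule suminf_split_initial_segment[OF sm])
  moreover have "(\<Sum>k<4. ?f k) = 1/2 - 2/3 + 4/15 - 8/189"
  proof -
    have e: "euler_coeff 1 = - 2" "euler_coeff 2 = 4 / 3" "euler_coeff 3 = - (8 / 21)"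
      by (simp_all add: numeral_2_eq_2 numeral_3_eq_3)
    have "(\<Sum>k<4. g k) = g 0 + g 1 + g 2 + g 3" for g :: "nat \<Rightarrow> real"
      by (simp add: numeral_eq_Suc)
    from this[of ?f] show ?thesis by (simp add: e)
  qed
  ultimately show ?thesis by linarith
qed

text \<open>Dividing the Euler coefficients by \<open>1 + 2 ^ k\<close> yields a series
  \<open>A\<close> with \<open>A x + A (2 x)\<close> equal to the Euler series, which vanishes at
  powers of 2. Hence \<open>A (2 ^ m)\<close> alternates in sign with constant modulus. That sign
  cancels the one in \<open>(- (2 ^ k)) ^ m\<close>, and division by \<open>c = A 1\<close> makes
  every moment 1.\<close>

lemma seeley_coefficients:
  obtains a :: "nat \<Rightarrow> real"
  where "\<And>m. summable (\<lambda>k. \<bar>a k\<bar> * (2 ^ k) ^ m)" "\<And>m. (\<Sum>k. a k * (- (2 ^ k)) ^ m) = 1"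
proof
  define c where "c = (\<Sum>k. euler_coeff k / (1 + 2 ^ k))"
  define A where "A x = (\<Sum>k. 1 / (1 + 2 ^ k) * euler_coeff k * x ^ k)" for x
  let ?a = "\<lambda>k. euler_coeff k / (1 + 2 ^ k) / c"
  have c: "c \<noteq> 0" unfolding c_def by (rule seeley_normalisation)
  have sm: "summable (\<lambda>k. 1 / (1 + 2 ^ k) * euler_coeff k * x ^ k)" for x
    by (rule summable_euler_coeff_mult[OF inverse_one_plus_power_le])
  have pw: "(2 ^ k) ^ m = ((2 :: real) ^ m) ^ k" for k m
    by (simp add: power_mult[symmetric] mult.commute)
  show "summable (\<lambda>k. \<bar>?a k\<bar> * (2 ^ k) ^ m)" for m
  proof -
    have "summable (\<lambda>k. 1 / \<bar>c\<bar> * (\<bar>euler_coeff k\<bar> * (2 ^ m) ^ k))"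
      by (intro summable_mult summable_euler_coeff)
    then show ?thesis
    proof (rule summable_comparison_test'[of _ 0])
      fix k
      have "1 / (1 + 2 ^ k) \<le> (1 :: real)" using inverse_one_plus_power_le[of k] by linarith
      then have "1 / (1 + 2 ^ k) * (\<bar>euler_coeff k\<bar> * (2 ^ m) ^ k / \<bar>c\<bar>)
          \<le> 1 * (\<bar>euler_coeff k\<bar> * (2 ^ m) ^ k / \<bar>c\<bar>)"
        by (rule mult_right_mono) simp
      then show "norm (\<bar>?a k\<bar> * (2 ^ k) ^ m) \<le> 1 / \<bar>c\<bar> * (\<bar>euler_coeff k\<bar> * (2 ^ m) ^ k)"
        unfolding pw[of k m] by (simp add: abs_mult mult_ac)
    qed
  qed
  have A_double: "A (2 ^ Suc m) = - A (2 ^ m)" for m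
  proof -
    have "A (2 ^ Suc m) + A (2 ^ m) = (\<Sum>k. 1 / (1 + 2 ^ k) * euler_coeff k * (2 ^ Suc m) ^ k
        + 1 / (1 + 2 ^ k) * euler_coeff k * (2 ^ m) ^ k)"
      using suminf_add[OF sm[of "2 ^ Suc m"] sm[of "2 ^ m"]] by (simp only: A_def)
    also have "(\<lambda>k. 1 / (1 + 2 ^ k) * euler_coeff k * (2 ^ Suc m) ^ k
        + 1 / (1 + 2 ^ k) * euler_coeff k * (2 ^ m) ^ k) = (\<lambda>k. euler_coeff k * (2 ^ m) ^ k)"
    proof
      fix k
      define w where "w = 1 / (1 + 2 ^ k :: real)"
      have "1 + 2 ^ k \<noteq> (0 :: real)"
        using zero_less_power[of "2 :: real" k] by linarith
      then have w: "w * (1 + 2 ^ k) = 1" by (simp add: w_def)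
      have alg: "w * h * (P * x) + w * h * x = (w * (1 + P)) * (h * x)" for w h P x :: real
        by (simp add: algebra_simps)
      have e: "(2 ^ Suc m) ^ k = 2 ^ k * ((2 :: real) ^ m) ^ k"
        unfolding power_Suc power_mult_distrib ..
      have "w * euler_coeff k * (2 ^ Suc m) ^ k + w * euler_coeff k * (2 ^ m) ^ k
          = euler_coeff k * (2 ^ m) ^ k"
        unfolding e alg w by (rule mult_1_left)
      then show "1 / (1 + 2 ^ k) * euler_coeff k * (2 ^ Suc m) ^ k
        + 1 / (1 + 2 ^ k) * euler_coeff k * (2 ^ m) ^ k = euler_coeff k * (2 ^ m) ^ k"
        unfolding w_def .
    qed
    finally show ?thesis using euler_series_zero[of m] by simp
  qed
  have "A (2 ^ m) = (- 1) ^ m * c" for m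
  proof (induction m)
    case (Suc m)
    then show ?case unfolding A_double by simp
  qed (simp add: A_def c_def)
  then have A: "(- 1) ^ m * A (2 ^ m) / c = 1" for m
    using c by (simp add: power_mult_distrib[symmetric])
  have eq: "?a k * (- (2 ^ k)) ^ m = (- 1) ^ m / c * (1 / (1 + 2 ^ k) * euler_coeff k * (2 ^ m) ^ k)"
    for k m
    unfolding power_minus[of "2 ^ k"] pw[of k m] by (simp add: mult_ac)
  show "(\<Sum>k. ?a k * (- (2 ^ k)) ^ m) = 1" for m
  proof -
    have "(\<Sum>k. ?a k * (- (2 ^ k)) ^ m) = (- 1) ^ m / c * A (2 ^ m)"
      unfolding A_def eq by (rule suminf_mult[OF sm])
    then show ?thesis using A[of m] by (simp only: times_divide_eq_left)
  qed
qed

text \<open>The functions \<open>p (1 / x) exp (- 1 / x)\<close>, extended by 0, are closed under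
  differentiation: the polynomial \<open>p\<close> becomes \<open>X\<^sup>2 (p - p')\<close>.
  Positivity for \<open>x > 0\<close> matters later, since the cut-off built from this function is
  divided out again.\<close>

lemma flat_function:
  obtains \<phi> :: "real \<Rightarrow> real"
  where "smooth_on UNIV \<phi>" "\<And>x. x > 0 \<Longrightarrow> \<phi> x > 0" "\<And>x. x \<le> 0 \<Longrightarrow> \<phi> x = 0"
proof -
  define e where "e p x = (if x > 0 then poly p (inverse x) * exp (- inverse x) else 0)"
    for p and x :: real
  have lim: "((\<lambda>y. poly p y * exp (- y)) \<longlongrightarrow> 0) at_top" for p :: "real poly"
  proof -
    have "((\<lambda>y. \<Sum>i\<le>degree p. coeff p i * (y ^ i / exp y)) \<longlongrightarrow> (\<Sum>i\<le>degree p. coeff p i * 0)) at_top"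
      by (intro tendsto_intros tendsto_power_div_exp_0)
    then show ?thesis
      by (simp add: poly_altdef sum_distrib_right exp_minus divide_inverse mult.assoc)
  qed
  have lim0: "((\<lambda>x. poly p (inverse x) * exp (- inverse x)) \<longlongrightarrow> 0) (at_right 0)" for p :: "real poly"
    by (rule filterlim_compose[OF lim filterlim_inverse_at_top_right])
  have der: "(e p has_real_derivative e ([:0, 0, 1:] * (p - pderiv p)) x) (at x)" for p x
  proof (cases x "0 :: real" rule: linorder_cases)
    case less
    then have "\<forall>\<^sub>F y in nhds x. e p y = 0"
      using eventually_nhds_in_open[of "{..<0}" x] by (auto elim!: eventually_mono simp: e_def)
    then show ?thesis
      using less DERIV_cong_ev[OF refl, of "e p" "\<lambda>_. 0" x] by (simp add: e_def)
  next
    case greater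
    have "((\<lambda>x. poly p (inverse x) * exp (- inverse x)) has_real_derivative
        poly (pderiv p) (inverse x) * (- (inverse x ^ 2)) * exp (- inverse x)
        + poly p (inverse x) * (exp (- inverse x) * (inverse x ^ 2))) (at x)"
      using greater
      by (auto intro!: derivative_eq_intros DERIV_chain2[OF poly_DERIV] simp: power2_eq_square)
    moreover have "\<forall>\<^sub>F y in nhds x. e p y = poly p (inverse y) * exp (- inverse y)"
      using greater eventually_nhds_in_open[of "{0<..}" x]
      by (auto elim!: eventually_mono simp: e_def)
    ultimately show ?thesis
      using greater DERIV_cong_ev[OF refl, of "e p" "\<lambda>y. poly p (inverse y) * exp (- inverse y)" x]
      by (simp add: e_def power2_eq_square algebra_simps)
  next
    case equal
    have "((\<lambda>y. (e p y - e p 0) / (y - 0)) \<longlongrightarrow> 0) (at_left 0)"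
      by (rule tendsto_eventually) (auto simp: eventually_at_filter e_def)
    moreover have "((\<lambda>y. (e p y - e p 0) / (y - 0)) \<longlongrightarrow> 0) (at_right 0)"
    \<comment> \<open>Dividing by \<open>x\<close> multiplies the polynomial in \<open>1 / x\<close>
      by its variable, so the difference quotient at 0 belongs to the same family, with
      \<open>pCons 0 p\<close>.\<close>
    proof (rule Lim_transform_eventually[OF lim0[of "pCons 0 p"]])
      show "\<forall>\<^sub>F x in at_right 0. poly (pCons 0 p) (inverse x) * exp (- inverse x)
          = (e p x - e p 0) / (x - 0)"
        using eventually_at_right_less[of "0 :: real"]
        by eventually_elim (simp add: e_def divide_inverse mult_ac)
    qed
    ultimately show ?thesis
      unfolding equal has_field_derivative_iff
      by (simp add: filterlim_at_split e_def)
  qed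
  have "smooth_on UNIV (e 1)"
    unfolding smooth_on_def
  proof
    fix n
    have "Ck_on n UNIV (e p)" for p
    proof (induction n arbitrary: p)
      case 0
      show ?case
        unfolding Ck_on.simps(1)
        by (rule continuous_at_imp_continuous_on) (use DERIV_isCont[OF der] in blast)
    next
      case (Suc n)
      show ?case
      proof (rule Ck_on_SucI[OF open_UNIV])
        show "(e p has_derivative (*) (e ([:0, 0, 1:] * (p - pderiv p)) x)) (at x)" for x
          using der[of p x] by (simp only: has_field_derivative_def)
        show "Ck_on n UNIV (\<lambda>x. e ([:0, 0, 1:] * (p - pderiv p)) x * v)" for v
          by (rule Ck_on_bounded_linear_comp[OF bounded_linear_mult_left open_UNIV Suc])
      qed
    qed
    then show "Ck_on n UNIV (e 1)" .
  qed
  moreover have "e 1 x > 0" if "x > 0" for x using that by (simp add: e_def)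
  moreover have "e 1 x = 0" if "x \<le> 0" for x using that by (simp add: e_def)
  ultimately show thesis by (rule that)
qed

text \<open>By the mean value theorem each difference quotient at \<open>a\<close> is a value of
  \<open>g\<close> at a point closer to \<open>a\<close>. This glues the two branches of the
  extension at 0 without a one-sided computation there.\<close>

lemma has_real_derivative_limit:
  fixes f g :: "real \<Rightarrow> real"
  assumes f: "continuous_on UNIV f" "\<And>x. x \<noteq> a \<Longrightarrow> (f has_real_derivative g x) (at x)"
    and g: "isCont g a"
  shows "(f has_real_derivative g a) (at a)"
  unfolding has_field_derivative_iff LIM_eq
proof (intro allI impI)
  fix r :: real assume "0 < r"
  then obtain d where d: "d > 0" "\<And>x. \<bar>x - a\<bar> < d \<Longrightarrow> \<bar>g x - g a\<bar> < r"
    using g unfolding isCont_def LIM_eq by (metis abs_zero diff_self real_norm_def)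
  have mvt: "\<exists>z. \<bar>z - a\<bar> < \<bar>x - a\<bar> \<and> (f x - f a) / (x - a) = g z" if x: "x \<noteq> a" for x
  proof (cases "a < x")
    case True
    obtain l z where z: "a < z" "z < x" "DERIV f z :> l" "f x - f a = (x - a) * l"
      using MVT[OF True continuous_on_subset[OF f(1) subset_UNIV]] f(2)
      by (metis real_differentiable_def order_less_irrefl)
    then have "l = g z" using DERIV_unique[OF z(3) f(2)[of z]] by simp
    then show ?thesis using z x by (intro exI[of _ z]) auto
  next
    case False
    then have "x < a" using x by simp
    obtain l z where z: "x < z" "z < a" "DERIV f z :> l" "f a - f x = (a - x) * l"
      using MVT[OF \<open>x < a\<close> continuous_on_subset[OF f(1) subset_UNIV]] f(2)
      by (metis real_differentiable_def order_less_irrefl)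
    then have "l = g z" using DERIV_unique[OF z(3) f(2)[of z]] by simp
    moreover have "(f x - f a) / (x - a) = (f a - f x) / (a - x)"
      using minus_divide_divide[of "f a - f x" "a - x"] by simp
    ultimately show ?thesis using z x by (intro exI[of _ z]) auto
  qed
  show "\<exists>s>0. \<forall>x. x \<noteq> a \<and> norm (x - a) < s \<longrightarrow> norm ((f x - f a) / (x - a) - g a) < r"
  proof (intro exI[of _ d] conjI allI impI d(1))
    fix x assume x: "x \<noteq> a \<and> norm (x - a) < d"
    then obtain z where "\<bar>z - a\<bar> < \<bar>x - a\<bar>" "(f x - f a) / (x - a) = g z"
      using mvt by blast
    then show "norm ((f x - f a) / (x - a) - g a) < r" using d(2)[of z] x by simp
  qed
qed

text \<open>The bound \<open>c\<close> on the support is common to all \<open>s \<in> A\<close>. It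
  makes the Seeley series a finite sum away from \<open>w = 0\<close>, with a number of terms
  independent of \<open>s\<close>, and keeps its terms bounded.\<close>

definition even_compact :: "real set \<Rightarrow> (real \<times> real \<Rightarrow> real) \<Rightarrow> bool" where
  "even_compact A f \<longleftrightarrow> smooth_on (A \<times> UNIV) f \<and> (\<forall>s\<in>A. \<forall>v. f (s, - v) = f (s, v)) \<and>
    (\<exists>c. \<forall>s\<in>A. \<forall>v. c < \<bar>v\<bar> \<longrightarrow> f (s, v) = 0)"

lemma even_compact_D1:
  assumes A: "open A" and f: "even_compact A f"
  shows "even_compact A (D1 f)"
proof -
  have sm: "smooth_on (A \<times> UNIV) f" and ev: "\<And>s v. s \<in> A \<Longrightarrow> f (s, - v) = f (s, v)"
    using f by (auto simp: even_compact_def)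
  obtain c where c: "\<And>s v. s \<in> A \<Longrightarrow> c < \<bar>v\<bar> \<Longrightarrow> f (s, v) = 0"
    using f unfolding even_compact_def by blast
  have D: "((\<lambda>r. f (r, v)) has_real_derivative D1 f (s, v)) (at s)" if "s \<in> A" for s v
    by (rule D1_DERIV[OF sm]) (use that in simp)
  have "D1 f (s, - v) = D1 f (s, v)" if s: "s \<in> A" for s v
  proof (rule DERIV_unique[OF _ D[OF s]])
    show "((\<lambda>r. f (r, v)) has_real_derivative D1 f (s, - v)) (at s)"
      by (rule has_field_derivative_transform_within_open[OF D[OF s] A s]) (rule ev)
  qed
  moreover have "D1 f (s, v) = 0" if s: "s \<in> A" and v: "c < \<bar>v\<bar>" for s v
  proof (rule DERIV_unique[OF D[OF s]])
    show "((\<lambda>r. f (r, v)) has_real_derivative 0) (at s)"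
      by (rule has_field_derivative_transform_within_open[OF DERIV_const A s, of 0])
        (use c v in simp)
  qed
  ultimately show ?thesis
    using smooth_on_D1[OF sm] unfolding even_compact_def by blast
qed

text \<open>\<open>D2 f\<close> is odd and leaves the class; dividing by \<open>2 * v\<close>
  restores evenness. This quotient is the relevant one because \<open>f (s, sqrt w)\<close> has
  derivative \<open>g (s, sqrt w)\<close> in \<open>w\<close>.\<close>

lemma even_compact_D2:
  assumes A: "open A" "convex A" and f: "even_compact A f"
  obtains g where "even_compact A g" "\<And>s v. s \<in> A \<Longrightarrow> D2 f (s, v) = 2 * v * g (s, v)"
proof -
  have sm: "smooth_on (A \<times> UNIV) f" and ev: "\<And>s v. s \<in> A \<Longrightarrow> f (s, - v) = f (s, v)"
    using f by (auto simp: even_compact_def)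
  obtain c where c: "\<And>s v. s \<in> A \<Longrightarrow> c < \<bar>v\<bar> \<Longrightarrow> f (s, v) = 0"
    using f unfolding even_compact_def by blast
  have D: "((\<lambda>r. f (s, r)) has_real_derivative D2 f (s, v)) (at v)" if "s \<in> A" for s v
    by (rule D2_DERIV[OF sm]) (use that in simp)
  have odd: "D2 f (s, - v) = - D2 f (s, v)" if s: "s \<in> A" for s v
  proof -
    have "((\<lambda>r. f (s, - r)) has_real_derivative D2 f (s, - v) * - 1) (at v)"
      by (rule DERIV_chain2[OF D[OF s]]) (auto intro!: derivative_eq_intros)
    then have "((\<lambda>r. f (s, r)) has_real_derivative D2 f (s, - v) * - 1) (at v)"
      using ev[OF s] by simp
    from DERIV_unique[OF this D[OF s]] show ?thesis by simp
  qed
  then have zero: "D2 f (s, 0) = 0" if "s \<in> A" for s using odd[OF that, of 0] by simp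
  \<comment> \<open>Hadamard division of the odd function \<open>D2 f\<close>, which vanishes at
    \<open>v = 0\<close>.\<close>
  define g where "g = (\<lambda>x. 1 / 2 * avg 0 (D2 (D2 f)) x)"
  have g: "D2 f (s, v) = 2 * v * g (s, v)" if "s \<in> A" for s v
    using eq_power_mult_avg[OF convex_UNIV UNIV_I smooth_on_D2[OF sm], of 0 "D2 (D2 f)" s v] zero[OF that] that
    by (simp add: g_def)
  have op: "open (A \<times> (UNIV :: real set))" using A by (simp add: open_Times)
  have "smooth_on (A \<times> UNIV) g"
    unfolding g_def
    by (rule smooth_on_mult[OF op smooth_on_const[OF op] smooth_on_avg[OF A open_UNIV convex_UNIV UNIV_I
            smooth_on_D2[OF smooth_on_D2[OF sm]]]])
  moreover have "g (s, - v) = g (s, v)" if "s \<in> A" for s v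
    using g[OF that, of v] g[OF that, of "- v"] odd[OF that, of v] by (cases "v = 0") auto
  \<comment> \<open>The bound \<open>c\<close> may be negative; the maximum with 0 guarantees
    \<open>v \<noteq> 0\<close>, so that \<open>2 * v\<close> can be cancelled.\<close>
  moreover have "g (s, v) = 0" if s: "s \<in> A" and v: "max c 0 < \<bar>v\<bar>" for s v
  proof -
    have "((\<lambda>r. f (s, r)) has_real_derivative 0) (at v)"
    proof (rule has_field_derivative_transform_within_open[where S = "{r. c < \<bar>r\<bar>}"])
      show "((\<lambda>r. 0 :: real) has_real_derivative 0) (at v)" by simp
      show "open {r. c < \<bar>r\<bar>}" by (intro open_Collect_less continuous_intros)
    qed (use c s v in auto)
    from DERIV_unique[OF this D[OF s]] show ?thesis using g[OF s, of v] v by auto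
  qed
  ultimately have "even_compact A g" unfolding even_compact_def by blast
  then show thesis using g by (rule that)
qed

text \<open>Seeley's extension of \<open>w \<mapsto> f (s, sqrt w)\<close> to negative \<open>w\<close>: matching the \<open>m\<close>-th derivatives at
  \<open>w = 0\<close> amounts to \<open>\<Sum>k. a k * (- (2 ^ k)) ^ m = 1\<close>. The index \<open>m\<close> counts the derivatives taken.\<close>

definition seeley :: "(nat \<Rightarrow> real) \<Rightarrow> nat \<Rightarrow> (real \<times> real \<Rightarrow> real) \<Rightarrow> real \<times> real \<Rightarrow> real" where
  "seeley a m f = (\<lambda>(s, w). if w \<le> 0 then \<Sum>k. a k * (- (2 ^ k)) ^ m * f (s, sqrt (2 ^ k * - w))
    else f (s, sqrt w))"

locale seeley_coeffs =
  fixes a :: "nat \<Rightarrow> real"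
  assumes summable: "summable (\<lambda>k. \<bar>a k\<bar> * (2 ^ k) ^ m)"
    and moment: "(\<Sum>k. a k * (- (2 ^ k)) ^ m) = 1"
begin

lemma norm_term: "norm (a k * (- (2 ^ k)) ^ m) = \<bar>a k\<bar> * (2 ^ k) ^ m"
  by (simp add: abs_mult power_abs)

text \<open>At \<open>w = 0\<close> all terms carry the same value of \<open>f\<close>, and the
  moment of order \<open>m\<close> is 1. Hence both branches of the definition agree there for every
  \<open>m\<close>.\<close>

lemma seeley_zero: "seeley a m f (s, 0) = f (s, 0)"
proof -
  have "summable (\<lambda>k. a k * (- (2 ^ k)) ^ m)"
    by (rule summable_norm_cancel) (simp only: norm_term summable)
  from suminf_mult2[OF this, of "f (s, 0)"] show ?thesis
    by (simp add: seeley_def moment)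
qed

text \<open>For \<open>w < w0 < 0\<close> the arguments \<open>sqrt (2 ^ k * - w)\<close> eventually
  leave the support, uniformly in \<open>s\<close> and \<open>w\<close>, so term-by-term
  differentiation concerns finite sums. The statement covers all \<open>K' \<ge> K\<close>, so that
  the sums for a function and its derivative can be cut at a common index.\<close>

lemma seeley_finite:
  assumes c: "\<And>s v. s \<in> A \<Longrightarrow> c < \<bar>v\<bar> \<Longrightarrow> f (s, v) = 0" and w0: "w0 < 0"
  shows "\<exists>K. \<forall>K'\<ge>K. \<forall>s\<in>A. \<forall>w<w0.
    seeley a m f (s, w) = (\<Sum>k<K'. a k * (- (2 ^ k)) ^ m * f (s, sqrt (2 ^ k * - w)))"
proof -
  obtain K where K: "c\<^sup>2 / (- w0) < 2 ^ K"
    using real_arch_pow[of 2 "c\<^sup>2 / (- w0)"] by auto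
  show ?thesis
  proof (intro exI[of _ K] allI ballI impI)
    fix K' s w assume K': "K' \<ge> K" and s: "s \<in> A" and w: "w < w0"
    have "f (s, sqrt (2 ^ k * - w)) = 0" if "k \<notin> {..<K'}" for k
    proof (rule c[OF s])
      have "(2 :: real) ^ K \<le> 2 ^ k" using that K' by (intro power_increasing) auto
      then have "c\<^sup>2 / (- w0) < 2 ^ k" using K by linarith
      moreover have "0 < - w0" using w0 by simp
      ultimately have "c\<^sup>2 < 2 ^ k * - w0" using pos_divide_less_eq by blast
      also have "\<dots> \<le> 2 ^ k * - w" using w by simp
      finally have "sqrt (c\<^sup>2) < sqrt (2 ^ k * - w)" by (rule real_sqrt_less_mono)
      then show "c < \<bar>sqrt (2 ^ k * - w)\<bar>" by simp
    qed
    then have "(\<Sum>k. a k * (- (2 ^ k)) ^ m * f (s, sqrt (2 ^ k * - w)))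
        = (\<Sum>k<K'. a k * (- (2 ^ k)) ^ m * f (s, sqrt (2 ^ k * - w)))"
      by (intro suminf_finite) auto
    then show "seeley a m f (s, w) = (\<Sum>k<K'. a k * (- (2 ^ k)) ^ m * f (s, sqrt (2 ^ k * - w)))"
      using w w0 by (simp add: seeley_def)
  qed
qed

text \<open>Near each \<open>s\<close> the function is bounded, by compactness of its support over a
  closed ball, so the M-test applies with the summable majorant
  \<open>\<bar>a k\<bar> * (2 ^ k) ^ m\<close>.\<close>

lemma continuous_on_seeley:
  assumes A: "open A" and f: "even_compact A f"
  shows "continuous_on (A \<times> UNIV) (seeley a m f)"
proof -
  have cont: "continuous_on (A \<times> UNIV) f"
    using f smooth_on_imp_continuous_on by (auto simp: even_compact_def)
  obtain c where c: "\<And>s v. s \<in> A \<Longrightarrow> c < \<bar>v\<bar> \<Longrightarrow> f (s, v) = 0"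
    using f unfolding even_compact_def by blast
  let ?t = "\<lambda>k x. a k * (- (2 ^ k)) ^ m * f (fst x, sqrt (2 ^ k * - snd x))"
  \<comment> \<open>Here \<open>w > 0\<close> is included: \<open>sqrt\<close> is odd on the whole
    line, so the terms stay continuous. The series is restricted to \<open>w \<le> 0\<close> before
    gluing.\<close>
  have "continuous_on (A \<times> UNIV) (\<lambda>x. \<Sum>k. ?t k x)"
  proof (rule continuous_at_imp_continuous_on, rule ballI)
    fix x :: "real \<times> real" assume "x \<in> A \<times> UNIV"
    then have "fst x \<in> A" by auto
    then obtain d where d: "d > 0" "cball (fst x) d \<subseteq> A"
      using A open_contains_cball by blast
    let ?U = "ball (fst x) d \<times> (UNIV :: real set)"
    have sub: "?U \<subseteq> A \<times> UNIV" using d(2) ball_subset_cball by blast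
    have "compact (f ` (cball (fst x) d \<times> {- c..c}))"
      using d(2) by (intro compact_continuous_image continuous_on_subset[OF cont] compact_Times) auto
    from compact_imp_bounded[OF this]
    obtain B where B: "\<And>y. y \<in> cball (fst x) d \<times> {- c..c} \<Longrightarrow> norm (f y) \<le> B"
      unfolding bounded_iff by blast
    \<comment> \<open>With \<open>c < 0\<close> the compact set is empty and \<open>B\<close>
      arbitrary, and off the support a nonnegative bound is required; hence
      \<open>max B 0\<close>.\<close>
    have bound: "norm (f y) \<le> max B 0" if "y \<in> ?U" for y
    proof (cases "c < \<bar>snd y\<bar>")
      case True
      moreover have "fst y \<in> cball (fst x) d" using that by auto
      then have "fst y \<in> A" using d(2) by blast
      ultimately have "f y = 0" using c[of "fst y" "snd y"] by simp
      then show ?thesis by simp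
    next
      case False
      then have "y \<in> cball (fst x) d \<times> {- c..c}" using that by (cases y) auto
      from B[OF this] show ?thesis by simp
    qed
    have "continuous_on ?U (\<lambda>x. \<Sum>k. ?t k x)"
    proof (rule uniform_limit_theorem)
      show "uniform_limit ?U (\<lambda>n x. \<Sum>k<n. ?t k x) (\<lambda>x. \<Sum>k. ?t k x) sequentially"
      proof (rule Weierstrass_m_test)
        show "norm (?t k y) \<le> \<bar>a k\<bar> * (2 ^ k) ^ m * max B 0" if "y \<in> ?U" for k y
          unfolding norm_mult[of _ "f _"] norm_term
          by (rule mult_left_mono[OF bound]) (use that in auto)
        show "summable (\<lambda>k. \<bar>a k\<bar> * (2 ^ k) ^ m * max B 0)"
          by (rule summable_mult2[OF summable])
      qed
      have "continuous_on ?U (?t k)" for k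
        by (intro continuous_intros continuous_on_compose2[OF cont]) (use sub in auto)
      then show "\<forall>\<^sub>F n in sequentially. continuous_on ?U (\<lambda>x. \<Sum>k<n. ?t k x)"
        by (intro always_eventually allI continuous_on_sum)
    qed simp
    moreover have "open ?U" "x \<in> ?U" using d(1) by (auto simp: open_Times mem_Times_iff)
    ultimately show "isCont (\<lambda>x. \<Sum>k. ?t k x) x"
      using continuous_on_eq_continuous_at by blast
  qed
  then have 1: "continuous_on {x \<in> A \<times> UNIV. snd x \<le> 0} (\<lambda>x. \<Sum>k. ?t k x)"
    by (rule continuous_on_subset) auto
  have 2: "continuous_on {x \<in> A \<times> UNIV. 0 \<le> snd x} (\<lambda>x. f (fst x, sqrt (snd x)))"
    by (rule continuous_on_compose2[OF cont]) (auto intro!: continuous_intros)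
  have "continuous_on (A \<times> UNIV) (\<lambda>x. if snd x \<le> 0 then \<Sum>k. ?t k x else f (fst x, sqrt (snd x)))"
  proof (rule continuous_on_cases_le[OF 1 2])
    fix x assume "x \<in> A \<times> (UNIV :: real set)" "snd x = 0"
    then show "(\<Sum>k. ?t k x) = f (fst x, sqrt (snd x))"
      using seeley_zero[of m f "fst x"] by (simp add: seeley_def)
  qed (intro continuous_intros)
  then show ?thesis by (simp add: seeley_def case_prod_beta')
qed

lemma seeley_D1:
  assumes A: "open A" and f: "even_compact A f" and s: "s \<in> A"
  shows "((\<lambda>r. seeley a m f (r, w)) has_real_derivative seeley a m (D1 f) (s, w)) (at s)"
proof -
  have sm: "smooth_on (A \<times> UNIV) f" using f by (simp add: even_compact_def)
  have D: "((\<lambda>r. f (r, v)) has_real_derivative D1 f (s, v)) (at s)" for v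
    by (rule D1_DERIV[OF sm]) (use s in simp)
  consider "w < 0" | "w = 0" | "w > 0" by linarith
  then show ?thesis
  proof cases
    case 1
    obtain c where c: "\<And>s v. s \<in> A \<Longrightarrow> c < \<bar>v\<bar> \<Longrightarrow> f (s, v) = 0"
      using f unfolding even_compact_def by blast
    obtain c' where c': "\<And>s v. s \<in> A \<Longrightarrow> c' < \<bar>v\<bar> \<Longrightarrow> D1 f (s, v) = 0"
      using even_compact_D1[OF A f] unfolding even_compact_def by blast
    \<comment> \<open>\<open>seeley_finite\<close> wants a negative bound strictly above the
      argument, and \<open>w / 2\<close> is one.\<close>
    have w: "w / 2 < 0" "w < w / 2" using 1 by auto
    obtain K where K: "\<And>K' s w'. K' \<ge> K \<Longrightarrow> s \<in> A \<Longrightarrow> w' < w / 2 \<Longrightarrow>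
        seeley a m f (s, w') = (\<Sum>k<K'. a k * (- (2 ^ k)) ^ m * f (s, sqrt (2 ^ k * - w')))"
      using seeley_finite[of A c f "w / 2" m] c w(1) by blast
    obtain L where L: "\<And>K' s w'. K' \<ge> L \<Longrightarrow> s \<in> A \<Longrightarrow> w' < w / 2 \<Longrightarrow>
        seeley a m (D1 f) (s, w') = (\<Sum>k<K'. a k * (- (2 ^ k)) ^ m * D1 f (s, sqrt (2 ^ k * - w')))"
      using seeley_finite[of A c' "D1 f" "w / 2" m] c' w(1) by blast
    have "((\<lambda>r. \<Sum>k<max K L. a k * (- (2 ^ k)) ^ m * f (r, sqrt (2 ^ k * - w))) has_real_derivative
        (\<Sum>k<max K L. a k * (- (2 ^ k)) ^ m * D1 f (s, sqrt (2 ^ k * - w)))) (at s)"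
      by (intro DERIV_sum DERIV_cmult D)
    then have "((\<lambda>r. \<Sum>k<max K L. a k * (- (2 ^ k)) ^ m * f (r, sqrt (2 ^ k * - w))) has_real_derivative
        seeley a m (D1 f) (s, w)) (at s)"
      using L[of "max K L" s w] s w by simp
    then show ?thesis
      by (rule has_field_derivative_transform_within_open[OF _ A s])
        (rule K[symmetric, OF max.cobounded1 _ w(2)])
  next
    case 2
    then show ?thesis using D[of 0] by (simp add: seeley_zero)
  next
    case 3
    then show ?thesis using D[of "sqrt w"] by (simp add: seeley_def)
  qed
qed

text \<open>Differentiating \<open>f (s, sqrt (2 ^ k * - w))\<close> in \<open>w\<close> gives
  \<open>- (2 ^ k)\<close> times the same expression for \<open>g\<close>, and this factor raises
  the index \<open>m\<close>. For \<open>w > 0\<close> no factor appears, so both branches become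
  those of \<open>seeley a (Suc m) g\<close>.\<close>

lemma seeley_D2:
  assumes A: "open A" and f: "even_compact A f" and s: "s \<in> A"
    and g: "even_compact A g" "\<And>s v. s \<in> A \<Longrightarrow> D2 f (s, v) = 2 * v * g (s, v)"
  shows "((\<lambda>r. seeley a m f (s, r)) has_real_derivative seeley a (Suc m) g (s, w)) (at w)"
proof -
  have sm: "smooth_on (A \<times> UNIV) f" using f by (simp add: even_compact_def)
  have D: "((\<lambda>r. f (s, r)) has_real_derivative 2 * v * g (s, v)) (at v)" for v
    using D2_DERIV[OF sm, of s v] g(2)[OF s, of v] s by simp
  \<comment> \<open>Used with \<open>b = - (2 ^ k)\<close> for \<open>w < 0\<close> and with
    \<open>b = 1\<close> for \<open>w > 0\<close>.\<close>
  have D_sqrt: "((\<lambda>w. f (s, sqrt (b * w))) has_real_derivative b * g (s, sqrt (b * w))) (at w)"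
    if "b * w > 0" for b w
  proof -
    have "((\<lambda>w. sqrt (b * w)) has_real_derivative b / (2 * sqrt (b * w))) (at w)"
      using that by (auto intro!: derivative_eq_intros simp: field_simps)
    from DERIV_chain2[OF D this]
    have "((\<lambda>w. f (s, sqrt (b * w))) has_real_derivative
        2 * sqrt (b * w) * g (s, sqrt (b * w)) * (b / (2 * sqrt (b * w)))) (at w)" .
    moreover have "2 * y * h * (b / (2 * y)) = b * h" if "y \<noteq> 0" for y h :: real
      using that by simp
    moreover have "sqrt (b * w) \<noteq> 0" using that by auto
    ultimately show ?thesis by metis
  qed
  have cont: "continuous_on UNIV (\<lambda>w. seeley a m h (s, w))" if "even_compact A h" for m h
    by (rule continuous_on_compose2[OF continuous_on_seeley[OF A that]])
      (use s in \<open>auto intro!: continuous_intros\<close>)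
  have off: "((\<lambda>r. seeley a m f (s, r)) has_real_derivative seeley a (Suc m) g (s, w)) (at w)"
    if "w \<noteq> 0" for w
  proof (cases "w < 0")
    case True
    obtain c where c: "\<And>s v. s \<in> A \<Longrightarrow> c < \<bar>v\<bar> \<Longrightarrow> f (s, v) = 0"
      using f unfolding even_compact_def by blast
    obtain c' where c': "\<And>s v. s \<in> A \<Longrightarrow> c' < \<bar>v\<bar> \<Longrightarrow> g (s, v) = 0"
      using g(1) unfolding even_compact_def by blast
    have w: "w / 2 < 0" "w < w / 2" using True by auto
    obtain K where K: "\<And>K' s w'. K' \<ge> K \<Longrightarrow> s \<in> A \<Longrightarrow> w' < w / 2 \<Longrightarrow>
        seeley a m f (s, w') = (\<Sum>k<K'. a k * (- (2 ^ k)) ^ m * f (s, sqrt (2 ^ k * - w')))"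
      using seeley_finite[of A c f "w / 2" m] c w(1) by blast
    obtain L where L: "\<And>K' s w'. K' \<ge> L \<Longrightarrow> s \<in> A \<Longrightarrow> w' < w / 2 \<Longrightarrow>
        seeley a (Suc m) g (s, w') = (\<Sum>k<K'. a k * (- (2 ^ k)) ^ Suc m * g (s, sqrt (2 ^ k * - w')))"
      using seeley_finite[of A c' g "w / 2" "Suc m"] c' w(1) by blast
    have "((\<lambda>w. a k * (- (2 ^ k)) ^ m * f (s, sqrt (2 ^ k * - w))) has_real_derivative
        a k * (- (2 ^ k)) ^ Suc m * g (s, sqrt (2 ^ k * - w))) (at w)" for k
    proof -
      have "- (2 ^ k) * w > 0" using True by (intro mult_neg_neg) auto
      from DERIV_cmult[OF D_sqrt[OF this], of "a k * (- (2 ^ k)) ^ m"]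
      show ?thesis by (simp add: mult_ac)
    qed
    then have "((\<lambda>w. \<Sum>k<max K L. a k * (- (2 ^ k)) ^ m * f (s, sqrt (2 ^ k * - w)))
        has_real_derivative
        (\<Sum>k<max K L. a k * (- (2 ^ k)) ^ Suc m * g (s, sqrt (2 ^ k * - w)))) (at w)"
      by (rule DERIV_sum)
    then have "((\<lambda>w. \<Sum>k<max K L. a k * (- (2 ^ k)) ^ m * f (s, sqrt (2 ^ k * - w)))
        has_real_derivative seeley a (Suc m) g (s, w)) (at w)"
      using L[of "max K L" s w] s w by (simp only: max.cobounded2)
    then show ?thesis
    proof (rule has_field_derivative_transform_within_open[where S = "{..<w / 2}"])
      show "(\<Sum>k<max K L. a k * (- (2 ^ k)) ^ m * f (s, sqrt (2 ^ k * - r))) = seeley a m f (s, r)"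
        if "r \<in> {..<w / 2}" for r
        by (rule K[symmetric, OF max.cobounded1 s]) (use that in simp)
    qed (use w in auto)
  next
    case False
    then have w: "w > 0" using that by simp
    from D_sqrt[of 1 w] w
    have "((\<lambda>w. f (s, sqrt w)) has_real_derivative seeley a (Suc m) g (s, w)) (at w)"
      by (simp add: seeley_def)
    then show ?thesis
      by (rule has_field_derivative_transform_within_open[of _ _ _ "{0<..}"])
        (use w in \<open>auto simp: seeley_def\<close>)
  qed
  show ?thesis
  proof (cases "w = 0")
    case True
    \<comment> \<open>At the gluing point the derivative is the limit of the derivatives off 0,
      which exists because \<open>seeley a (Suc m) g\<close> is already known to be
      continuous.\<close>
    have cg: "isCont (\<lambda>w. seeley a (Suc m) g (s, w)) 0"
      using cont[OF g(1)] continuous_on_eq_continuous_at[OF open_UNIV] by blast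
    show ?thesis
      unfolding True by (rule has_real_derivative_limit[OF cont[OF f] off cg])
  qed (rule off)
qed

lemma smooth_on_seeley:
  assumes A: "open A" "convex A" and f: "even_compact A f"
  shows "smooth_on (A \<times> UNIV) (seeley a m f)"
proof (rule smooth_on_of_partials[where \<F> = "{seeley a m f | m f. even_compact A f}"])
  show "open (A \<times> (UNIV :: real set))" using A by (simp add: open_Times)
  fix h assume "h \<in> {seeley a m f | m f. even_compact A f}"
  then obtain m f where h: "h = seeley a m f" and f: "even_compact A f" by blast
  show "continuous_on (A \<times> UNIV) h"
    unfolding h by (rule continuous_on_seeley[OF A(1) f])
  show "\<exists>f1\<in>{seeley a m f | m f. even_compact A f}. \<forall>s t. (s, t) \<in> A \<times> UNIV \<longrightarrow>
      ((\<lambda>r. h (r, t)) has_real_derivative f1 (s, t)) (at s)"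
    unfolding h using seeley_D1[OF A(1) f] even_compact_D1[OF A(1) f] by blast
  obtain g where "even_compact A g" "\<And>s v. s \<in> A \<Longrightarrow> D2 f (s, v) = 2 * v * g (s, v)"
    using even_compact_D2[OF A f] by blast
  then show "\<exists>f2\<in>{seeley a m f | m f. even_compact A f}. \<forall>s t. (s, t) \<in> A \<times> UNIV \<longrightarrow>
      ((\<lambda>r. h (s, r)) has_real_derivative f2 (s, t)) (at t)"
    unfolding h using seeley_D2[OF A(1) f] by blast
qed (use f in blast)

end

text \<open>Seeley's formula needs bounded support, so \<open>f\<close> is first multiplied by
  \<open>\<phi> (d\<^sup>2 - v\<^sup>2)\<close>. This cut-off is itself a function of
  \<open>v\<^sup>2\<close>; after the extension it becomes \<open>\<phi> (d\<^sup>2 - w)\<close>,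
  positive for all \<open>w < d\<^sup>2\<close> and hence divisible out. No plateau where the
  cut-off equals 1 is involved.\<close>

lemma whitney_even:
  fixes A :: "real set" and e :: real and f :: "real \<times> real \<Rightarrow> real"
  assumes A: "open A" "convex A" and e: "e > 0" and f: "smooth_on (A \<times> {- e<..<e}) f"
    and ev: "\<And>s v. s \<in> A \<Longrightarrow> \<bar>v\<bar> < e \<Longrightarrow> f (s, - v) = f (s, v)"
  obtains G d where "0 < d" "d < e" "smooth_on (A \<times> {- d\<^sup>2<..<d\<^sup>2}) G"
    "\<And>s v. s \<in> A \<Longrightarrow> \<bar>v\<bar> < d \<Longrightarrow> f (s, v) = G (s, v\<^sup>2)"
proof -
  obtain a where "seeley_coeffs a"
    using seeley_coefficients unfolding seeley_coeffs_def by metis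
  then interpret seeley_coeffs a .
  obtain \<phi> :: "real \<Rightarrow> real" where \<phi>: "smooth_on UNIV \<phi>" "\<And>x. x > 0 \<Longrightarrow> \<phi> x > 0" "\<And>x. x \<le> 0 \<Longrightarrow> \<phi> x = 0"
    using flat_function by blast
  \<comment> \<open>Any \<open>d\<close> strictly between 0 and \<open>e\<close> leaves a collar
    \<open>d < \<bar>v\<bar> < e\<close> on which the product is 0, so it continues smoothly by
    0.\<close>
  define d where "d = e / 2"
  have d: "0 < d" "d < e" using e by (auto simp: d_def)
  define h where "h = (\<lambda>x. if \<bar>snd x\<bar> < e then f x * \<phi> (d\<^sup>2 - (snd x)\<^sup>2) else 0)"
  have op: "open (A \<times> {- e<..<e})" "open (A \<times> {v. d < \<bar>v\<bar>})"
    using A by (auto intro!: open_Times open_Collect_less continuous_intros)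
  have h0: "h x = 0" if "d < \<bar>snd x\<bar>" for x
  proof -
    have "d\<^sup>2 < (snd x)\<^sup>2" using power2_strict_mono[of d "snd x"] that d by simp
    then show ?thesis using \<phi>(3)[of "d\<^sup>2 - (snd x)\<^sup>2"] by (simp add: h_def)
  qed
  have "smooth_on (A \<times> {- e<..<e}) (\<lambda>x. \<phi> (d\<^sup>2 - (snd x)\<^sup>2))"
    by (rule smooth_on_compose[OF op(1) open_UNIV subset_UNIV _ \<phi>(1)])
      (intro smooth_on_diff smooth_on_const smooth_on_power smooth_on_snd smooth_on_id op(1))
  from smooth_on_mult[OF op(1) f this] have "smooth_on (A \<times> {- e<..<e}) h"
    by (rule smooth_on_cong[OF op(1)]) (auto simp: h_def)
  moreover have "smooth_on (A \<times> {v. d < \<bar>v\<bar>}) h"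
    by (rule smooth_on_cong[OF op(2) smooth_on_const[OF op(2), of 0]]) (auto simp: h0)
  ultimately have "smooth_on (A \<times> {- e<..<e} \<union> A \<times> {v. d < \<bar>v\<bar>}) h"
    by (rule smooth_on_Un[OF op])
  then have "smooth_on (A \<times> UNIV) h"
    by (rule smooth_on_subset) (use d in auto)
  moreover have "h (s, - v) = h (s, v)" if "s \<in> A" for s v
    using ev[OF that, of v] by (simp add: h_def)
  moreover have "h (s, v) = 0" if "d < \<bar>v\<bar>" for s v using h0[of "(s, v)"] that by simp
  ultimately have h: "even_compact A h" unfolding even_compact_def by blast
  have op': "open (A \<times> {- d\<^sup>2<..<d\<^sup>2})" using A by (simp add: open_Times)
  show thesis
  proof (rule that[OF d])
    show "smooth_on (A \<times> {- d\<^sup>2<..<d\<^sup>2}) (\<lambda>x. seeley a 0 h x / \<phi> (d\<^sup>2 - snd x))"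
    proof (rule smooth_on_divide[OF op'])
      show "smooth_on (A \<times> {- d\<^sup>2<..<d\<^sup>2}) (seeley a 0 h)"
        by (rule smooth_on_subset[OF smooth_on_seeley[OF A h]]) auto
      show "smooth_on (A \<times> {- d\<^sup>2<..<d\<^sup>2}) (\<lambda>x. \<phi> (d\<^sup>2 - snd x))"
        by (rule smooth_on_compose[OF op' open_UNIV subset_UNIV _ \<phi>(1)])
          (intro smooth_on_diff smooth_on_const smooth_on_snd smooth_on_id op')
      show "\<phi> (d\<^sup>2 - snd x) \<noteq> 0" if "x \<in> A \<times> {- d\<^sup>2<..<d\<^sup>2}" for x
        using \<phi>(2)[of "d\<^sup>2 - snd x"] that by auto
    qed
    fix s v assume s: "s \<in> A" and v: "\<bar>v\<bar> < d"
    have "seeley a 0 h (s, v\<^sup>2) = h (s, \<bar>v\<bar>)"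
    proof (cases "v = 0")
      case False
      then show ?thesis by (simp add: seeley_def)
    qed (simp add: seeley_zero)
    also have "\<dots> = h (s, v)"
      using h s unfolding even_compact_def by (metis abs_if)
    also have "\<dots> = f (s, v) * \<phi> (d\<^sup>2 - v\<^sup>2)" using v d by (simp add: h_def)
    moreover have "v\<^sup>2 < d\<^sup>2" using power2_strict_mono[of v d] v d by simp
    then have "\<phi> (d\<^sup>2 - v\<^sup>2) > 0" using \<phi>(2) by simp
    ultimately show "f (s, v) = seeley a 0 h (s, v\<^sup>2) / \<phi> (d\<^sup>2 - snd (s, v\<^sup>2))" by simp
  qed
qed

section \<open>Cuspidal edges\<close>

lemma smooth_on_compose_pair:
  fixes f :: "'a::euclidean_space \<Rightarrow> 'b::euclidean_space" and g :: "'a \<Rightarrow> 'c::euclidean_space"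
    and h :: "'b \<times> 'c \<Rightarrow> 'd::euclidean_space"
  assumes "open S" "open T" "smooth_on T h" "smooth_on S f" "smooth_on S g"
    "\<And>x. x \<in> S \<Longrightarrow> (f x, g x) \<in> T"
  shows "smooth_on S (\<lambda>x. h (f x, g x))"
  by (rule smooth_on_compose[OF assms(1,2) _ smooth_on_Pair[OF assms(1,4,5)] assms(3)])
    (use assms(6) in blast)

text \<open>With \<open>Y = v\<^sup>2\<close> one has \<open>dZ = r dY = 2 v r dv\<close>, and \<open>r\<close> is divisible by \<open>v\<close>; hence \<open>v\<^sup>3\<close> divides
  \<open>Z\<close>, and splitting the quotient into its even and odd part in \<open>v\<close> expresses it through \<open>v\<^sup>2\<close>.\<close>

lemma cusp_normal_form:
  fixes Y Z :: "real \<times> real \<Rightarrow> real" and s0 :: real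
  assumes A: "open A" "convex A" "s0 \<in> A" and B: "open B" "convex B" "0 \<in> B"
    and Y: "smooth_on (A \<times> B) Y" "\<And>s. s \<in> A \<Longrightarrow> Y (s, 0) = 0" "\<And>s. s \<in> A \<Longrightarrow> D2 Y (s, 0) = 0"
    and Z: "smooth_on (A \<times> B) Z" "\<And>s. s \<in> A \<Longrightarrow> Z (s, 0) = 0"
      "\<And>s r. s \<in> A \<Longrightarrow> r \<in> B \<Longrightarrow> D2 Z (s, r) = r * D2 Y (s, r)"
    and pos: "D2 (D2 Y) (s0, 0) > 0"
  obtains N A' J v \<rho> E0 E1 where "open N" "(s0, 0) \<in> N" "N \<subseteq> A \<times> B" "smooth_on N v" "v (s0, 0) = 0"
    "open A'" "s0 \<in> A'" "A' \<subseteq> A" "open J" "0 \<in> J" "smooth_on {x. fst x \<in> A' \<and> (snd x)\<^sup>2 \<in> J} \<rho>"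
    "\<And>s r. (s, r) \<in> N \<Longrightarrow> s \<in> A' \<and> (v (s, r))\<^sup>2 \<in> J \<and> \<rho> (s, v (s, r)) = r"
    "\<And>s w. s \<in> A' \<Longrightarrow> w\<^sup>2 \<in> J \<Longrightarrow> (s, \<rho> (s, w)) \<in> N \<and> v (s, \<rho> (s, w)) = w"
    "smooth_on (A' \<times> J) E0" "smooth_on (A' \<times> J) E1" "\<And>x. x \<in> A' \<times> J \<Longrightarrow> E0 x \<noteq> 0"
    "\<And>s r. (s, r) \<in> N \<Longrightarrow> Y (s, r) = (v (s, r))\<^sup>2 \<and>
      Z (s, r) = (v (s, r)) ^ 3 * E0 (s, (v (s, r))\<^sup>2) + ((v (s, r))\<^sup>2)\<^sup>2 * E1 (s, (v (s, r))\<^sup>2)"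
proof -
  have opAB: "open (A \<times> B)" using A B by (simp add: open_Times)
  define k0 where "k0 = avg 0 (D2 (D2 Y))"
  have smk0: "smooth_on (A \<times> B) k0"
    unfolding k0_def by (rule smooth_on_avg[OF A(1,2) B smooth_on_D2[OF smooth_on_D2[OF Y(1)]]])
  have D2Y: "D2 Y (s, r) = r ^ 1 * k0 (s, r)" if "(s, r) \<in> A \<times> B" for s r
  proof -
    have "D2 Y (s, r) = r ^ Suc 0 * avg 0 (D2 (D2 Y)) (s, r)"
      by (rule eq_power_mult_avg[OF B(2,3) smooth_on_D2[OF Y(1)] _ that]) (use that Y(3) in auto)
    then show ?thesis by (simp add: k0_def)
  qed
  \<comment> \<open>A second division: \<open>Y = r\<^sup>2 b\<close>, and \<open>b (s0, 0)\<close>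
    is half of the second derivative of \<open>Y\<close>, hence positive.\<close>
  define b where "b = avg 1 k0"
  have smb: "smooth_on (A \<times> B) b"
    unfolding b_def by (rule smooth_on_avg[OF A(1,2) B smk0])
  have Yb: "Y (s, r) = r\<^sup>2 * b (s, r)" if "(s, r) \<in> A \<times> B" for s r
  proof -
    have "Y (s, r) = r ^ Suc 1 * avg 1 k0 (s, r)"
      by (rule eq_power_mult_avg[OF B(2,3) Y(1) D2Y that]) (use that Y(2) in auto)
    then show ?thesis by (simp add: b_def power2_eq_square)
  qed
  have b0: "b (s0, 0) > 0"
    using pos by (simp add: b_def k0_def avg_zero)
  define N0 where "N0 = (A \<times> B) \<inter> b -` {0<..}"
  have N0: "open N0"
    unfolding N0_def
    by (rule continuous_open_preimage[OF smooth_on_imp_continuous_on[OF smb] opAB]) simp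
  have N0_sub: "N0 \<subseteq> A \<times> B" and N0_pos: "\<And>x. x \<in> N0 \<Longrightarrow> b x > 0" and N0_mem: "(s0, 0) \<in> N0"
    using A B b0 by (auto simp: N0_def)
  define q where "q = (\<lambda>x. sqrt (b x))"
  have smq: "smooth_on N0 q"
    unfolding q_def by (rule smooth_on_sqrt[OF N0 smooth_on_subset[OF smb N0_sub] N0_pos])
  \<comment> \<open>The new parameter is \<open>r * sqrt b\<close>, a smooth square root of
    \<open>Y\<close>; its \<open>r\<close>-derivative at the base point is
    \<open>sqrt (b (s0, 0)) \<noteq> 0\<close>, so it can replace \<open>r\<close>.\<close>
  define v where "v = (\<lambda>x. snd x * q x)"
  have smv: "smooth_on N0 v"
    unfolding v_def by (rule smooth_on_mult[OF N0 smooth_on_snd[OF N0 smooth_on_id[OF N0]] smq])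
  have v2: "Y x = (v x)\<^sup>2" if "x \<in> N0" for x
    using Yb[of "fst x" "snd x"] N0_pos[OF that] N0_sub that
    by (auto simp: v_def q_def power_mult_distrib)
  have q0: "q (s0, 0) \<noteq> 0" using b0 by (simp add: q_def)
  have D2v: "D2 v (s0, 0) = q (s0, 0)"
  proof (rule D2_eqI[OF smv N0_mem])
    have "((\<lambda>r. r * q (s0, r)) has_real_derivative 1 * q (s0, 0) + D2 q (s0, 0) * 0) (at 0)"
      by (rule DERIV_mult[OF DERIV_ident D2_DERIV[OF smq N0_mem]])
    then show "((\<lambda>r. v (s0, r)) has_real_derivative q (s0, 0)) (at 0)"
      by (simp add: v_def)
  qed
  have v00: "v (s0, 0) = 0" by (simp add: v_def)
  obtain U V \<rho> where U: "open U" "(s0, 0) \<in> U" "U \<subseteq> N0" and V: "open V" and sm\<rho>: "smooth_on V \<rho>"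
    and UV: "\<And>s t. (s, t) \<in> U \<Longrightarrow> (s, v (s, t)) \<in> V \<and> \<rho> (s, v (s, t)) = t"
    and VU: "\<And>s w. (s, w) \<in> V \<Longrightarrow> (s, \<rho> (s, w)) \<in> U \<and> v (s, \<rho> (s, w)) = w"
    using fibred_inverse[OF N0 smv N0_mem] D2v q0 by auto
  have V0: "(s0, 0) \<in> V" using UV[OF U(2)] v00 by simp
  obtain e where e: "e > 0" "ball s0 e \<times> ball 0 e \<subseteq> V" using open_prod_box[OF V V0] .
  define A1 where "A1 = ball s0 e"
  have ball0: "ball 0 e = {- e<..<e}" by (auto simp: dist_real_def)
  have A1: "open A1" "convex A1" "s0 \<in> A1" using e(1) by (auto simp: A1_def)
  have B1: "open {- e<..<e}" "convex {- e<..<e}" "0 \<in> {- e<..<e}" using e(1) by auto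
  have op1: "open (A1 \<times> {- e<..<e})" using A1(1) B1(1) by (rule open_Times)
  have sub1: "A1 \<times> {- e<..<e} \<subseteq> V" using e(2) unfolding ball0 A1_def .
  have sm\<rho>1: "smooth_on (A1 \<times> {- e<..<e}) \<rho>" by (rule smooth_on_subset[OF sm\<rho> sub1])
  have mem: "(s, \<rho> (s, w)) \<in> N0" "(s, \<rho> (s, w)) \<in> A \<times> B" "v (s, \<rho> (s, w)) = w"
    if "(s, w) \<in> A1 \<times> {- e<..<e}" for s w
  proof -
    have "(s, w) \<in> V" using sub1 that by blast
    from VU[OF this] show "(s, \<rho> (s, w)) \<in> N0" "(s, \<rho> (s, w)) \<in> A \<times> B" "v (s, \<rho> (s, w)) = w"
      using U(3) N0_sub by blast+
  qed
  have \<rho>0: "\<rho> (s, 0) = 0" if "s \<in> A1" for s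
  proof -
    have m: "(s, 0) \<in> A1 \<times> {- e<..<e}" using that e(1) by auto
    from mem(3)[OF m] N0_pos[OF mem(1)[OF m]] show ?thesis by (simp add: v_def q_def)
  qed
  \<comment> \<open>\<open>k\<close> extends \<open>2 * \<rho> (s, w) / w\<close>; the factor 2
    comes from differentiating \<open>Y = w\<^sup>2\<close>.\<close>
  define k where "k = (\<lambda>x. 2 * avg 0 (D2 \<rho>) x)"
  have sma: "smooth_on (A1 \<times> {- e<..<e}) (avg 0 (D2 \<rho>))"
    by (rule smooth_on_avg[OF A1(1,2) B1 smooth_on_D2[OF sm\<rho>1]])
  have smk: "smooth_on (A1 \<times> {- e<..<e}) k"
    unfolding k_def by (rule smooth_on_mult[OF op1 smooth_on_const[OF op1] sma])
  have \<rho>_avg: "\<rho> (s, w) = w * avg 0 (D2 \<rho>) (s, w)" if "(s, w) \<in> A1 \<times> {- e<..<e}" for s w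
  proof -
    have "\<rho> (s, w) = w ^ Suc 0 * avg 0 (D2 \<rho>) (s, w)"
      by (rule eq_power_mult_avg[OF B1(2,3) sm\<rho>1 _ that]) (use that \<rho>0 in auto)
    then show ?thesis by simp
  qed
  define z where "z = (\<lambda>x. Z (fst x, \<rho> x))"
  have smz: "smooth_on (A1 \<times> {- e<..<e}) z"
    unfolding z_def
    by (rule smooth_on_compose_pair[OF op1 opAB Z(1) smooth_on_fst[OF op1 smooth_on_id[OF op1]] sm\<rho>1])
      (use mem(2) in auto)
  have D2z: "D2 z (s, w) = w\<^sup>2 * k (s, w)" if sw: "(s, w) \<in> A1 \<times> {- e<..<e}" for s w
  proof (rule D2_eqI[OF smz sw])
    have d\<rho>: "((\<lambda>w. \<rho> (s, w)) has_real_derivative D2 \<rho> (s, w)) (at w)"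
      by (rule D2_DERIV[OF sm\<rho>1 sw])
    have "((\<lambda>w. Y (s, \<rho> (s, w))) has_real_derivative D2 Y (s, \<rho> (s, w)) * D2 \<rho> (s, w)) (at w)"
      by (rule DERIV_chain2[OF D2_DERIV[OF Y(1) mem(2)[OF sw]] d\<rho>])
    moreover have "((\<lambda>w. Y (s, \<rho> (s, w))) has_real_derivative 2 * w) (at w)"
    proof (rule has_field_derivative_transform_within_open[where S = "{- e<..<e}"])
      show "((\<lambda>w. w\<^sup>2) has_real_derivative 2 * w) (at w)"
        by (auto intro!: derivative_eq_intros)
      show "r\<^sup>2 = Y (s, \<rho> (s, r))" if "r \<in> {- e<..<e}" for r
      proof -
        have "(s, r) \<in> A1 \<times> {- e<..<e}" using that sw by simp
        from v2[OF mem(1)[OF this]] mem(3)[OF this] show ?thesis by simp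
      qed
    qed (use sw in auto)
    ultimately have eq: "D2 Y (s, \<rho> (s, w)) * D2 \<rho> (s, w) = 2 * w" by (rule DERIV_unique)
    have "((\<lambda>w. Z (s, \<rho> (s, w))) has_real_derivative D2 Z (s, \<rho> (s, w)) * D2 \<rho> (s, w)) (at w)"
      by (rule DERIV_chain2[OF D2_DERIV[OF Z(1) mem(2)[OF sw]] d\<rho>])
    moreover have "D2 Z (s, \<rho> (s, w)) * D2 \<rho> (s, w) = \<rho> (s, w) * (D2 Y (s, \<rho> (s, w)) * D2 \<rho> (s, w))"
      using Z(3)[of s "\<rho> (s, w)"] mem(2)[OF sw] by simp
    moreover have "\<rho> (s, w) * (2 * w) = w\<^sup>2 * k (s, w)"
      by (subst \<rho>_avg[OF sw]) (simp add: k_def power2_eq_square)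
    ultimately show "((\<lambda>w. z (s, w)) has_real_derivative w\<^sup>2 * k (s, w)) (at w)"
      by (simp add: z_def eq)
  qed
  define E where "E = avg 2 k"
  have smE: "smooth_on (A1 \<times> {- e<..<e}) E"
    unfolding E_def by (rule smooth_on_avg[OF A1(1,2) B1 smk])
  have zE: "z (s, w) = w ^ 3 * E (s, w)" if sw: "(s, w) \<in> A1 \<times> {- e<..<e}" for s w
  proof -
    have "z (s, w) = w ^ Suc 2 * avg 2 k (s, w)"
    proof (rule eq_power_mult_avg[OF B1(2,3) smz D2z sw])
      show "z (s, 0) = 0" using sw \<rho>0[of s] Z(2)[of s] mem(2)[of s 0] e(1) by (auto simp: z_def)
    qed
    then show ?thesis by (simp add: E_def eval_nat_numeral)
  qed
  have m0: "(s0, 0) \<in> A1 \<times> {- e<..<e}" using A1(3) e(1) by simp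
  have "D2 v (s0, 0) * D2 \<rho> (s0, 0) = 1"
  proof (rule DERIV_unique)
    have "((\<lambda>w. \<rho> (s0, w)) has_real_derivative D2 \<rho> (s0, 0)) (at 0)"
      by (rule D2_DERIV[OF sm\<rho>1 m0])
    moreover have "((\<lambda>r. v (s0, r)) has_real_derivative D2 v (s0, 0)) (at (\<rho> (s0, 0)))"
      using D2_DERIV[OF smv N0_mem] \<rho>0[OF A1(3)] by simp
    ultimately show "((\<lambda>w. v (s0, \<rho> (s0, w))) has_real_derivative D2 v (s0, 0) * D2 \<rho> (s0, 0)) (at 0)"
      using DERIV_chain2[where f = "\<lambda>r. v (s0, r)" and g = "\<lambda>w. \<rho> (s0, w)"] by blast
    show "((\<lambda>w. v (s0, \<rho> (s0, w))) has_real_derivative 1) (at 0)"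
    proof (rule has_field_derivative_transform_within_open[where S = "{- e<..<e}"])
      show "((\<lambda>w. w) has_real_derivative 1) (at 0)" by simp
      show "w = v (s0, \<rho> (s0, w))" if "w \<in> {- e<..<e}" for w
        using mem(3)[of s0 w] A1(3) that by simp
    qed (use e(1) in auto)
  qed
  then have "D2 \<rho> (s0, 0) \<noteq> 0" by auto
  then have E_nz: "E (s0, 0) \<noteq> 0" by (simp add: E_def k_def avg_zero)
  \<comment> \<open>The reflection of \<open>E\<close>, from which its even part \<open>Ee\<close>
    and odd part \<open>Eo\<close> in \<open>w\<close> are formed. \<open>Eo\<close> is
    \<open>w\<close> times an even function, so Whitney's theorem applies to both pieces.\<close>
  define R where "R = (\<lambda>x. E (fst x, - snd x))"
  have smR: "smooth_on (A1 \<times> {- e<..<e}) R"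
    unfolding R_def
    by (rule smooth_on_compose_pair[OF op1 op1 smE smooth_on_fst[OF op1 smooth_on_id[OF op1]]
          smooth_on_uminus[OF op1 smooth_on_snd[OF op1 smooth_on_id[OF op1]]]]) auto
  define Ee where "Ee = (\<lambda>x. 1 / 2 * (E x + R x))"
  define Eo where "Eo = (\<lambda>x. 1 / 2 * (E x - R x))"
  have smEe: "smooth_on (A1 \<times> {- e<..<e}) Ee"
    unfolding Ee_def
    by (rule smooth_on_mult[OF op1 smooth_on_const[OF op1] smooth_on_add[OF op1 smE smR]])
  have smEo: "smooth_on (A1 \<times> {- e<..<e}) Eo"
    unfolding Eo_def
    by (rule smooth_on_mult[OF op1 smooth_on_const[OF op1] smooth_on_diff[OF op1 smE smR]])
  define k1 where "k1 = avg 0 (D2 Eo)"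
  have smk1: "smooth_on (A1 \<times> {- e<..<e}) k1"
    unfolding k1_def by (rule smooth_on_avg[OF A1(1,2) B1 smooth_on_D2[OF smEo]])
  have Eo: "Eo (s, w) = w * k1 (s, w)" if "(s, w) \<in> A1 \<times> {- e<..<e}" for s w
  proof -
    have "Eo (s, w) = w ^ Suc 0 * avg 0 (D2 Eo) (s, w)"
      by (rule eq_power_mult_avg[OF B1(2,3) smEo _ that]) (auto simp: Eo_def R_def)
    then show ?thesis by (simp add: k1_def)
  qed
  obtain E0 d0 where E0: "0 < d0" "d0 < e" "smooth_on (A1 \<times> {- d0\<^sup>2<..<d0\<^sup>2}) E0"
    "\<And>s v. s \<in> A1 \<Longrightarrow> \<bar>v\<bar> < d0 \<Longrightarrow> Ee (s, v) = E0 (s, v\<^sup>2)"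
    by (rule whitney_even[OF A1(1,2) e(1) smEe]) (auto simp: Ee_def R_def)
  have k1_even: "k1 (s, - w) = k1 (s, w)" if "s \<in> A1" "\<bar>w\<bar> < e" for s w
  proof (cases "w = 0")
    case False
    have "Eo (s, - w) = - Eo (s, w)" by (simp add: Eo_def R_def algebra_simps)
    moreover have "Eo (s, w) = w * k1 (s, w)" "Eo (s, - w) = - w * k1 (s, - w)"
      using Eo[of s w] Eo[of s "- w"] that by (auto simp: abs_less_iff)
    ultimately show ?thesis using False by simp
  qed simp
  obtain E1 d1 where E1: "0 < d1" "d1 < e" "smooth_on (A1 \<times> {- d1\<^sup>2<..<d1\<^sup>2}) E1"
    "\<And>s v. s \<in> A1 \<Longrightarrow> \<bar>v\<bar> < d1 \<Longrightarrow> k1 (s, v) = E1 (s, v\<^sup>2)"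
    using whitney_even[OF A1(1,2) e(1) smk1 k1_even] by metis
  define d where "d = min d0 d1"
  have d: "0 < d" "d < e" "d \<le> d0" "d \<le> d1" using E0 E1 by (auto simp: d_def)
  have dsq: "d\<^sup>2 \<le> d0\<^sup>2" "d\<^sup>2 \<le> d1\<^sup>2" using d by (auto intro!: power_mono)
  have split: "E (s, w) = E0 (s, w\<^sup>2) + w * E1 (s, w\<^sup>2)" if "s \<in> A1" "\<bar>w\<bar> < d" for s w
  proof -
    have "E (s, w) = Ee (s, w) + Eo (s, w)" by (simp add: Ee_def Eo_def field_simps)
    then show ?thesis using E0(4)[of s w] E1(4)[of s w] Eo[of s w] that d by (auto simp: abs_less_iff)
  qed
  \<comment> \<open>\<open>E0 (s0, 0)\<close> equals \<open>E (s0, 0)\<close>, a nonzero multiple of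
    \<open>D2 \<rho> (s0, 0)\<close>. Near the base point \<open>E0\<close> can therefore be a
    denominator.\<close>
  define T where "T = (A1 \<times> {- d\<^sup>2<..<d\<^sup>2}) \<inter> E0 -` (- {0})"
  have opd: "open (A1 \<times> {- d\<^sup>2<..<d\<^sup>2})" using A1(1) by (simp add: open_Times)
  have smE0: "smooth_on (A1 \<times> {- d\<^sup>2<..<d\<^sup>2}) E0" "smooth_on (A1 \<times> {- d\<^sup>2<..<d\<^sup>2}) E1"
    by (rule smooth_on_subset[OF E0(3)], use dsq in force)
      (rule smooth_on_subset[OF E1(3)], use dsq in force)
  have T: "open T"
    unfolding T_def
    by (rule continuous_open_preimage[OF smooth_on_imp_continuous_on[OF smE0(1)] opd]) auto
  have T0: "(s0, 0) \<in> T"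
    using split[of s0 0] E_nz A1(3) d(1) by (auto simp: T_def)
  obtain e' where e': "e' > 0" "ball s0 e' \<times> ball 0 e' \<subseteq> T" using open_prod_box[OF T T0] .
  define A' where "A' = ball s0 e'"
  define J where "J = ball (0 :: real) e'"
  have sT: "A' \<times> J \<subseteq> T" using e'(2) by (simp add: A'_def J_def)
  have s0A': "s0 \<in> A'" "0 \<in> J" "open A'" "open J" using e'(1) by (auto simp: A'_def J_def)
  have A'1: "s \<in> A1" if "s \<in> A'" for s using sT s0A' that by (auto simp: T_def)
  have J: "\<bar>w\<bar> < d" if "w\<^sup>2 \<in> J" for w
  proof -
    have "(s0, w\<^sup>2) \<in> T" using sT s0A' that by auto
    then have "w\<^sup>2 < d\<^sup>2" by (simp add: T_def)
    then show ?thesis using d(1) power2_less_imp_less[of "\<bar>w\<bar>" d] by simp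
  qed
  \<comment> \<open>The restriction is put on the square of \<open>v\<close>, so in the coordinates
    \<open>(s, v)\<close> the set \<open>N\<close> consists of all \<open>(s, w)\<close> with
    \<open>s \<in> A'\<close> and \<open>w\<^sup>2 \<in> J\<close>, and the source and target
    domains match exactly.\<close>
  define N where "N = U \<inter> (\<lambda>x. (fst x, (v x)\<^sup>2)) -` (A' \<times> J)"
  have "continuous_on U (\<lambda>x. (fst x, (v x)\<^sup>2))"
    using smooth_on_imp_continuous_on[OF smooth_on_subset[OF smv U(3)]]
    by (intro continuous_intros)
  then have opN: "open N"
    unfolding N_def by (rule continuous_open_preimage[OF _ U(1)]) (use s0A' in \<open>simp add: open_Times\<close>)
  have NU: "x \<in> U" if "x \<in> N" for x using that by (simp add: N_def)
  show thesis
  proof (rule that[of N v A' J \<rho> E0 E1])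
    show "open N" by (rule opN)
    show "(s0, 0) \<in> N" using U(2) s0A' v00 by (simp add: N_def)
    show "N \<subseteq> A \<times> B" using NU U(3) N0_sub by blast
    show "smooth_on N v" by (rule smooth_on_subset[OF smv]) (use NU U(3) in blast)
    show "v (s0, 0) = 0" by (rule v00)
    show "open A'" "s0 \<in> A'" "open J" "0 \<in> J" using s0A' by auto
    show "A' \<subseteq> A"
    proof
      fix s assume "s \<in> A'"
      then have "(s, 0) \<in> A1 \<times> {- e<..<e}" using A'1 e(1) by simp
      from mem(2)[OF this] show "s \<in> A" by simp
    qed
    have M: "(s, w) \<in> A1 \<times> {- e<..<e}" if "s \<in> A'" "w\<^sup>2 \<in> J" for s w
      using A'1[OF that(1)] J[OF that(2)] d(2) by auto
    show "smooth_on {x. fst x \<in> A' \<and> (snd x)\<^sup>2 \<in> J} \<rho>"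
      by (rule smooth_on_subset[OF sm\<rho>1]) (use M in auto)
    show "s \<in> A' \<and> (v (s, r))\<^sup>2 \<in> J \<and> \<rho> (s, v (s, r)) = r" if "(s, r) \<in> N" for s r
      using that UV[OF NU[OF that]] by (simp add: N_def)
    show "(s, \<rho> (s, w)) \<in> N \<and> v (s, \<rho> (s, w)) = w" if "s \<in> A'" "w\<^sup>2 \<in> J" for s w
    proof -
      have "(s, w) \<in> V" using M[OF that] sub1 by blast
      from VU[OF this] that show ?thesis by (simp add: N_def)
    qed
    show "smooth_on (A' \<times> J) E0" "smooth_on (A' \<times> J) E1"
      using smooth_on_subset[OF smE0(1)] smooth_on_subset[OF smE0(2)] sT by (auto simp: T_def)
    show "E0 x \<noteq> 0" if "x \<in> A' \<times> J" for x using that sT by (auto simp: T_def)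
    show "Y (s, r) = (v (s, r))\<^sup>2 \<and>
      Z (s, r) = (v (s, r)) ^ 3 * E0 (s, (v (s, r))\<^sup>2) + ((v (s, r))\<^sup>2)\<^sup>2 * E1 (s, (v (s, r))\<^sup>2)"
      if sr: "(s, r) \<in> N" for s r
    proof -
      define w where "w = v (s, r)"
      have w: "s \<in> A'" "w\<^sup>2 \<in> J" "\<rho> (s, w) = r"
        using sr UV[OF NU[OF sr]] by (auto simp: N_def w_def)
      have "Z (s, r) = z (s, w)" using w(3) by (simp add: z_def)
      also have "\<dots> = w ^ 3 * (E0 (s, w\<^sup>2) + w * E1 (s, w\<^sup>2))"
        using zE[OF M[OF w(1,2)]] split[OF A'1[OF w(1)] J[OF w(2)]] by simp
      also have "\<dots> = w ^ 3 * E0 (s, w\<^sup>2) + (w\<^sup>2)\<^sup>2 * E1 (s, w\<^sup>2)"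
        by (simp add: algebra_simps eval_nat_numeral)
      finally show ?thesis using v2[of "(s, r)"] NU[OF sr] U(3) by (auto simp: w_def)
    qed
  qed
qed

lemma diffeomorphism_with_inverseI:
  assumes "open A" "open B" "\<And>x. x \<in> A \<Longrightarrow> f x \<in> B \<and> g (f x) = x"
    "\<And>y. y \<in> B \<Longrightarrow> g y \<in> A \<and> f (g y) = y" "smooth_on A f" "smooth_on B g"
  shows "diffeomorphism_with_inverse A B f g"
  unfolding diffeomorphism_with_inverse_def
  using assms by (auto simp: image_iff) metis+

lemma cuspidal_edge_of_front:
  fixes f :: "real \<times> real \<Rightarrow> real \<times> real \<times> real" and y z :: "real \<times> real \<Rightarrow> real"
  assumes S: "open S" "(s0, t0) \<in> S" and y: "smooth_on S y" and z: "smooth_on S z"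
    and f: "\<And>s t. (s, t) \<in> S \<Longrightarrow> f (s, t) = (s, y (s, t), z (s, t))"
    and tan: "\<And>s t. (s, t) \<in> S \<Longrightarrow> D2 z (s, t) = t * D2 y (s, t)"
    and y1: "D2 y (s0, t0) = 0" and y2: "D2 (D2 y) (s0, t0) \<noteq> 0"
  shows "cuspidal_edge_at f (s0, t0)"
proof -
  obtain U1 V1 \<rho>1 where U1: "open U1" "(s0, t0) \<in> U1" "U1 \<subseteq> S" and V1: "open V1" "smooth_on V1 \<rho>1"
    and UV1: "\<And>s t. (s, t) \<in> U1 \<Longrightarrow> (s, D2 y (s, t)) \<in> V1 \<and> \<rho>1 (s, D2 y (s, t)) = t"
    and VU1: "\<And>s v. (s, v) \<in> V1 \<Longrightarrow> (s, \<rho>1 (s, v)) \<in> U1 \<and> D2 y (s, \<rho>1 (s, v)) = v"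
    by (rule fibred_inverse[OF S(1) smooth_on_D2[OF y] S(2) y2]) (rule that)
  \<comment> \<open>The level 0 of \<open>D2 y\<close>, solved for \<open>t\<close>: the curve of
    cusp parameters.\<close>
  define \<tau> where "\<tau> = (\<lambda>s. \<rho>1 (s, 0))"
  define V0 where "V0 = (\<lambda>s. (s, 0 :: real)) -` V1"
  have V0: "open V0" unfolding V0_def by (intro open_vimage V1 continuous_intros)
  have s0V0: "s0 \<in> V0" and \<tau>0: "\<tau> s0 = t0"
    using UV1[OF U1(2)] y1 by (auto simp: V0_def \<tau>_def)
  have sm\<tau>: "smooth_on V0 \<tau>"
    unfolding \<tau>_def
    by (rule smooth_on_compose_pair[OF V0 V1(1,2) smooth_on_id[OF V0] smooth_on_const[OF V0]])
      (simp add: V0_def)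
  have \<tau>S: "(s, \<tau> s) \<in> S" "D2 y (s, \<tau> s) = 0" if "s \<in> V0" for s
    using VU1[of s 0] U1(3) that by (auto simp: V0_def \<tau>_def)
  define R where "R = (V0 \<times> UNIV) \<inter> (\<lambda>x. (fst x, \<tau> (fst x) + snd x)) -` S"
  have "continuous_on (V0 \<times> (UNIV :: real set)) (\<lambda>x. \<tau> (fst x))"
    by (rule continuous_on_compose2[OF smooth_on_imp_continuous_on[OF sm\<tau>]])
      (auto intro!: continuous_intros)
  then have "continuous_on (V0 \<times> UNIV) (\<lambda>x. (fst x, \<tau> (fst x) + snd x))"
    by (intro continuous_intros)
  then have R: "open R"
    unfolding R_def by (rule continuous_open_preimage) (use V0 S in \<open>auto simp: open_Times\<close>)
  have "(s0, 0) \<in> R" using s0V0 \<tau>0 S(2) by (simp add: R_def)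
  then obtain e where e: "e > 0" "ball s0 e \<times> ball 0 e \<subseteq> R" by (rule open_prod_box[OF R]) (rule that)
  define A where "A = ball s0 e"
  define B where "B = ball (0 :: real) e"
  have A: "open A" "convex A" "s0 \<in> A" and B: "open B" "convex B" "0 \<in> B"
    using e(1) by (auto simp: A_def B_def)
  have opAB: "open (A \<times> B)" using A B by (simp add: open_Times)
  have AB: "s \<in> V0" "(s, \<tau> s + r) \<in> S" if "s \<in> A" "r \<in> B" for s r
  proof -
    have "(s, r) \<in> R" using e(2) that unfolding A_def B_def by blast
    then show "s \<in> V0" "(s, \<tau> s + r) \<in> S" by (auto simp: R_def)
  qed
  have AV0: "A \<subseteq> V0" using AB(1) B(3) by blast
  have sm\<tau>A: "smooth_on A \<tau>" by (rule smooth_on_subset[OF sm\<tau> AV0])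
  have sm1: "smooth_on (A \<times> B) (\<lambda>x. g (fst x))" if "smooth_on A g" for g :: "real \<Rightarrow> real"
    by (rule smooth_on_compose[OF opAB A(1) _ smooth_on_fst[OF opAB smooth_on_id[OF opAB]] that]) auto
  have sh: "smooth_on (A \<times> B) (\<lambda>x. g (fst x, \<tau> (fst x) + snd x))" if "smooth_on S g" for g :: "real \<times> real \<Rightarrow> real"
    by (rule smooth_on_compose_pair[OF opAB S(1) that smooth_on_fst[OF opAB smooth_on_id[OF opAB]]
          smooth_on_add[OF opAB sm1[OF sm\<tau>A] smooth_on_snd[OF opAB smooth_on_id[OF opAB]]]])
      (use AB in auto)
  have Dsh: "((\<lambda>r. g (s, \<tau> s + r)) has_real_derivative D2 g (s, \<tau> s + r)) (at r)"
    if "smooth_on S g" "s \<in> A" "r \<in> B" for g s r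
  proof -
    have "((\<lambda>r. \<tau> s + r) has_real_derivative 1) (at r)" by (auto intro!: derivative_eq_intros)
    from DERIV_chain2[OF D2_DERIV[OF that(1) AB(2)[OF that(2,3)]] this] show ?thesis by simp
  qed
  \<comment> \<open>Orients \<open>Y\<close> so that its second derivative is positive and its
    square root exists. \<open>Z\<close> receives the same sign, which preserves the relation
    \<open>D2 Z = r * D2 Y\<close>.\<close>
  define \<sigma> where "\<sigma> = sgn (D2 (D2 y) (s0, t0))"
  have \<sigma>: "\<sigma> * \<sigma> = 1" using y2 by (simp add: \<sigma>_def sgn_if)
  have \<sigma>_cancel: "\<sigma> * (\<sigma> * a) = a" for a using \<sigma> by (simp add: mult.assoc[symmetric])
  define y0 where "y0 = (\<lambda>s. y (s, \<tau> s))"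
  \<comment> \<open>Subtracting \<open>\<tau>(s) y\<close> turns the slope \<open>t\<close> into
    \<open>t - \<tau>(s)\<close>, the new parameter \<open>r\<close>; \<open>c0\<close> is the
    remaining height at the cusp.\<close>
  define c0 where "c0 = (\<lambda>s. z (s, \<tau> s) - \<tau> s * y0 s)"
  have smS: "smooth_on A (\<lambda>s. g (s, \<tau> s))" if "smooth_on S g" for g :: "real \<times> real \<Rightarrow> real"
    by (rule smooth_on_compose_pair[OF A(1) S(1) that smooth_on_id[OF A(1)] sm\<tau>A])
      (use \<tau>S AV0 in blast)
  have smy0: "smooth_on A y0" unfolding y0_def by (rule smS[OF y])
  have smc0: "smooth_on A c0"
    unfolding c0_def
    by (rule smooth_on_diff[OF A(1) smS[OF z] smooth_on_mult[OF A(1) sm\<tau>A smy0]])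
  define Y where "Y = (\<lambda>x. \<sigma> * (y (fst x, \<tau> (fst x) + snd x) - y0 (fst x)))"
  define Z where "Z = (\<lambda>x. \<sigma> * (z (fst x, \<tau> (fst x) + snd x)
    - \<tau> (fst x) * y (fst x, \<tau> (fst x) + snd x) - c0 (fst x)))"
  have smY: "smooth_on (A \<times> B) Y"
    unfolding Y_def
    by (rule smooth_on_mult[OF opAB smooth_on_const[OF opAB] smooth_on_diff[OF opAB sh[OF y] sm1[OF smy0]]])
  have smZ: "smooth_on (A \<times> B) Z"
    unfolding Z_def
    by (rule smooth_on_mult[OF opAB smooth_on_const[OF opAB] smooth_on_diff[OF opAB
            smooth_on_diff[OF opAB sh[OF z] smooth_on_mult[OF opAB sm1[OF sm\<tau>A] sh[OF y]]] sm1[OF smc0]]])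
  have D2Y: "D2 Y (s, r) = \<sigma> * D2 y (s, \<tau> s + r)" if "s \<in> A" "r \<in> B" for s r
  proof (rule D2_eqI[OF smY])
    show "((\<lambda>r. Y (s, r)) has_real_derivative \<sigma> * D2 y (s, \<tau> s + r)) (at r)"
      using DERIV_cmult[OF DERIV_diff[OF Dsh[OF y that] DERIV_const[of "y0 s"]], of \<sigma>]
      by (simp add: Y_def)
  qed (use that in simp)
  have D2Z: "D2 Z (s, r) = r * D2 Y (s, r)" if "s \<in> A" "r \<in> B" for s r
  proof (rule D2_eqI[OF smZ])
    have "\<sigma> * (D2 z (s, \<tau> s + r) - \<tau> s * D2 y (s, \<tau> s + r) - 0) = r * D2 Y (s, r)"
      using tan[OF AB(2)[OF that]] D2Y[OF that] by (simp add: algebra_simps)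
    then show "((\<lambda>r. Z (s, r)) has_real_derivative r * D2 Y (s, r)) (at r)"
      using DERIV_cmult[OF DERIV_diff[OF DERIV_diff[OF Dsh[OF z that] DERIV_cmult[OF Dsh[OF y that], of "\<tau> s"]]
            DERIV_const[of "c0 s"]], of \<sigma>]
      by (simp add: Z_def)
  qed (use that in simp)
  have "D2 (D2 Y) (s0, 0) = \<sigma> * D2 (D2 y) (s0, t0)"
  proof (rule D2_eqI[OF smooth_on_D2[OF smY]])
    show "((\<lambda>r. D2 Y (s0, r)) has_real_derivative \<sigma> * D2 (D2 y) (s0, t0)) (at 0)"
    proof (rule has_field_derivative_transform_within_open[OF _ B(1,3)])
      show "((\<lambda>r. \<sigma> * D2 y (s0, \<tau> s0 + r)) has_real_derivative \<sigma> * D2 (D2 y) (s0, t0)) (at 0)"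
        using DERIV_cmult[OF Dsh[OF smooth_on_D2[OF y] A(3) B(3)], of \<sigma>] by (simp add: \<tau>0)
    qed (simp add: D2Y A(3))
  qed (use A B in simp)
  moreover have "\<sigma> * D2 (D2 y) (s0, t0) > 0"
    using y2 by (simp add: \<sigma>_def sgn_if)
  ultimately have pos: "D2 (D2 Y) (s0, 0) > 0" by simp
  have Y0: "Y (s, 0) = 0" "Z (s, 0) = 0" for s
    by (simp_all add: Y_def Z_def y0_def c0_def)
  have Y1: "D2 Y (s, 0) = 0" if "s \<in> A" for s
    using D2Y[OF that B(3)] \<tau>S(2)[of s] AV0 that by auto
  obtain N A' J v \<rho> E0 E1 where N: "open N" "(s0, 0) \<in> N" "N \<subseteq> A \<times> B" and v: "smooth_on N v" "v (s0, 0) = 0"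
    and A': "open A'" "s0 \<in> A'" "A' \<subseteq> A" and J: "open J" "0 \<in> J"
    and \<rho>: "smooth_on {x. fst x \<in> A' \<and> (snd x)\<^sup>2 \<in> J} \<rho>"
    and v\<rho>: "\<And>s r. (s, r) \<in> N \<Longrightarrow> s \<in> A' \<and> (v (s, r))\<^sup>2 \<in> J \<and> \<rho> (s, v (s, r)) = r"
    and \<rho>v: "\<And>s w. s \<in> A' \<Longrightarrow> w\<^sup>2 \<in> J \<Longrightarrow> (s, \<rho> (s, w)) \<in> N \<and> v (s, \<rho> (s, w)) = w"
    and E: "smooth_on (A' \<times> J) E0" "smooth_on (A' \<times> J) E1" and E0: "\<And>x. x \<in> A' \<times> J \<Longrightarrow> E0 x \<noteq> 0"
    and YZ: "\<And>s r. (s, r) \<in> N \<Longrightarrow> Y (s, r) = (v (s, r))\<^sup>2 \<and>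
      Z (s, r) = (v (s, r)) ^ 3 * E0 (s, (v (s, r))\<^sup>2) + ((v (s, r))\<^sup>2)\<^sup>2 * E1 (s, (v (s, r))\<^sup>2)"
    by (rule cusp_normal_form[OF A B smY Y0(1) Y1 smZ Y0(2) D2Z pos]) (assumption | rule that)+
  have opA'J: "open (A' \<times> J)" using A' J by (simp add: open_Times)
  have smA': "smooth_on A' \<tau>" "smooth_on A' y0" "smooth_on A' c0"
    using sm\<tau>A smy0 smc0 A'(3) smooth_on_subset by blast+

  define N' where "N' = (A' \<times> UNIV) \<inter> (\<lambda>x. (fst x, snd x - \<tau> (fst x))) -` N"
  have opA'U: "open (A' \<times> (UNIV :: real set))" using A' by (simp add: open_Times)
  have sm\<tau>U: "smooth_on (A' \<times> (UNIV :: real set)) (\<lambda>x. (fst x, snd x - \<tau> (fst x)))"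
    by (rule smooth_on_Pair[OF opA'U smooth_on_fst[OF opA'U smooth_on_id[OF opA'U]]
          smooth_on_diff[OF opA'U smooth_on_snd[OF opA'U smooth_on_id[OF opA'U]]
            smooth_on_compose[OF opA'U A'(1) _ smooth_on_fst[OF opA'U smooth_on_id[OF opA'U]] smA'(1)]]]) auto
  have opN': "open N'"
    unfolding N'_def
    by (rule continuous_open_preimage[OF smooth_on_imp_continuous_on[OF sm\<tau>U] opA'U N(1)])
  have N': "(s, t) \<in> N' \<longleftrightarrow> (s, t - \<tau> s) \<in> N" for s t
    using v\<rho> by (auto simp: N'_def)
  \<comment> \<open>Translated by \<open>s0\<close>, because the model germ is based at the
    origin.\<close>
  define M' where "M' = {x :: real \<times> real. fst x + s0 \<in> A' \<and> (snd x)\<^sup>2 \<in> J}"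
  have opM': "open M'"
  proof -
    have "M' = (\<lambda>x. (fst x + s0, (snd x)\<^sup>2)) -` (A' \<times> J)" by (auto simp: M'_def)
    also have "open \<dots>" by (intro open_vimage opA'J continuous_intros)
    finally show ?thesis .
  qed
  have opM: "open {x :: real \<times> real. fst x \<in> A' \<and> (snd x)\<^sup>2 \<in> J}"
  proof -
    have "{x :: real \<times> real. fst x \<in> A' \<and> (snd x)\<^sup>2 \<in> J} = (\<lambda>x. (fst x, (snd x)\<^sup>2)) -` (A' \<times> J)" by auto
    also have "open \<dots>" by (intro open_vimage opA'J continuous_intros)
    finally show ?thesis .
  qed
  define \<phi> where "\<phi> = (\<lambda>x. (fst x - s0, v (fst x, snd x - \<tau> (fst x))))"
  define \<phi>' where "\<phi>' = (\<lambda>x. (fst x + s0, \<tau> (fst x + s0) + \<rho> (fst x + s0, snd x)))"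
  have shift_sm: "smooth_on M' (\<lambda>x. fst x + s0)"
    by (rule smooth_on_add[OF opM' smooth_on_fst[OF opM' smooth_on_id[OF opM']] smooth_on_const[OF opM']])
  have diff\<phi>: "diffeomorphism_with_inverse N' M' \<phi> \<phi>'"
  proof (rule diffeomorphism_with_inverseI[OF opN' opM'])
    fix x assume "x \<in> N'"
    then have "(fst x, snd x - \<tau> (fst x)) \<in> N" using N'[of "fst x" "snd x"] by simp
    from v\<rho>[OF this] show "\<phi> x \<in> M' \<and> \<phi>' (\<phi> x) = x"
      by (simp add: \<phi>_def \<phi>'_def M'_def)
  next
    fix x assume "x \<in> M'"
    then have "fst x + s0 \<in> A'" "(snd x)\<^sup>2 \<in> J" by (auto simp: M'_def)
    from \<rho>v[OF this] show "\<phi>' x \<in> N' \<and> \<phi> (\<phi>' x) = x"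
      by (simp add: \<phi>_def \<phi>'_def N')
  next
    have sub: "N' \<subseteq> A' \<times> UNIV" by (auto simp: N'_def)
    show "smooth_on N' \<phi>"
      unfolding \<phi>_def
      by (rule smooth_on_Pair[OF opN' smooth_on_diff[OF opN' smooth_on_fst[OF opN' smooth_on_id[OF opN']]
              smooth_on_const[OF opN']] smooth_on_compose[OF opN' N(1) _ smooth_on_subset[OF sm\<tau>U sub] v(1)]])
        (auto simp: N'_def)
    show "smooth_on M' \<phi>'"
      unfolding \<phi>'_def
    proof (rule smooth_on_Pair[OF opM' shift_sm smooth_on_add[OF opM']])
      show "smooth_on M' (\<lambda>x. \<tau> (fst x + s0))"
        by (rule smooth_on_compose[OF opM' A'(1) _ shift_sm smA'(1)]) (auto simp: M'_def)
      show "smooth_on M' (\<lambda>x. \<rho> (fst x + s0, snd x))"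
        by (rule smooth_on_compose_pair[OF opM' opM \<rho> shift_sm smooth_on_snd[OF opM' smooth_on_id[OF opM']]])
          (auto simp: M'_def)
    qed
  qed

  \<comment> \<open>Only the second target coordinate is confined, to where \<open>E0\<close> and
    \<open>E1\<close> are defined; the third is free because \<open>\<psi>\<close> is affine in
    it.\<close>
  define P where "P = (A' \<times> (UNIV :: (real \<times> real) set)) \<inter> (\<lambda>x. \<sigma> * (fst (snd x) - y0 (fst x))) -` J"
  define Q where "Q = {x :: real \<times> real \<times> real. fst x + s0 \<in> A' \<and> fst (snd x) \<in> J}"
  have opA'U2: "open (A' \<times> (UNIV :: (real \<times> real) set))" using A' by (simp add: open_Times)
  have smfst: "smooth_on (A' \<times> (UNIV :: (real \<times> real) set)) (\<lambda>x. g (fst x))"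
    if "smooth_on A' g" for g :: "real \<Rightarrow> real"
    by (rule smooth_on_compose[OF opA'U2 A'(1) _ smooth_on_fst[OF opA'U2 smooth_on_id[OF opA'U2]] that]) auto
  have smfs: "smooth_on T (\<lambda>x. fst (snd x))" "smooth_on T (\<lambda>x. snd (snd x))" "smooth_on T (\<lambda>x. fst x)"
    if "open T" for T :: "(real \<times> real \<times> real) set"
    using smooth_on_fst[OF that smooth_on_snd[OF that smooth_on_id[OF that]]]
      smooth_on_snd[OF that smooth_on_snd[OF that smooth_on_id[OF that]]]
      smooth_on_fst[OF that smooth_on_id[OF that]] by auto
  \<comment> \<open>\<open>a\<close> and \<open>b\<close> extend the normalisations \<open>Y\<close>
    and \<open>Z\<close> from the surface to the ambient space; each is affine in \<open>y\<close>
    and \<open>z\<close> for fixed \<open>s\<close>, so it inverts explicitly.\<close>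
  define a where "a = (\<lambda>x :: real \<times> real \<times> real. \<sigma> * (fst (snd x) - y0 (fst x)))"
  define b where "b = (\<lambda>x :: real \<times> real \<times> real. \<sigma> * (snd (snd x) - \<tau> (fst x) * fst (snd x) - c0 (fst x)))"
  have sma: "smooth_on (A' \<times> UNIV) a"
    unfolding a_def
    by (rule smooth_on_mult[OF opA'U2 smooth_on_const[OF opA'U2]
          smooth_on_diff[OF opA'U2 smfs(1)[OF opA'U2] smfst[OF smA'(2)]]])
  have smb: "smooth_on (A' \<times> UNIV) b"
    unfolding b_def
    by (rule smooth_on_mult[OF opA'U2 smooth_on_const[OF opA'U2] smooth_on_diff[OF opA'U2
            smooth_on_diff[OF opA'U2 smfs(2)[OF opA'U2] smooth_on_mult[OF opA'U2 smfst[OF smA'(1)]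
                smfs(1)[OF opA'U2]]] smfst[OF smA'(3)]]])
  have P_eq: "P = (A' \<times> UNIV) \<inter> a -` J" by (simp add: P_def a_def)
  have opP: "open P"
    unfolding P_eq
    by (rule continuous_open_preimage[OF smooth_on_imp_continuous_on[OF sma] opA'U2 J(1)])
  have opQ: "open Q"
  proof -
    have "Q = (\<lambda>x. (fst x + s0, fst (snd x))) -` (A' \<times> J)" by (auto simp: Q_def)
    also have "open \<dots>" by (intro open_vimage opA'J continuous_intros)
    finally show ?thesis .
  qed
  define \<psi> where "\<psi> = (\<lambda>x. (fst x - s0, a x, (b x - (a x)\<^sup>2 * E1 (fst x, a x)) / E0 (fst x, a x)))"
  define \<psi>' where "\<psi>' = (\<lambda>x. (fst x + s0, \<sigma> * fst (snd x) + y0 (fst x + s0),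
    \<sigma> * (snd (snd x) * E0 (fst x + s0, fst (snd x)) + (fst (snd x))\<^sup>2 * E1 (fst x + s0, fst (snd x)))
      + \<tau> (fst x + s0) * (\<sigma> * fst (snd x) + y0 (fst x + s0)) + c0 (fst x + s0)))"
  have diff\<psi>: "diffeomorphism_with_inverse P Q \<psi> \<psi>'"
  proof (rule diffeomorphism_with_inverseI[OF opP opQ])
    fix x assume x: "x \<in> P"
    then have "(fst x, a x) \<in> A' \<times> J" by (auto simp: P_eq)
    with E0[OF this] have "fst x \<in> A'" "a x \<in> J" "E0 (fst x, a x) \<noteq> 0" by auto
    then show "\<psi> x \<in> Q \<and> \<psi>' (\<psi> x) = x"
      by (simp add: \<psi>_def \<psi>'_def Q_def prod_eq_iff) (simp add: a_def b_def \<sigma>_cancel)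
  next
    fix x assume "x \<in> Q"
    then have x: "fst x + s0 \<in> A'" "fst (snd x) \<in> J" by (auto simp: Q_def)
    have nz: "E0 (fst x + s0, fst (snd x)) \<noteq> 0" by (rule E0) (use x in simp)
    have a: "a (\<psi>' x) = fst (snd x)" by (simp add: a_def \<psi>'_def \<sigma>_cancel)
    have b: "b (\<psi>' x) = snd (snd x) * E0 (fst x + s0, fst (snd x))
        + (fst (snd x))\<^sup>2 * E1 (fst x + s0, fst (snd x))"
      by (simp add: b_def \<psi>'_def \<sigma>_cancel)
    have fst: "fst (\<psi>' x) = fst x + s0" by (simp add: \<psi>'_def)
    show "\<psi>' x \<in> P \<and> \<psi> (\<psi>' x) = x"
      using x nz unfolding P_eq \<psi>_def a b fst
      by (auto simp: a fst mem_Times_iff prod_eq_iff)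
  next
    have sub: "P \<subseteq> A' \<times> UNIV" by (auto simp: P_eq)
    have smaP: "smooth_on P a" "smooth_on P b"
      using smooth_on_subset[OF sma sub] smooth_on_subset[OF smb sub] by auto
    have smEP: "smooth_on P (\<lambda>x. g (fst x, a x))" if "smooth_on (A' \<times> J) g" for g :: "real \<times> real \<Rightarrow> real"
      by (rule smooth_on_compose_pair[OF opP opA'J that smfs(3)[OF opP] smaP(1)]) (auto simp: P_eq)
    show "smooth_on P \<psi>"
      unfolding \<psi>_def
    proof (rule smooth_on_Pair[OF opP smooth_on_diff[OF opP smfs(3)[OF opP] smooth_on_const[OF opP]]
          smooth_on_Pair[OF opP smaP(1) smooth_on_divide[OF opP _ smEP[OF E(1)]]]])
      show "smooth_on P (\<lambda>x. b x - (a x)\<^sup>2 * E1 (fst x, a x))"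
        by (rule smooth_on_diff[OF opP smaP(2) smooth_on_mult[OF opP smooth_on_power[OF opP smaP(1)]
                smEP[OF E(2)]]])
      show "E0 (fst x, a x) \<noteq> 0" if "x \<in> P" for x
        by (rule E0) (use that in \<open>auto simp: P_eq\<close>)
    qed
    have shift: "smooth_on Q (\<lambda>x. fst x + s0)"
      by (rule smooth_on_add[OF opQ smfs(3)[OF opQ] smooth_on_const[OF opQ]])
    have smQ: "smooth_on Q (\<lambda>x. g (fst x + s0))" if "smooth_on A' g" for g :: "real \<Rightarrow> real"
      by (rule smooth_on_compose[OF opQ A'(1) _ shift that]) (auto simp: Q_def)
    have smEQ: "smooth_on Q (\<lambda>x. g (fst x + s0, fst (snd x)))" if "smooth_on (A' \<times> J) g"
      for g :: "real \<times> real \<Rightarrow> real"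
      by (rule smooth_on_compose_pair[OF opQ opA'J that shift smfs(1)[OF opQ]]) (auto simp: Q_def)
    have yQ: "smooth_on Q (\<lambda>x. \<sigma> * fst (snd x) + y0 (fst x + s0))"
      by (rule smooth_on_add[OF opQ smooth_on_mult[OF opQ smooth_on_const[OF opQ] smfs(1)[OF opQ]] smQ[OF smA'(2)]])
    show "smooth_on Q \<psi>'"
      unfolding \<psi>'_def
    proof (rule smooth_on_Pair[OF opQ shift smooth_on_Pair[OF opQ yQ smooth_on_add[OF opQ _ smQ[OF smA'(3)]]]])
      show "smooth_on Q (\<lambda>x. \<sigma> * (snd (snd x) * E0 (fst x + s0, fst (snd x))
          + (fst (snd x))\<^sup>2 * E1 (fst x + s0, fst (snd x)))
          + \<tau> (fst x + s0) * (\<sigma> * fst (snd x) + y0 (fst x + s0)))"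
        by (rule smooth_on_add[OF opQ smooth_on_mult[OF opQ smooth_on_const[OF opQ] smooth_on_add[OF opQ
                  smooth_on_mult[OF opQ smfs(2)[OF opQ] smEQ[OF E(1)]]
                  smooth_on_mult[OF opQ smooth_on_power[OF opQ smfs(1)[OF opQ]] smEQ[OF E(2)]]]]
              smooth_on_mult[OF opQ smQ[OF smA'(1)] yQ]])
    qed
  qed

  have N'S: "(s, t) \<in> S" if "(s, t) \<in> N'" for s t
    using AB(2)[of s "t - \<tau> s"] N(3) that by (auto simp: N')
  have key: "f (s, t) \<in> P \<and> \<psi> (f (s, t)) = (s - s0, (v (s, t - \<tau> s))\<^sup>2, v (s, t - \<tau> s) ^ 3)"
    if st: "(s, t) \<in> N'" for s t
  proof -
    have m: "(s, t - \<tau> s) \<in> N" using st N' by simp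
    define w where "w = v (s, t - \<tau> s)"
    have w: "s \<in> A'" "w\<^sup>2 \<in> J" using v\<rho>[OF m] by (auto simp: w_def)
    have nz: "E0 (s, w\<^sup>2) \<noteq> 0" by (rule E0) (use w in simp)
    have a: "a (f (s, t)) = w\<^sup>2"
      using YZ[OF m] by (simp add: a_def f[OF N'S[OF st]] Y_def w_def)
    have b: "b (f (s, t)) = w ^ 3 * E0 (s, w\<^sup>2) + (w\<^sup>2)\<^sup>2 * E1 (s, w\<^sup>2)"
      using YZ[OF m] by (simp add: b_def f[OF N'S[OF st]] Z_def w_def)
    have fst: "fst (f (s, t)) = s" by (simp add: f[OF N'S[OF st]])
    show ?thesis
      using w nz by (simp add: P_eq \<psi>_def a b fst mem_Times_iff flip: w_def)
  qed
  have m0: "(s0, t0) \<in> N'" using N(2) \<tau>0 by (simp add: N')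
  have f0: "f (s0, t0) \<in> P" "\<psi> (f (s0, t0)) = (0, 0, 0)"
    using key[OF m0] v(2) \<tau>0 by auto
  let ?g = "\<lambda>(u :: real, v :: real). (u, v ^ 2, v ^ 3)"
  show ?thesis
    unfolding cuspidal_edge_at_def right_left_equivalent_def
  proof (intro conjI exI[of _ \<phi>] exI[of _ \<psi>])
    show "smooth_germ f (s0, t0)"
      unfolding smooth_germ_def
    proof (intro exI[of _ S] conjI S)
      show "smooth_on S f"
        by (rule smooth_on_cong[OF S(1) smooth_on_Pair[OF S(1) smooth_on_fst[OF S(1) smooth_on_id[OF S(1)]]
                smooth_on_Pair[OF S(1) y z]]]) (auto simp: f)
    qed
    show "smooth_germ ?g (0, 0)"
      unfolding smooth_germ_def
    proof (intro exI[of _ UNIV] conjI open_UNIV UNIV_I)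
      show "smooth_on UNIV ?g"
        by (rule smooth_on_cong[OF open_UNIV smooth_on_Pair[OF open_UNIV
                smooth_on_fst[OF open_UNIV smooth_on_id[OF open_UNIV]]
                smooth_on_Pair[OF open_UNIV
                  smooth_on_power[OF open_UNIV smooth_on_snd[OF open_UNIV smooth_on_id[OF open_UNIV]], of 2]
                  smooth_on_power[OF open_UNIV smooth_on_snd[OF open_UNIV smooth_on_id[OF open_UNIV]], of 3]]]])
          (simp add: case_prod_beta')
    qed
    have "\<phi> (s0, t0) = (0, 0)" using v(2) \<tau>0 by (simp add: \<phi>_def)
    then show "diffeomorphism_germ \<phi> (s0, t0) (0, 0)"
      unfolding diffeomorphism_germ_def using m0 diff\<phi> by blast
    show "diffeomorphism_germ \<psi> (f (s0, t0)) (?g (0, 0))"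
      unfolding diffeomorphism_germ_def
      by (rule exI[of _ P], rule exI[of _ Q], rule exI[of _ \<psi>']) (simp add: f0 diff\<psi>)
    have "\<forall>\<^sub>F w in nhds (s0, t0). w \<in> N'" by (rule eventually_nhds_in_open[OF opN' m0])
    then show "\<forall>\<^sub>F w in nhds (s0, t0). \<psi> (f w) = ?g (\<phi> w)"
    proof eventually_elim
      case (elim w)
      then show ?case using key[of "fst w" "snd w"] by (simp add: \<phi>_def)
    qed
  qed
qed

section \<open>Integral surfaces\<close>

text \<open>\<open>D_x\<close> to \<open>D_q\<close> are one-variable derivatives along coordinate
  lines. They become values of the Frechet derivative by the same chain rule that handles the given
  curve, which is why \<open>curve\<close> below is stated for arbitrary curves through the
  point.\<close>

lemma DERIV_along_curve:
  fixes \<alpha> :: "R5 \<Rightarrow> real"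
  assumes \<alpha>: "smooth_on D \<alpha>" "(x r, y r, z r, p r, q r) \<in> D"
    and x: "(x has_real_derivative x') (at r)" and y: "(y has_real_derivative y') (at r)"
    and z: "(z has_real_derivative z') (at r)" and p: "(p has_real_derivative p') (at r)"
    and q: "(q has_real_derivative q') (at r)"
  shows "((\<lambda>r. \<alpha> (x r, y r, z r, p r, q r)) has_real_derivative
    x' * D_x \<alpha> (x r, y r, z r, p r, q r) + y' * D_y \<alpha> (x r, y r, z r, p r, q r)
    + z' * D_z \<alpha> (x r, y r, z r, p r, q r) + p' * D_p \<alpha> (x r, y r, z r, p r, q r)
    + q' * D_q \<alpha> (x r, y r, z r, p r, q r)) (at r)"
proof -
  define L where "L = frechet_derivative \<alpha> (at (x r, y r, z r, p r, q r))"
  have der: "(\<alpha> has_derivative L) (at (x r, y r, z r, p r, q r))"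
    unfolding L_def by (rule smooth_on_has_derivative[OF \<alpha>])
  then have lin: "linear L" by (rule has_derivative_linear)
  have curve: "((\<lambda>u. \<alpha> (a u, b u, c u, d u, e u)) has_real_derivative L (a', b', c', d', e')) (at v)"
    if pt: "(a v, b v, c v, d v, e v) = (x r, y r, z r, p r, q r)"
      and "(a has_real_derivative a') (at v)" "(b has_real_derivative b') (at v)"
      "(c has_real_derivative c') (at v)" "(d has_real_derivative d') (at v)"
      "(e has_real_derivative e') (at v)" for a b c d e a' b' c' d' e' v
  proof -
    have "((\<lambda>u. (a u, b u, c u, d u, e u)) has_derivative
        (\<lambda>h. (a' * h, b' * h, c' * h, d' * h, e' * h))) (at v)"
      using that(2-6) unfolding has_field_derivative_def by (intro has_derivative_Pair)
    from has_derivative_compose[OF this, of \<alpha> L] der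
    have "((\<lambda>u. \<alpha> (a u, b u, c u, d u, e u)) has_derivative
        (\<lambda>h. L (a' * h, b' * h, c' * h, d' * h, e' * h))) (at v)"
      unfolding pt by blast
    moreover have "L (a' * h, b' * h, c' * h, d' * h, e' * h) = L (a', b', c', d', e') * h" for h
      using linear_scale[OF lin, of h "(a', b', c', d', e')"] by (simp add: mult.commute)
    ultimately have "((\<lambda>u. \<alpha> (a u, b u, c u, d u, e u)) has_derivative
        (\<lambda>h. L (a', b', c', d', e') * h)) (at v)"
      by (simp only:)
    then show ?thesis
      unfolding has_field_derivative_def .
  qed
  have part_x: "D_x \<alpha> (x r, y r, z r, p r, q r) = L (1, 0, 0, 0, 0)"
    unfolding D_x_def prod.case
    by (rule DERIV_imp_deriv[OF curve[where a = "\<lambda>u. u" and b = "\<lambda>_. y r"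
          and c = "\<lambda>_. z r" and d = "\<lambda>_. p r" and e = "\<lambda>_. q r" and v = "x r"]])
      (rule refl DERIV_ident DERIV_const)+
  have part_y: "D_y \<alpha> (x r, y r, z r, p r, q r) = L (0, 1, 0, 0, 0)"
    unfolding D_y_def prod.case
    by (rule DERIV_imp_deriv[OF curve[where a = "\<lambda>_. x r" and b = "\<lambda>u. u"
          and c = "\<lambda>_. z r" and d = "\<lambda>_. p r" and e = "\<lambda>_. q r" and v = "y r"]])
      (rule refl DERIV_ident DERIV_const)+
  have part_z: "D_z \<alpha> (x r, y r, z r, p r, q r) = L (0, 0, 1, 0, 0)"
    unfolding D_z_def prod.case
    by (rule DERIV_imp_deriv[OF curve[where a = "\<lambda>_. x r" and b = "\<lambda>_. y r"
          and c = "\<lambda>u. u" and d = "\<lambda>_. p r" and e = "\<lambda>_. q r" and v = "z r"]])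
      (rule refl DERIV_ident DERIV_const)+
  have part_p: "D_p \<alpha> (x r, y r, z r, p r, q r) = L (0, 0, 0, 1, 0)"
    unfolding D_p_def prod.case
    by (rule DERIV_imp_deriv[OF curve[where a = "\<lambda>_. x r" and b = "\<lambda>_. y r"
          and c = "\<lambda>_. z r" and d = "\<lambda>u. u" and e = "\<lambda>_. q r" and v = "p r"]])
      (rule refl DERIV_ident DERIV_const)+
  have part_q: "D_q \<alpha> (x r, y r, z r, p r, q r) = L (0, 0, 0, 0, 1)"
    unfolding D_q_def prod.case
    by (rule DERIV_imp_deriv[OF curve[where a = "\<lambda>_. x r" and b = "\<lambda>_. y r"
          and c = "\<lambda>_. z r" and d = "\<lambda>_. p r" and e = "\<lambda>u. u" and v = "q r"]])
      (rule refl DERIV_ident DERIV_const)+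
  have "(x', y', z', p', q') = x' *\<^sub>R (1, 0, 0, 0, 0) + y' *\<^sub>R (0, 1, 0, 0, 0)
      + z' *\<^sub>R (0, 0, 1, 0, 0) + p' *\<^sub>R (0, 0, 0, 1, 0) + q' *\<^sub>R (0, 0, 0, 0, 1)"
    by simp
  then have "L (x', y', z', p', q') = x' * L (1, 0, 0, 0, 0) + y' * L (0, 1, 0, 0, 0)
      + z' * L (0, 0, 1, 0, 0) + p' * L (0, 0, 0, 1, 0) + q' * L (0, 0, 0, 0, 1)"
    by (simp only: linear_add[OF lin] linear_scale[OF lin] real_scaleR_def)
  then show ?thesis
    using curve[where a = x and b = y and c = z and d = p and e = q and v = r, OF refl x y z p q]
    by (simp only: part_x part_y part_z part_p part_q)
qed

lemma smooth_on_deriv: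
  fixes f :: "real \<Rightarrow> real"
  assumes "smooth_on S f"
  shows "t \<in> S \<Longrightarrow> (f has_real_derivative deriv f t) (at t)"
    and "open S \<Longrightarrow> smooth_on S (deriv f)"
proof -
  have der: "(f has_real_derivative frechet_derivative f (at t) 1) (at t)" if "t \<in> S" for t
  proof -
    have f: "(f has_derivative frechet_derivative f (at t)) (at t)"
      by (rule smooth_on_has_derivative[OF assms that])
    have "frechet_derivative f (at t) h = frechet_derivative f (at t) 1 * h" for h
      using linear_scale[OF has_derivative_linear[OF f], of h 1] by (simp add: mult.commute)
    then have "frechet_derivative f (at t) = (*) (frechet_derivative f (at t) 1)"
      by (rule ext)
    with f show ?thesis unfolding has_field_derivative_def by metis
  qed
  then have eq: "frechet_derivative f (at t) 1 = deriv f t" if "t \<in> S" for t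
    using DERIV_imp_deriv[OF der[OF that]] by simp
  show "(f has_real_derivative deriv f t) (at t)" if "t \<in> S"
    using der[OF that] eq[OF that] by simp
  show "smooth_on S (deriv f)" if "open S"
    by (rule smooth_on_cong[OF that smooth_on_frechet_derivative[OF assms]]) (rule eq)
qed

lemma open_interval_convex: "open_interval I \<Longrightarrow> convex I"
  by (simp add: open_interval_def is_interval_convex)

text \<open>\<open>Phi2\<close> retains \<open>x\<close>, \<open>p\<close>, \<open>q\<close> and
  records \<open>z - p x - q y\<close>. So the component \<open>y\<close> of the inverse determines
  all the others.\<close>

lemma Phi2_inverse_components:
  assumes diff: "diffeomorphism_with_inverse W V (Phi2 \<alpha>) \<Psi>" and v: "(x0, x1, x2, x3, x4) \<in> V"
  shows "\<Psi> (x0, x1, x2, x3, x4) = (x0, phi2 \<Psi> (x0, x1, x2, x3, x4),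
      x2 + x3 * x0 + x4 * phi2 \<Psi> (x0, x1, x2, x3, x4), x3, x4)"
    and "\<alpha> (\<Psi> (x0, x1, x2, x3, x4)) = x1" and "\<Psi> (x0, x1, x2, x3, x4) \<in> W"
proof -
  obtain x y z p q where \<Psi>: "\<Psi> (x0, x1, x2, x3, x4) = (x, y, z, p, q)" by (metis prod.collapse)
  have "Phi2 \<alpha> (\<Psi> (x0, x1, x2, x3, x4)) = (x0, x1, x2, x3, x4)"
    using diff v unfolding diffeomorphism_with_inverse_def by blast
  then have "x = x0" "\<alpha> (x, y, z, p, q) = x1" "z - p * x - q * y = x2" "p = x3" "q = x4"
    by (auto simp: \<Psi> Phi2_def)
  then show "\<Psi> (x0, x1, x2, x3, x4) = (x0, phi2 \<Psi> (x0, x1, x2, x3, x4),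
      x2 + x3 * x0 + x4 * phi2 \<Psi> (x0, x1, x2, x3, x4), x3, x4)"
    and "\<alpha> (\<Psi> (x0, x1, x2, x3, x4)) = x1"
    using \<Psi> by (auto simp: phi2_def)
  show "\<Psi> (x0, x1, x2, x3, x4) \<in> W"
    using diff v unfolding diffeomorphism_with_inverse_def by blast
qed

lemma nongeneric_typeD:
  "nongeneric_type D \<alpha> \<Longrightarrow> (x, y, z, p, q) \<in> D \<Longrightarrow>
    x * (D_y \<alpha> (x, y, z, p, q) + q * D_z \<alpha> (x, y, z, p, q)) = - 1"
  unfolding nongeneric_type_def Let_def by fastforce

lemma involutive_typeD:
  "involutive_type D \<alpha> \<Longrightarrow> (x, y, z, p, q) \<in> D \<Longrightarrow>
    D_x \<alpha> (x, y, z, p, q) + p * D_z \<alpha> (x, y, z, p, q)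
      - \<alpha> (x, y, z, p, q) * (D_y \<alpha> (x, y, z, p, q) + q * D_z \<alpha> (x, y, z, p, q)) = 0"
  unfolding involutive_type_def Let_def by fastforce

text \<open>Along \<open>x0 \<mapsto> \<Psi> (x0, w)\<close> the involutivity condition reads \<open>(\<alpha> + y') (\<alpha>\<^sub>y + q \<alpha>\<^sub>z) = 0\<close>, whose
  second factor is nonzero by non-genericity; hence \<open>y' = - \<alpha>\<close> and \<open>y + \<alpha> x\<close> is constant.\<close>

lemma beta_bar_eq:
  assumes \<alpha>: "smooth_on D \<alpha>" "involutive_type D \<alpha>" "nongeneric_type D \<alpha>"
    and K: "open_interval K" and "W \<subseteq> D"
    and diff: "diffeomorphism_with_inverse W (K \<times> U2) (Phi2 \<alpha>) \<Psi>"
    and x0: "x0 \<in> K" and w: "w \<in> U2"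
  shows "beta \<alpha> (\<Psi> (x0, w)) = beta_bar \<alpha> K \<Psi> w"
proof -
  obtain x1 x2 x3 x4 where w_eq: "w = (x1, x2, x3, x4)" by (metis prod.collapse)
  have mem: "(r, x1, x2, x3, x4) \<in> K \<times> U2" if "r \<in> K" for r using that w w_eq by simp
  define y where "y r = phi2 \<Psi> (r, x1, x2, x3, x4)" for r
  have \<Psi>: "\<Psi> (r, x1, x2, x3, x4) = (r, y r, x2 + x3 * r + x4 * y r, x3, x4)"
    "\<alpha> (r, y r, x2 + x3 * r + x4 * y r, x3, x4) = x1"
    "(r, y r, x2 + x3 * r + x4 * y r, x3, x4) \<in> D" if "r \<in> K" for r
    using Phi2_inverse_components[OF diff mem[OF that]] \<open>W \<subseteq> D\<close> by (auto simp: y_def)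
  have K': "open K" "convex K" using K open_interval_convex by (auto simp: open_interval_def)
  have smooth: "smooth_on (K \<times> U2) \<Psi>" and op: "open (K \<times> U2)"
    using diff by (auto simp: diffeomorphism_with_inverse_def)
  have y': "(y has_real_derivative - x1) (at r)" if r: "r \<in> K" for r
  proof -
    have "((\<lambda>r. (r, x1, x2, x3, x4)) has_derivative (\<lambda>h. (h, 0))) (at r)"
      by (auto intro!: derivative_eq_intros simp: zero_prod_def)
    from has_derivative_compose[OF this smooth_on_has_derivative[OF smooth mem[OF r]]]
    have "((\<lambda>r. fst (snd (\<Psi> (r, x1, x2, x3, x4)))) has_derivative
        (\<lambda>h. fst (snd (frechet_derivative \<Psi> (at (r, x1, x2, x3, x4)) (h, 0))))) (at r)"
      by (intro has_derivative_fst has_derivative_snd)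
    then have "(\<lambda>r. fst (snd (\<Psi> (r, x1, x2, x3, x4)))) differentiable at r"
      unfolding differentiable_def by blast
    moreover have "(\<lambda>r. fst (snd (\<Psi> (r, x1, x2, x3, x4)))) = y"
      by (auto simp: y_def phi2_def split: prod.split)
    ultimately obtain d where d: "(y has_real_derivative d) (at r)"
      using real_differentiable_def by metis
    have dz: "((\<lambda>r. x2 + x3 * r + x4 * y r) has_real_derivative x3 + x4 * d) (at r)"
      using d by (auto intro!: derivative_eq_intros)
    let ?w = "(r, y r, x2 + x3 * r + x4 * y r, x3, x4)"
    have "((\<lambda>r. \<alpha> (r, y r, x2 + x3 * r + x4 * y r, x3, x4)) has_real_derivative
        1 * D_x \<alpha> ?w + d * D_y \<alpha> ?w + (x3 + x4 * d) * D_z \<alpha> ?w + 0 * D_p \<alpha> ?w + 0 * D_q \<alpha> ?w) (at r)"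
      by (rule DERIV_along_curve[OF \<alpha>(1) \<Psi>(3)[OF r] DERIV_ident d dz DERIV_const DERIV_const])
    moreover have "((\<lambda>r. \<alpha> (r, y r, x2 + x3 * r + x4 * y r, x3, x4)) has_real_derivative 0) (at r)"
      by (rule has_field_derivative_transform_within_open[where S = K and f = "\<lambda>_. x1"])
        (use K' r \<Psi>(2) in auto)
    ultimately have "D_x \<alpha> ?w + d * D_y \<alpha> ?w + (x3 + x4 * d) * D_z \<alpha> ?w = 0"
      using DERIV_unique by force
    moreover have "D_x \<alpha> ?w + x3 * D_z \<alpha> ?w - x1 * (D_y \<alpha> ?w + x4 * D_z \<alpha> ?w) = 0"
      using involutive_typeD[OF \<alpha>(2) \<Psi>(3)[OF r]] \<Psi>(2)[OF r] by simp
    ultimately have "(d + x1) * (D_y \<alpha> ?w + x4 * D_z \<alpha> ?w) = 0"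
      by (simp add: algebra_simps)
    moreover have "D_y \<alpha> ?w + x4 * D_z \<alpha> ?w \<noteq> 0"
      using nongeneric_typeD[OF \<alpha>(3) \<Psi>(3)[OF r]] by auto
    ultimately have "d = - x1" by simp
    then show ?thesis using d by simp
  qed
  have const: "y r + x1 * r = y x0 + x1 * x0" if r: "r \<in> K" for r
  proof -
    have "\<exists>c. \<forall>r\<in>K. y r + x1 * r = c"
    proof (rule has_field_derivative_zero_constant[OF K'(2)])
      show "((\<lambda>r. y r + x1 * r) has_field_derivative 0) (at r within K)" if "r \<in> K" for r
      proof -
        have "((\<lambda>r. y r + x1 * r) has_real_derivative - x1 + x1) (at r)"
          by (rule DERIV_add[OF y'[OF that] DERIV_cmult_Id])
        then show ?thesis by (simp add: has_field_derivative_at_within)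
      qed
    qed
    then show ?thesis using r x0 by auto
  qed
  have beta: "beta \<alpha> (\<Psi> (r, w)) = y x0 + x1 * x0" if "r \<in> K" for r
    using const[OF that] \<Psi>[OF that] by (simp add: w_eq beta_def)
  \<comment> \<open>The description in \<open>beta_bar\<close> has a unique solution because
    \<open>K\<close> contains \<open>x0\<close>.\<close>
  then have "beta_bar \<alpha> K \<Psi> w = y x0 + x1 * x0"
    unfolding beta_bar_def using x0 by (intro the_equality) auto
  then show ?thesis using beta[OF x0] by simp
qed

text \<open>The first component of \<open>f\<close> is \<open>s\<close> itself, so a nonzero
  \<open>t\<close>-derivative of \<open>y\<close> already makes the differential injective.\<close>

lemma D2_zero_if_singular:
  fixes y z :: "real \<times> real \<Rightarrow> real"
  assumes S: "open S" "(s, t) \<in> S" and y: "smooth_on S y" and z: "smooth_on S z"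
    and f: "\<And>s t. (s, t) \<in> S \<Longrightarrow> f (s, t) = (s, y (s, t), z (s, t))"
    and sing: "(s, t) \<in> singular_set T f"
  shows "D2 y (s, t) = 0"
proof (rule ccontr)
  assume nz: "D2 y (s, t) \<noteq> 0"
  define L where "L v = (fst v, fst v * D1 y (s, t) + snd v * D2 y (s, t),
    fst v * D1 z (s, t) + snd v * D2 z (s, t))" for v
  have "((\<lambda>x. (fst x, y x, z x)) has_derivative L) (at (s, t))"
    unfolding L_def
    by (intro has_derivative_Pair has_derivative_D1_D2[OF y S(2)] has_derivative_D1_D2[OF z S(2)]
        bounded_linear_imp_has_derivative bounded_linear_fst)
  then have der: "(f has_derivative L) (at (s, t))"
    by (rule has_derivative_transform_within_open[OF _ S]) (auto simp: f)
  then have eq: "frechet_derivative f (at (s, t)) = L" by (rule frechet_derivative_at[symmetric])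
  have lin: "linear L" by (rule has_derivative_linear[OF der])
  have "inj L"
    unfolding linear_injective_0[OF lin] using nz by (auto simp: L_def zero_prod_def prod_eq_iff)
  then have "dim (range L) = dim (UNIV :: (real \<times> real) set)"
    using dim_image_eq[OF lin, of UNIV] by (simp add: inj_on_subset)
  then show False using sing by (simp add: singular_set_def eq)
qed

theorem theorem6p36:
  fixes \<alpha> :: "R5 \<Rightarrow> real" and D W :: "R5 set" and \<Psi> :: "R5 \<Rightarrow> R5"
    and K :: "real set" and U2 :: "R4 set"
    and \<xi> \<mu> :: "real \<Rightarrow> real" and I2 J2 :: "real set" and s0 t0 :: real
  assumes "open D" and "smooth_on D \<alpha>"
    and "involutive_type D \<alpha>" and "nongeneric_type D \<alpha>"
    and "open_interval K" and "open U2" and "W \<subseteq> D"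
    and "diffeomorphism_with_inverse W (K \<times> U2) (Phi2 \<alpha>) \<Psi>"
    and "open_interval I2" and "open_interval J2"
    and "smooth_on J2 \<xi>" and "smooth_on J2 \<mu>"
    and "\<forall>s\<in>I2. \<forall>t\<in>J2. (s, deriv \<xi> t, \<mu> t, \<xi> t, t) \<in> K \<times> U2"
    and "\<forall>t\<in>J2. (\<mu> has_real_derivative - beta_bar \<alpha> K \<Psi> (deriv \<xi> t, \<mu> t, \<xi> t, t)) (at t)"
    and "(s0, t0) \<in> singular_set (I2 \<times> J2) (F2 \<Psi> \<xi> \<mu>)"
    and "deriv (\<lambda>t. ((\<lambda>w. D_q \<alpha> w + \<alpha> w * D_p \<alpha> w) \<circ> Theta2 \<Psi> \<xi> \<mu>) (s0, t)) t0
           - (deriv ^^ 3) \<xi> t0 \<noteq> 0"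
  shows "cuspidal_edge_at (F2 \<Psi> \<xi> \<mu>) (s0, t0)"
proof -
  note \<alpha> = assms(2-4) and diff = assms(8)
  have I2: "open I2" and J2: "open J2" using assms(9,10) by (auto simp: open_interval_def)
  have mem: "s0 \<in> I2" "t0 \<in> J2" using assms(15) by (auto simp: singular_set_def)
  let ?S = "I2 \<times> J2"
  have S: "open ?S" "(s0, t0) \<in> ?S" using I2 J2 mem by (auto simp: open_Times)
  note d = smooth_on_deriv(1) and sd = smooth_on_deriv(2)[OF _ J2]
  note sm\<xi> = assms(11) and sm\<mu> = assms(12)
  \<comment> \<open>On the surface \<open>x = s\<close> and \<open>\<alpha> = \<xi>'\<close>, so the
    equation for \<open>\<mu>\<close> reads \<open>\<mu>' = - (y + s \<xi>')\<close>; solved for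
    \<open>y\<close> it gives this formula.\<close>
  define y where "y = (\<lambda>(s, t). - deriv \<mu> t - s * deriv \<xi> t)"
  define z where "z = (\<lambda>(s, t). \<mu> t + s * \<xi> t + t * y (s, t))"
  define y' where "y' = (\<lambda>s t. - deriv (deriv \<mu>) t - s * deriv (deriv \<xi>) t)"
  have smt: "smooth_on ?S (\<lambda>x. g (snd x))" if "smooth_on J2 g" for g :: "real \<Rightarrow> real"
    by (rule smooth_on_compose[OF S(1) J2 _ smooth_on_snd[OF S(1) smooth_on_id[OF S(1)]] that]) auto
  have sms: "smooth_on ?S (\<lambda>x. fst x)" "smooth_on ?S (\<lambda>x. snd x)"
    by (rule smooth_on_fst[OF S(1) smooth_on_id[OF S(1)]],
        rule smooth_on_snd[OF S(1) smooth_on_id[OF S(1)]])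
  have smy: "smooth_on ?S y"
    unfolding y_def case_prod_beta'
    by (rule smooth_on_diff[OF S(1) smooth_on_uminus[OF S(1) smt[OF sd[OF sm\<mu>]]]
          smooth_on_mult[OF S(1) sms(1) smt[OF sd[OF sm\<xi>]]]])
  have smz: "smooth_on ?S z"
    unfolding z_def case_prod_beta' prod.collapse
    by (rule smooth_on_add[OF S(1) smooth_on_add[OF S(1) smt[OF sm\<mu>] smooth_on_mult[OF S(1) sms(1) smt[OF sm\<xi>]]]
          smooth_on_mult[OF S(1) sms(2) smy]])
  have dy: "((\<lambda>t. y (s, t)) has_real_derivative y' s t) (at t)" if "t \<in> J2" for s t
    unfolding y_def y'_def prod.case
    using d[OF sd[OF sm\<mu>] that] d[OF sd[OF sm\<xi>] that] by (auto intro!: derivative_eq_intros)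
  \<comment> \<open>The terms \<open>\<mu>' + s \<xi>' + y\<close> cancel by the choice of
    \<open>y\<close>, leaving \<open>t\<close> times the derivative of \<open>y\<close>.\<close>
  have dz: "((\<lambda>t. z (s, t)) has_real_derivative t * y' s t) (at t)" if "t \<in> J2" for s t
    unfolding z_def prod.case
    by (rule DERIV_cong[OF DERIV_add[OF DERIV_add[OF d[OF sm\<mu> that] DERIV_cmult[OF d[OF sm\<xi> that]]]
            DERIV_mult[OF DERIV_ident dy[OF that]]]])
      (simp add: y_def)
  have D2y: "D2 y (s, t) = y' s t" if "(s, t) \<in> ?S" for s t
    by (rule D2_eqI[OF smy that dy]) (use that in simp)
  have D2z: "D2 z (s, t) = t * D2 y (s, t)" if "(s, t) \<in> ?S" for s t
    unfolding D2y[OF that] by (rule D2_eqI[OF smz that dz]) (use that in simp)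
  have V: "(s, deriv \<xi> t, \<mu> t, \<xi> t, t) \<in> K \<times> U2" if "(s, t) \<in> ?S" for s t
    using assms(13) that by blast
  note Psi = Phi2_inverse_components[OF diff V]
  have phi: "phi2 \<Psi> (s, deriv \<xi> t, \<mu> t, \<xi> t, t) = y (s, t)" if st: "(s, t) \<in> ?S" for s t
  proof -
    let ?v = "(s, deriv \<xi> t, \<mu> t, \<xi> t, t)"
    have "beta \<alpha> (\<Psi> ?v) = beta_bar \<alpha> K \<Psi> (deriv \<xi> t, \<mu> t, \<xi> t, t)"
      using V[OF st] by (intro beta_bar_eq[OF \<alpha> assms(5,7) diff]) auto
    also have "\<dots> = - deriv \<mu> t"
      using DERIV_imp_deriv[of \<mu> _ t] assms(14) st by fastforce
    finally have "beta \<alpha> (\<Psi> ?v) = - deriv \<mu> t" .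
    moreover have "beta \<alpha> (\<Psi> ?v) = phi2 \<Psi> ?v + deriv \<xi> t * s"
    proof -
      note \<Psi> = Psi(1)[OF st]
      have "\<alpha> (s, phi2 \<Psi> ?v, \<mu> t + \<xi> t * s + t * phi2 \<Psi> ?v, \<xi> t, t) = deriv \<xi> t"
        using Psi(2)[OF st] by (simp only: \<Psi>)
      then show ?thesis by (simp only: \<Psi> beta_def prod.case)
    qed
    ultimately show ?thesis by (simp add: y_def algebra_simps)
  qed
  have Theta: "Theta2 \<Psi> \<xi> \<mu> (s, t) = (s, y (s, t), z (s, t), \<xi> t, t)" if st: "(s, t) \<in> ?S" for s t
    using Psi(1)[OF st] phi[OF st] by (simp add: Theta2_def z_def mult.commute)
  have F2: "F2 \<Psi> \<xi> \<mu> (s, t) = (s, y (s, t), z (s, t))" if "(s, t) \<in> ?S" for s t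
    using Theta[OF that] phi[OF that] by (simp add: F2_def Theta2_def psi2_def)
  have in_D: "(s, y (s, t), z (s, t), \<xi> t, t) \<in> D"
    and \<alpha>_eq: "\<alpha> (s, y (s, t), z (s, t), \<xi> t, t) = deriv \<xi> t" if st: "(s, t) \<in> ?S" for s t
  proof -
    have \<Psi>: "\<Psi> (s, deriv \<xi> t, \<mu> t, \<xi> t, t) = (s, y (s, t), z (s, t), \<xi> t, t)"
      using Theta[OF st] by (simp add: Theta2_def)
    show "(s, y (s, t), z (s, t), \<xi> t, t) \<in> D"
      using Psi(3)[OF st] assms(7) unfolding \<Psi> by blast
    show "\<alpha> (s, y (s, t), z (s, t), \<xi> t, t) = deriv \<xi> t"
      using Psi(2)[OF st] unfolding \<Psi> .
  qed
  have y1: "D2 y (s0, t0) = 0"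
    by (rule D2_zero_if_singular[OF S smy smz F2 assms(15)])
  \<comment> \<open>Non-genericity excludes \<open>x = 0\<close> from \<open>D\<close>, so
    \<open>s0\<close> may serve as a denominator.\<close>
  have s0: "s0 \<noteq> 0" using nongeneric_typeD[OF \<alpha>(3) in_D[OF S(2)]] by auto
  \<comment> \<open>Along \<open>t\<close> the coordinates \<open>p = \<xi> t\<close> and
    \<open>q = t\<close> have derivatives \<open>\<xi>' = \<alpha>\<close> and 1, which produces
    \<open>\<alpha>\<^sub>q + \<alpha> \<alpha>\<^sub>p\<close>. The \<open>y\<close> and
    \<open>z\<close> terms combine into \<open>y\<^sub>t (\<alpha>\<^sub>y + t \<alpha>\<^sub>z) = -
    y\<^sub>t / s0\<close>.\<close>
  have G: "((\<lambda>w. D_q \<alpha> w + \<alpha> w * D_p \<alpha> w) \<circ> Theta2 \<Psi> \<xi> \<mu>) (s0, t)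
      = deriv (deriv \<xi>) t + D2 y (s0, t) / s0" if t: "t \<in> J2" for t
  proof -
    have st: "(s0, t) \<in> ?S" using mem t by simp
    let ?w = "(s0, y (s0, t), z (s0, t), \<xi> t, t)"
    have "((\<lambda>t. \<alpha> (s0, y (s0, t), z (s0, t), \<xi> t, t)) has_real_derivative
        0 * D_x \<alpha> ?w + y' s0 t * D_y \<alpha> ?w + t * y' s0 t * D_z \<alpha> ?w + deriv \<xi> t * D_p \<alpha> ?w
        + 1 * D_q \<alpha> ?w) (at t)"
      by (rule DERIV_along_curve[OF \<alpha>(1) in_D[OF st] DERIV_const dy[OF t] dz[OF t] d[OF sm\<xi> t] DERIV_ident])
    moreover have "((\<lambda>t. \<alpha> (s0, y (s0, t), z (s0, t), \<xi> t, t)) has_real_derivative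
        deriv (deriv \<xi>) t) (at t)"
      by (rule has_field_derivative_transform_within_open[OF d[OF sd[OF sm\<xi>] t] J2 t])
        (use \<alpha>_eq mem in simp)
    ultimately have eq: "y' s0 t * (D_y \<alpha> ?w + t * D_z \<alpha> ?w) + deriv \<xi> t * D_p \<alpha> ?w + D_q \<alpha> ?w
        = deriv (deriv \<xi>) t"
      using DERIV_unique by (force simp: algebra_simps)
    have "D_y \<alpha> ?w + t * D_z \<alpha> ?w = - 1 / s0"
      using nongeneric_typeD[OF \<alpha>(3) in_D[OF st]] s0 by (simp add: field_simps)
    with eq show ?thesis
      by (simp add: Theta[OF st] \<alpha>_eq[OF st] D2y[OF st] algebra_simps)
  qed
  have "((\<lambda>t. ((\<lambda>w. D_q \<alpha> w + \<alpha> w * D_p \<alpha> w) \<circ> Theta2 \<Psi> \<xi> \<mu>) (s0, t)) has_real_derivative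
      deriv (deriv (deriv \<xi>)) t0 + D2 (D2 y) (s0, t0) / s0) (at t0)"
  proof (rule has_field_derivative_transform_within_open[OF _ J2 mem(2)])
    show "((\<lambda>t. deriv (deriv \<xi>) t + D2 y (s0, t) / s0) has_real_derivative
        deriv (deriv (deriv \<xi>)) t0 + D2 (D2 y) (s0, t0) / s0) (at t0)"
      by (rule DERIV_add[OF d[OF sd[OF sd[OF sm\<xi>]] mem(2)]
            DERIV_cdivide[OF D2_DERIV[OF smooth_on_D2[OF smy] S(2)]]])
  qed (simp only: G)
  \<comment> \<open>The third derivative of \<open>\<xi>\<close> cancels, and the hypothesis becomes
    \<open>D2 (D2 y) (s0, t0) / s0 \<noteq> 0\<close>.\<close>
  from DERIV_imp_deriv[OF this] assms(16) have y2: "D2 (D2 y) (s0, t0) \<noteq> 0"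
    by (auto simp: numeral_3_eq_3)
  show ?thesis
    by (rule cuspidal_edge_of_front[OF S smy smz F2 D2z y1 y2])
qed

end
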